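(* For every positive integer $q$, there is a polynomial-time algorithm for the Maximum Weight Independent Set problem in the class of $K_{1,q}$-induced-minor-free graphs.
   Context: All graphs are finite, simple and undirected. Maximum Weight Independent Set: given a graph $G$ and a weight function $w:V(G)\to\mathbb{Q}_+$, find an independent set $I$ in $G$ (a set of pairwise nonadjacent vertices) maximizing $w(I)=\sum_{x\in I}w(x)$. $K_{1,q}$ is the complete bipartite graph (star) with parts of sizes $1$ and $q$. $H$ is an induced minor of $G$ if a graph isomorphic to $H$ can be obtained from $G$ by a sequence of vertex deletions and edge contractions (with resulting parallel edges identified); $G$ is $H$-induced-minor-free if this is not the case. The integer $q$ is fixed (not part of the input), and the input graph is promised to be in the class. *)

theory Defs
  imports
    "HOL-Computational_Algebra.Polynomial"
    "HOL-Library.Log_Nat"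
begin

section \<open>Graphs and induced minors\<close>

record 'a ugraph =
  verts :: "'a set"
  edges :: "'a set set"

definition simple_graph :: "'a ugraph \<Rightarrow> bool" where
  "simple_graph G \<longleftrightarrow> finite (verts G) \<and> (\<forall>e\<in>edges G. e \<subseteq> verts G \<and> card e = 2)"

definition graph_iso :: "'a ugraph \<Rightarrow> 'b ugraph \<Rightarrow> bool" where
  "graph_iso G H \<longleftrightarrow>
     (\<exists>f. bij_betw f (verts G) (verts H) \<and>
          (\<forall>u\<in>verts G. \<forall>v\<in>verts G. {u, v} \<in> edges G \<longleftrightarrow> {f u, f v} \<in> edges H))"

definition delete_vertex :: "'a ugraph \<Rightarrow> 'a \<Rightarrow> 'a ugraph" where
  "delete_vertex G v = \<lparr>verts = verts G - {v}, edges = {e \<in> edges G. v \<notin> e}\<rparr>"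

text \<open>Contraction of the edge \<open>uv\<close>; the vertex it produces keeps the name \<open>u\<close>. Since the edges
  form a set, parallel edges are identified.\<close>

definition contract_edge :: "'a ugraph \<Rightarrow> 'a \<Rightarrow> 'a \<Rightarrow> 'a ugraph" where
  "contract_edge G u v =
     \<lparr>verts = verts G - {v},
      edges = {e \<in> edges G. v \<notin> e} \<union> {{u, x} | x. {v, x} \<in> edges G \<and> x \<noteq> u}\<rparr>"

inductive minor_step :: "'a ugraph \<Rightarrow> 'a ugraph \<Rightarrow> bool" where
  delete: "v \<in> verts G \<Longrightarrow> minor_step G (delete_vertex G v)"
| contract: "{u, v} \<in> edges G \<Longrightarrow> minor_step G (contract_edge G u v)"

definition induced_minor :: "'b ugraph \<Rightarrow> 'a ugraph \<Rightarrow> bool" where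
  "induced_minor H G \<longleftrightarrow> (\<exists>G'. minor_step\<^sup>*\<^sup>* G G' \<and> graph_iso G' H)"

text \<open>The star \<open>K\<^sub>1\<^sub>,\<^sub>q\<close> with centre \<open>0\<close> and leaves \<open>1, \<dots>, q\<close>.\<close>

definition star :: "nat \<Rightarrow> nat ugraph" where
  "star q = \<lparr>verts = {0..q}, edges = {{0, i} | i. i \<in> {1..q}}\<rparr>"

definition independent :: "'a ugraph \<Rightarrow> 'a set \<Rightarrow> bool" where
  "independent G I \<longleftrightarrow> I \<subseteq> verts G \<and> (\<forall>u\<in>I. \<forall>v\<in>I. {u, v} \<notin> edges G)"

definition max_weight_independent :: "'a ugraph \<Rightarrow> ('a \<Rightarrow> rat) \<Rightarrow> 'a set \<Rightarrow> bool" where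
  "max_weight_independent G w I \<longleftrightarrow>
     independent G I \<and> (\<forall>J. independent G J \<longrightarrow> sum w J \<le> sum w I)"


section \<open>Polynomial time\<close>

text \<open>The machine model is the random access machine with the logarithmic cost criterion
  (Aho, Hopcroft and Ullman), programmed by structured commands instead of jumps. A program
  mentions finitely many registers and finitely many arrays; both hold natural numbers of
  arbitrary size, and array cells are addressed indirectly. Every number that is read,
  computed, or used as an address is charged its binary length, so that running times are
  polynomially related to those of Turing machines.\<close>

datatype arith = Add | Sub | Mul | Div

fun apply_arith :: "arith \<Rightarrow> nat \<Rightarrow> nat \<Rightarrow> nat" where
  "apply_arith Add m n = m + n"
| "apply_arith Sub m n = m - n"
| "apply_arith Mul m n = m * n"
| "apply_arith Div m n = m div n"

text \<open>\<open>Cell a e\<close> is the cell of array \<open>a\<close> whose address is the value of \<open>e\<close>.\<close>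

datatype expr = Const nat | Reg nat | Cell nat expr | Arith arith expr expr

datatype com =
    Skip
  | Assign nat expr
  | Store nat expr expr
  | Seq com com
  | Cond expr com com
  | While expr com

record state =
  regs :: "nat \<Rightarrow> nat"
  arrays :: "nat \<Rightarrow> nat \<Rightarrow> nat"

text \<open>The length of the binary representation; \<open>0\<close> is written with one digit.\<close>

definition bit_len :: "nat \<Rightarrow> nat" where
  "bit_len n = max 1 (floorlog 2 n)"

fun eval_expr :: "expr \<Rightarrow> state \<Rightarrow> nat" where
  "eval_expr (Const n) s = n"
| "eval_expr (Reg x) s = regs s x"
| "eval_expr (Cell a e) s = arrays s a (eval_expr e s)"
| "eval_expr (Arith f e1 e2) s = apply_arith f (eval_expr e1 s) (eval_expr e2 s)"

fun cost_expr :: "expr \<Rightarrow> state \<Rightarrow> nat" where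
  "cost_expr (Const n) s = bit_len n"
| "cost_expr (Reg x) s = bit_len (regs s x)"
| "cost_expr (Cell a e) s = cost_expr e s + bit_len (eval_expr (Cell a e) s)"
| "cost_expr (Arith f e1 e2) s =
     cost_expr e1 s + cost_expr e2 s + bit_len (eval_expr (Arith f e1 e2) s)"

text \<open>\<open>exec c s t s'\<close>: started in \<open>s\<close>, the command \<open>c\<close> halts in \<open>s'\<close> at cost \<open>t\<close>. Conditions
  count as true iff their value is nonzero. By determinism (below), the existence of a
  derivation means that the run from \<open>s\<close> terminates.\<close>

inductive exec :: "com \<Rightarrow> state \<Rightarrow> nat \<Rightarrow> state \<Rightarrow> bool" where
  Skip: "exec Skip s 1 s"
| Assign: "exec (Assign x e) s (cost_expr e s) (s\<lparr>regs := (regs s)(x := eval_expr e s)\<rparr>)"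
| Store: "exec (Store a e1 e2) s (cost_expr e1 s + cost_expr e2 s)
     (s\<lparr>arrays := (arrays s)(a := (arrays s a)(eval_expr e1 s := eval_expr e2 s))\<rparr>)"
| Seq: "exec c1 s t1 s' \<Longrightarrow> exec c2 s' t2 s'' \<Longrightarrow> exec (Seq c1 c2) s (t1 + t2) s''"
| CondTrue: "eval_expr e s \<noteq> 0 \<Longrightarrow> exec c1 s t s' \<Longrightarrow>
     exec (Cond e c1 c2) s (cost_expr e s + t) s'"
| CondFalse: "eval_expr e s = 0 \<Longrightarrow> exec c2 s t s' \<Longrightarrow>
     exec (Cond e c1 c2) s (cost_expr e s + t) s'"
| WhileTrue: "eval_expr e s \<noteq> 0 \<Longrightarrow> exec c s t1 s' \<Longrightarrow> exec (While e c) s' t2 s'' \<Longrightarrow>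
     exec (While e c) s (cost_expr e s + t1 + t2) s''"
| WhileFalse: "eval_expr e s = 0 \<Longrightarrow> exec (While e c) s (cost_expr e s) s"

inductive_cases exec_SkipE: "exec Skip s t s'"
inductive_cases exec_AssignE: "exec (Assign x e) s t s'"
inductive_cases exec_StoreE: "exec (Store a e1 e2) s t s'"
inductive_cases exec_SeqE: "exec (Seq c1 c2) s t s'"
inductive_cases exec_CondE: "exec (Cond e c1 c2) s t s'"
inductive_cases exec_WhileE: "exec (While e c) s t s'"

lemma exec_deterministic:
  "exec c s t s' \<Longrightarrow> exec c s u r \<Longrightarrow> t = u \<and> s' = r"
proof (induction arbitrary: u r rule: exec.induct)
  case (Seq c1 s t1 s' c2 t2 s'')
  from Seq.prems obtain u1 u2 r'
    where "exec c1 s u1 r'" "exec c2 r' u2 r" "u = u1 + u2"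
    by (rule exec_SeqE)
  with Seq.IH show ?case by metis
next
  case (CondTrue e s c1 t s' c2)
  from CondTrue.prems CondTrue.hyps(1) obtain u1
    where "exec c1 s u1 r" "u = cost_expr e s + u1"
    by (auto elim: exec_CondE)
  with CondTrue.IH show ?case by metis
next
  case (CondFalse e s c2 t s' c1)
  from CondFalse.prems CondFalse.hyps(1) obtain u1
    where "exec c2 s u1 r" "u = cost_expr e s + u1"
    by (auto elim: exec_CondE)
  with CondFalse.IH show ?case by metis
next
  case (WhileTrue e s c t1 s' t2 s'')
  from WhileTrue.prems WhileTrue.hyps(1) obtain u1 u2 r'
    where "exec c s u1 r'" "exec (While e c) r' u2 r" "u = cost_expr e s + u1 + u2"
    by (auto elim: exec_WhileE)
  with WhileTrue.IH show ?case by metis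
qed (auto elim: exec_SkipE exec_AssignE exec_StoreE exec_WhileE)

text \<open>A list is stored in an array with its length in cell \<open>0\<close> and its entries in the cells
  after that. The input is the list in array \<open>0\<close> (everything else is initially \<open>0\<close>), and the
  output is the list in array \<open>1\<close> of the final state.\<close>

definition initial_state :: "nat list \<Rightarrow> state" where
  "initial_state xs =
     \<lparr>regs = (\<lambda>_. 0),
      arrays = (\<lambda>_ _. 0)
        (0 := (\<lambda>i. if i = 0 then length xs else if i \<le> length xs then xs ! (i - 1) else 0))\<rparr>"

definition output_list :: "state \<Rightarrow> nat list" where
  "output_list s = map (arrays s 1) [1..<Suc (arrays s 1 0)]"

definition input_size :: "nat list \<Rightarrow> nat" where
  "input_size xs = (\<Sum>x\<leftarrow>xs. bit_len x)"

text \<open>The search problem of finding, for an instance \<open>x\<close>, some \<open>ys\<close> with \<open>sol x ys\<close>, under the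
  promise that \<open>x\<close> belongs to \<open>X\<close>: nothing is required of the program on other inputs.\<close>

definition poly_time_solvable ::
    "('i \<Rightarrow> nat list) \<Rightarrow> ('i \<Rightarrow> nat list \<Rightarrow> bool) \<Rightarrow> 'i set \<Rightarrow> bool" where
  "poly_time_solvable enc sol X \<longleftrightarrow>
     (\<exists>(c :: com) (p :: nat poly). \<forall>x\<in>X. \<exists>t s.
        exec c (initial_state (enc x)) t s \<and>
        t \<le> poly p (input_size (enc x)) \<and>
        sol x (output_list s))"


section \<open>Maximum Weight Independent Set\<close>

text \<open>A weighted graph on the vertices \<open>0, \<dots>, n - 1\<close> is given by \<open>n\<close>, the rows of its adjacency
  matrix, and the numerator and denominator (in lowest terms) of each weight.\<close>

fun encode_mwis :: "nat ugraph \<times> (nat \<Rightarrow> rat) \<Rightarrow> nat list" where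
  "encode_mwis (G, w) =
     (let n = card (verts G) in
        n # [if {i, j} \<in> edges G then 1 else 0. i \<leftarrow> [0..<n], j \<leftarrow> [0..<n]]
          @ concat (map (\<lambda>i. case quotient_of (w i) of (a, b) \<Rightarrow> [nat a, nat b]) [0..<n]))"

fun mwis_solution :: "nat ugraph \<times> (nat \<Rightarrow> rat) \<Rightarrow> nat list \<Rightarrow> bool" where
  "mwis_solution (G, w) ys \<longleftrightarrow> distinct ys \<and> max_weight_independent G w (set ys)"

definition mwis_poly_time :: "nat ugraph set \<Rightarrow> bool" where
  "mwis_poly_time \<C> \<longleftrightarrow>
     poly_time_solvable encode_mwis mwis_solution
       {(G, w). G \<in> \<C> \<and> simple_graph G \<and> verts G = {0..<card (verts G)} \<and>
          (\<forall>v\<in>verts G. 0 \<le> w v)}"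

end

theory Submission
  imports Defs "HOL-Library.Nat_Bijection"
begin

text \<open>Let \<open>C\<close> be a connected vertex set of a graph without an induced minor \<open>K\<^sub>1\<^sub>,\<^sub>q\<close>. Then the
  neighbourhood of \<open>C\<close> contains no \<open>q\<close> independent vertices: contracting \<open>C\<close> to a single vertex
  and deleting all other vertices would leave the star (\<open>card_independent_neighbours_less\<close>).

  Breadth-first search grows a connected set by adding its whole neighbourhood at once, so each
  layer that it produces meets every independent set in fewer than \<open>q\<close> vertices; a layer that
  starts a new component is a single vertex. Thus \<open>V(G)\<close> splits into at most \<open>n\<close> layers, edges
  only join vertices of equal or consecutive layers, and an independent set has at most \<open>q\<close>
  vertices in a layer (\<open>partial_layering_Suc\<close>). This makes the problem a longest path problem:
  its nodes are the pairs of a layer and an independent set of at most \<open>q\<close> vertices in it, and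
  two such sets in consecutive layers are joined if their union is independent. There are at most
  \<open>(n + 1)\<^sup>q\<close> nodes per layer, and dynamic programming over the layers finds the optimum
  (\<open>table_inv_step\<close>, \<open>table_inv_optimal\<close>).

  The table stores nothing but numbers. The weights are multiplied by a common denominator and by
  \<open>2\<^sup>n\<close>, and \<open>2\<^sup>i\<close> is added to the weight of vertex \<open>i\<close>. A sum of the new weights
  orders the sets as before, except for ties, and its \<open>n\<close> lowest bits are the characteristic vector of the
  set, so the optimal set is read off from the optimal value (\<open>code_weight_reflects_order\<close>,
  \<open>code_weight_bit\<close>).

  The program \<open>mwis_code q\<close> carries this out. Its running time is bounded by two separate
  counts. All numbers in the memory stay below \<open>2 ^ B\<close> for some \<open>B\<close> linear in the input
  size, so every command costs at most \<open>B\<close> times a constant that depends on \<open>q\<close>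
  (\<open>cost_expr_bound\<close>); and the nested loops execute at most \<open>steps q n\<close> commands, a polynomial
  in \<open>n\<close>. The relation \<open>runs\<close> keeps track of both together with the functional behaviour.\<close>

section \<open>Stars as induced minors\<close>

text \<open>Connectivity is expressed by cuts instead of paths: a cut is easily transported through a
  contraction and through the addition of neighbours, the two operations by which connected sets
  change below.\<close>
definition connected_in :: "'a ugraph \<Rightarrow> 'a set \<Rightarrow> bool" where
  "connected_in G C \<longleftrightarrow>
     (\<forall>X. X \<subseteq> C \<and> X \<noteq> {} \<and> X \<noteq> C \<longrightarrow> (\<exists>x\<in>X. \<exists>y\<in>C - X. {x, y} \<in> edges G))"

lemma connected_inD:
  assumes "connected_in G C" "X \<subseteq> C" "X \<noteq> {}" "X \<noteq> C"
  obtains x y where "x \<in> X" "y \<in> C" "y \<notin> X" "{x, y} \<in> edges G"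
proof -
  have "\<exists>x\<in>X. \<exists>y\<in>C - X. {x, y} \<in> edges G"
    using assms(1)[unfolded connected_in_def, rule_format, of X] assms(2-4) by blast
  then show thesis using that by blast
qed

lemma connected_in_extend:
  assumes "connected_in G C" and "\<forall>d\<in>D. \<exists>c\<in>C. {c, d} \<in> edges G"
  shows "connected_in G (C \<union> D)"
  unfolding connected_in_def
proof (intro allI impI, elim conjE)
  fix X assume X: "X \<subseteq> C \<union> D" "X \<noteq> {}" "X \<noteq> C \<union> D"
  consider "X \<inter> C = {}" | "C \<subseteq> X" | "X \<inter> C \<noteq> {}" "X \<inter> C \<noteq> C" by blast
  then show "\<exists>x\<in>X. \<exists>y\<in>C \<union> D - X. {x, y} \<in> edges G"
  proof cases
    case 1
    then obtain d where "d \<in> X" "d \<in> D" using X by blast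
    with assms(2) obtain c where "c \<in> C" "{d, c} \<in> edges G" by (metis insert_commute)
    with 1 \<open>d \<in> X\<close> show ?thesis by blast
  next
    case 2
    then obtain d where "d \<notin> X" "d \<in> D" using X by blast
    with 2 assms(2) show ?thesis by blast
  next
    case 3
    from connected_inD[OF assms(1) _ 3] obtain x y
      where "x \<in> X \<inter> C" "y \<in> C" "y \<notin> X \<inter> C" "{x, y} \<in> edges G" by blast
    then show ?thesis by blast
  qed
qed

lemma simple_graph_delete: "simple_graph G \<Longrightarrow> simple_graph (delete_vertex G v)"
  unfolding simple_graph_def delete_vertex_def by auto

lemma simple_graph_edgeD:
  assumes "simple_graph G" "{u, v} \<in> edges G"
  shows "u \<in> verts G" "v \<in> verts G" "u \<noteq> v"
proof -
  from assms have "{u, v} \<subseteq> verts G" "card {u, v} = 2" unfolding simple_graph_def by blast+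
  then show "u \<in> verts G" "v \<in> verts G" "u \<noteq> v" by auto
qed

lemma simple_graph_contract:
  assumes "simple_graph G" "{u, v} \<in> edges G"
  shows "simple_graph (contract_edge G u v)"
  unfolding simple_graph_def contract_edge_def ugraph.simps
proof (intro conjI ballI)
  show "finite (verts G - {v})" using assms(1) unfolding simple_graph_def by simp
  fix e assume "e \<in> {e \<in> edges G. v \<notin> e} \<union> {{u, x} |x. {v, x} \<in> edges G \<and> x \<noteq> u}"
  then consider "e \<in> edges G" "v \<notin> e" | x where "e = {u, x}" "{v, x} \<in> edges G" "x \<noteq> u"
    by blast
  then have "e \<subseteq> verts G - {v} \<and> card e = 2"
  proof cases
    case 1 then show ?thesis using assms(1) unfolding simple_graph_def by blast
  next
    case 2 then show ?thesis
      using simple_graph_edgeD[OF assms] simple_graph_edgeD[OF assms(1) 2(2)] by auto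
  qed
  then show "e \<subseteq> verts G - {v}" "card e = 2" by auto
qed

text \<open>A cut of the contracted set lifts to a cut of \<open>C\<close>, with \<open>v\<close> put on the side of \<open>u\<close>; an
  edge at \<open>v\<close> that crosses the lifted cut becomes an edge at \<open>u\<close>.\<close>
lemma connected_in_contract:
  assumes "connected_in G C" "u \<in> C" "v \<in> C" "u \<noteq> v"
  shows "connected_in (contract_edge G u v) (C - {v})"
  unfolding connected_in_def
proof (intro allI impI, elim conjE)
  fix X assume X: "X \<subseteq> C - {v}" "X \<noteq> {}" "X \<noteq> C - {v}"
  \<comment> \<open>the cut of the uncontracted set\<close>
  define Y where "Y = (if u \<in> X then insert v X else X)"
  have "Y \<subseteq> C" "Y \<noteq> {}" "Y \<noteq> C" using X assms unfolding Y_def by auto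
  from connected_inD[OF assms(1) this] obtain x y
    where xy: "x \<in> Y" "y \<in> C" "y \<notin> Y" "{x, y} \<in> edges G" .
  have xX: "x \<in> X" if "x \<noteq> v" using xy(1) that unfolding Y_def by (auto split: if_splits)
  have yX: "y \<notin> X" using xy(3) unfolding Y_def by (auto split: if_splits)
  consider "x = v" | "y = v" | "x \<noteq> v" "y \<noteq> v" by blast
  then show "\<exists>x\<in>X. \<exists>y\<in>C - {v} - X. {x, y} \<in> edges (contract_edge G u v)"
  proof cases
    case 1
    then have u: "u \<in> X" using xy(1) X unfolding Y_def by (auto split: if_splits)
    then have "y \<noteq> u" "y \<noteq> v" using xy(3) unfolding Y_def by auto
    moreover from this have "{u, y} \<in> edges (contract_edge G u v)"
      using xy(4) 1 unfolding contract_edge_def by auto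
    ultimately show ?thesis using u xy(2) yX by blast
  next
    case 2
    then have u: "u \<notin> X" "x \<noteq> v" using xy(1,3) unfolding Y_def by (auto split: if_splits)
    then have "x \<in> X" "x \<noteq> u" using xX by auto
    moreover from this have "{u, x} \<in> edges (contract_edge G u v)"
      using xy(4) 2 unfolding contract_edge_def by (auto simp: insert_commute)
    moreover have "u \<in> C - {v} - X" using u assms(2,4) by blast
    ultimately show ?thesis by (metis insert_commute)
  next
    case 3
    then have "{x, y} \<in> edges (contract_edge G u v)" using xy(4) unfolding contract_edge_def by auto
    then show ?thesis using 3 xX yX xy(2) by blast
  qed
qed

lemma star_isoI:
  assumes "simple_graph G" "verts G = insert c I" "c \<notin> I" "card I = q"
    "independent G I" "\<forall>i\<in>I. {c, i} \<in> edges G"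
  shows "graph_iso G (star q)"
proof -
  have "finite I" using assms(1,2) unfolding simple_graph_def by simp
  then obtain g where g: "bij_betw g I {1..q}"
    using assms(4) by (metis bij_betw_iff_card card_atLeastAtMost diff_Suc_1 finite_atLeastAtMost)
  define f where "f x = (if x = c then 0 else g x)" for x
  have fI: "f x \<in> {1..q}" if "x \<in> I" for x
    using g that assms(3) unfolding f_def bij_betw_def by auto
  have "bij_betw f I {1..q}"
    using g by (rule bij_betw_cong[THEN iffD1, rotated]) (use assms(3) in \<open>auto simp: f_def\<close>)
  moreover have "bij_betw f {c} {0}" by (simp add: f_def)
  ultimately have "bij_betw f ({c} \<union> I) ({0} \<union> {1..q})"
    by (intro bij_betw_combine) auto
  moreover have "{0} \<union> {1..q} = verts (star q)" by (auto simp: star_def)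
  ultimately have bij: "bij_betw f (verts G) (verts (star q))" using assms(2) by simp
  have star_edge: "{a, b} \<in> edges (star q) \<longleftrightarrow> (a = 0 \<and> b \<in> {1..q} \<or> b = 0 \<and> a \<in> {1..q})" for a b
    unfolding star_def by (auto simp: doubleton_eq_iff)
  have "{u, v} \<in> edges G \<longleftrightarrow> {f u, f v} \<in> edges (star q)"
    if uv: "u \<in> verts G" "v \<in> verts G" for u v
  proof -
    have no: "{c, c} \<notin> edges G" using simple_graph_edgeD(3)[OF assms(1)] by blast
    consider "u = c" "v = c" | "u = c" "v \<in> I" | "u \<in> I" "v = c" | "u \<in> I" "v \<in> I"
      using uv unfolding assms(2) by blast
    then show ?thesis
    proof cases
      case 1 then show ?thesis using no star_edge[of 0 0] by (simp add: f_def)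
    next
      case 2 then show ?thesis using assms(6) fI[of v] by (simp add: star_edge) (simp add: f_def)
    next
      case 3 then show ?thesis using assms(6) fI[of u]
        by (simp add: star_edge insert_commute[of u c]) (simp add: f_def)
    next
      case 4
      then have "{u, v} \<notin> edges G" using assms(5) unfolding independent_def by blast
      then show ?thesis using fI[OF 4(1)] fI[OF 4(2)] by (simp add: star_edge)
    qed
  qed
  with bij show ?thesis unfolding graph_iso_def by blast
qed

lemma induced_minor_step:
  assumes "minor_step G G'" "induced_minor H G'" shows "induced_minor H G"
proof -
  from assms(2) obtain H' where "minor_step\<^sup>*\<^sup>* G' H'" "graph_iso H' H"
    unfolding induced_minor_def by blast
  then show ?thesis
    using converse_rtranclp_into_rtranclp[of minor_step, OF assms(1)] unfolding induced_minor_def by blast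
qed

text \<open>Vertices outside \<open>C \<union> I\<close> are deleted, and edges inside \<open>C\<close> are contracted until \<open>C\<close> is a
  single vertex, which is then the centre of a star with leaves \<open>I\<close>. Each of these steps
  preserves the hypotheses and lowers the number of vertices.\<close>
lemma star_induced_minorI:
  assumes "simple_graph G" "C \<subseteq> verts G" "connected_in G C" "C \<noteq> {}"
    "independent G I" "I \<inter> C = {}" "card I = q" "\<forall>i\<in>I. \<exists>c\<in>C. {c, i} \<in> edges G"
  shows "induced_minor (star q) G"
  using assms
proof (induction "card (verts G)" arbitrary: G C rule: less_induct)
  case less
  have fin: "finite (verts G)" using less.prems(1) unfolding simple_graph_def by blast
  have IV: "I \<subseteq> verts G" using less.prems(5) unfolding independent_def by blast
  consider v where "v \<in> verts G" "v \<notin> C \<union> I" | c where "C = {c}" "verts G = C \<union> I"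
    | u v where "u \<in> C" "v \<in> C" "u \<noteq> v" "{u, v} \<in> edges G"
  proof (cases "\<exists>v\<in>verts G. v \<notin> C \<union> I")
    case True then show ?thesis using that(1) by blast
  next
    case False
    then have V: "verts G = C \<union> I" using less.prems(2) IV by blast
    obtain u where u: "u \<in> C" using less.prems(4) by blast
    show ?thesis
    proof (cases "C = {u}")
      case True then show ?thesis using that(2) V by blast
    next
      case False
      have "{u} \<subseteq> C" "{u} \<noteq> {}" "{u} \<noteq> C" using False u by auto
      from connected_inD[OF less.prems(3) this] obtain y where "y \<in> C" "y \<noteq> u" "{u, y} \<in> edges G"
        by blast
      then show ?thesis using that(3) u by blast
    qed
  qed
  then show ?case
  proof cases
    case 1
    have "card (verts (delete_vertex G v)) < card (verts G)"
      using card_Diff1_less[OF fin 1(1)] by (simp add: delete_vertex_def)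
    moreover have "connected_in (delete_vertex G v) C"
    proof -
      have "{x, y} \<in> edges (delete_vertex G v) \<longleftrightarrow> {x, y} \<in> edges G" if "x \<in> C" "y \<in> C" for x y
        using that 1(2) unfolding delete_vertex_def by auto
      then show ?thesis using less.prems(3) unfolding connected_in_def by (meson DiffD1 subset_iff)
    qed
    moreover have "independent (delete_vertex G v) I"
      using less.prems(5) 1(2) unfolding independent_def delete_vertex_def by auto
    moreover have "\<forall>i\<in>I. \<exists>c\<in>C. {c, i} \<in> edges (delete_vertex G v)"
      using less.prems(8) 1(2) unfolding delete_vertex_def by fastforce
    moreover have "C \<subseteq> verts (delete_vertex G v)"
      using less.prems(2) 1(2) unfolding delete_vertex_def by auto
    ultimately have "induced_minor (star q) (delete_vertex G v)"
      using less.hyps[of "delete_vertex G v" C] simple_graph_delete[OF less.prems(1)]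
        less.prems(4,6,7) by blast
    with minor_step.delete[OF 1(1)] show ?thesis by (rule induced_minor_step)
  next
    case 2
    have "graph_iso G (star q)"
      by (rule star_isoI[of G c I]) (use less.prems 2 in auto)
    then show ?thesis unfolding induced_minor_def by blast
  next
    case 3
    let ?G = "contract_edge G u v"
    have vI: "v \<notin> I" "u \<notin> I" using 3 less.prems(6) by blast+
    have "v \<in> verts G" using 3 less.prems(2) by blast
    then have "card (verts ?G) < card (verts G)"
      using card_Diff1_less[OF fin] by (simp add: contract_edge_def)
    moreover have "independent ?G I"
      using less.prems(5) vI unfolding independent_def contract_edge_def
      by (auto simp: doubleton_eq_iff)
    moreover have "\<forall>i\<in>I. \<exists>c\<in>C - {v}. {c, i} \<in> edges ?G"
    proof
      fix i assume i: "i \<in> I"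
      then obtain c where c: "c \<in> C" "{c, i} \<in> edges G" using less.prems(8) by blast
      show "\<exists>c\<in>C - {v}. {c, i} \<in> edges ?G"
      proof (cases "c = v")
        case True
        then have "{u, i} \<in> edges ?G" using c i vI unfolding contract_edge_def by auto
        then show ?thesis using 3 by blast
      next
        case False
        then have "{c, i} \<in> edges ?G" using c i vI unfolding contract_edge_def by auto
        then show ?thesis using False c by blast
      qed
    qed
    moreover have "C - {v} \<subseteq> verts ?G" using less.prems(2) unfolding contract_edge_def by auto
    moreover have "C - {v} \<noteq> {}" "I \<inter> (C - {v}) = {}" using 3 less.prems(6) by blast+
    ultimately have "induced_minor (star q) ?G"
      using less.hyps[of ?G "C - {v}"] simple_graph_contract[OF less.prems(1) 3(4)]
        connected_in_contract[OF less.prems(3) 3(1-3)] less.prems(7) by blast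
    with minor_step.contract[OF 3(4)] show ?thesis by (rule induced_minor_step)
  qed
qed

text \<open>The only place where the excluded induced minor enters. Connected sets are the sets that can be
  contracted to the centre of a star, so their neighbourhoods have small independence number.\<close>
lemma card_independent_neighbours_less:
  assumes "simple_graph G" "\<not> induced_minor (star q) G" "0 < q"
    "C \<subseteq> verts G" "connected_in G C"
    "independent G I" "I \<inter> C = {}" "\<forall>i\<in>I. \<exists>c\<in>C. {c, i} \<in> edges G"
  shows "card I < q"
proof (rule ccontr)
  assume "\<not> card I < q"
  then obtain J where J: "J \<subseteq> I" "card J = q" by (meson leI obtain_subset_with_card_n)
  then have "J \<noteq> {}" using assms(3) by auto
  then have "C \<noteq> {}" using assms(8) J by blast
  moreover have "independent G J" using assms(6) J unfolding independent_def by blast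
  moreover have "J \<inter> C = {}" "\<forall>i\<in>J. \<exists>c\<in>C. {c, i} \<in> edges G" using J assms(7,8) by blast+
  ultimately have "induced_minor (star q) G"
    using star_induced_minorI[OF assms(1,4,5)] J(2) by blast
  then show False using assms(2) by blast
qed

section \<open>Layerings by breadth-first search\<close>

text \<open>The state of the search after \<open>i\<close> rounds; \<open>l v\<close> is the layer of \<open>v\<close>, and \<open>0\<close> stands for
  a vertex not reached yet. The third clause says that only the latest layer has unreached
  neighbours. The fifth one provides a connected set of reached vertices that contains the latest
  layer, which is what bounds the independent sets of the next one. By the last clause every round
  reaches at least one vertex, so that \<open>n\<close> rounds suffice.\<close>
definition partial_layering :: "'a ugraph \<Rightarrow> nat \<Rightarrow> nat \<Rightarrow> ('a \<Rightarrow> nat) \<Rightarrow> bool" where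
  "partial_layering G q i l \<longleftrightarrow>
     (\<forall>v\<in>verts G. l v \<le> i) \<and>
     (\<forall>u v. {u, v} \<in> edges G \<longrightarrow> l u \<noteq> 0 \<longrightarrow> l v \<noteq> 0 \<longrightarrow> l u \<le> Suc (l v)) \<and>
     (\<forall>u v. {u, v} \<in> edges G \<longrightarrow> l u \<noteq> 0 \<longrightarrow> l v = 0 \<longrightarrow> l u = i) \<and>
     (\<forall>j>0. \<forall>J. independent G J \<longrightarrow> (\<forall>v\<in>J. l v = j) \<longrightarrow> card J \<le> q) \<and>
     (\<exists>C\<subseteq>verts G. connected_in G C \<and> (\<forall>v\<in>C. l v \<noteq> 0) \<and>
        (\<forall>v\<in>verts G. l v = i \<longrightarrow> l v \<noteq> 0 \<longrightarrow> v \<in> C)) \<and>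
     (i \<le> card {v \<in> verts G. l v \<noteq> 0} \<or> (\<forall>v\<in>verts G. l v \<noteq> 0))"

definition frontier :: "'a ugraph \<Rightarrow> ('a \<Rightarrow> nat) \<Rightarrow> 'a set" where
  "frontier G l = {v \<in> verts G. l v = 0 \<and> (\<exists>u. {u, v} \<in> edges G \<and> l u \<noteq> 0)}"

lemma partial_layering_0:
  assumes "simple_graph G" and l: "\<And>v. v \<in> verts G \<Longrightarrow> l v = 0"
  shows "partial_layering G q 0 l"
proof -
  have "l u = 0" if "{u, v} \<in> edges G" for u v
    using l simple_graph_edgeD(1)[OF assms(1) that] .
  moreover have "card J \<le> q" if "0 < j" "independent G J" "\<forall>v\<in>J. l v = j" for j J
  proof -
    have "J = {}" using that l unfolding independent_def by fastforce
    then show ?thesis by simp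
  qed
  moreover have "connected_in G {}" unfolding connected_in_def by blast
  ultimately show ?thesis unfolding partial_layering_def using l by auto
qed

text \<open>A round reaches the neighbours \<open>S\<close> of the reached vertices or, if there are none, one vertex
  of another component. In the first case all of \<open>S\<close> is adjacent to the connected set \<open>C\<close>
  around the latest layer, and \<open>C \<union> S\<close> is the new connected set; in the second one the new
  connected set is \<open>S\<close> itself.\<close>
lemma partial_layering_Suc:
  assumes G: "simple_graph G" "\<not> induced_minor (star q) G" "0 < q"
    and l: "partial_layering G q i l"
    and l': "\<And>v. v \<in> verts G \<Longrightarrow> l' v = (if v \<in> S then Suc i else l v)"
    and S: "frontier G l \<noteq> {} \<and> S = frontier G l \<or>
      frontier G l = {} \<and> S \<subseteq> {v \<in> verts G. l v = 0} \<and> card S \<le> 1 \<and>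
        (S = {} \<longrightarrow> (\<forall>v\<in>verts G. l v \<noteq> 0))"
  shows "partial_layering G q (Suc i) l'"
proof -
  have fin: "finite (verts G)" using G(1) unfolding simple_graph_def by blast
  note E = simple_graph_edgeD[OF G(1)]
  have Ec: "{u, v} \<in> edges G \<Longrightarrow> {v, u} \<in> edges G" for u v by (simp add: insert_commute)
  note L = l[unfolded partial_layering_def]
  have l1: "v \<in> verts G \<Longrightarrow> l v \<le> i" for v
    using L[THEN conjunct1] by blast
  have l2: "{u, v} \<in> edges G \<Longrightarrow> l u \<noteq> 0 \<Longrightarrow> l v \<noteq> 0 \<Longrightarrow> l u \<le> Suc (l v)" for u v
    using L[THEN conjunct2, THEN conjunct1] by blast
  have l3: "{u, v} \<in> edges G \<Longrightarrow> l u \<noteq> 0 \<Longrightarrow> l v = 0 \<Longrightarrow> l u = i" for u v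
    using L[THEN conjunct2, THEN conjunct2, THEN conjunct1] by blast
  have l4: "j > 0 \<Longrightarrow> independent G J \<Longrightarrow> (\<forall>v\<in>J. l v = j) \<Longrightarrow> card J \<le> q" for j J
    using L[THEN conjunct2, THEN conjunct2, THEN conjunct2, THEN conjunct1] by blast
  obtain C where C: "C \<subseteq> verts G" "connected_in G C" "\<forall>v\<in>C. l v \<noteq> 0"
      "\<And>v. v \<in> verts G \<Longrightarrow> l v = i \<Longrightarrow> l v \<noteq> 0 \<Longrightarrow> v \<in> C"
    using L[THEN conjunct2, THEN conjunct2, THEN conjunct2, THEN conjunct2, THEN conjunct1] by (elim exE conjE) blast
  have l6: "i \<le> card {v \<in> verts G. l v \<noteq> 0} \<or> (\<forall>v\<in>verts G. l v \<noteq> 0)"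
    using L[THEN conjunct2, THEN conjunct2, THEN conjunct2, THEN conjunct2, THEN conjunct2] by blast
  have SV: "S \<subseteq> {v \<in> verts G. l v = 0}" using S unfolding frontier_def by blast
  have finS: "finite S" by (rule finite_subset[OF _ fin]) (use SV in blast)
  have front: "v \<in> frontier G l" if "{u, v} \<in> edges G" "l u \<noteq> 0" "l v = 0" for u v
    using that E(2)[OF that(1)] unfolding frontier_def by blast
  have frontS: "v \<in> S" if "{u, v} \<in> edges G" "l u \<noteq> 0" "l v = 0" for u v
    using front[OF that] S by (elim disjE conjE) auto
  have frontC: "\<exists>c\<in>C. {c, v} \<in> edges G" if v: "v \<in> frontier G l" for v
  proof -
    obtain u where u: "{u, v} \<in> edges G" "l u \<noteq> 0" "l v = 0" using v unfolding frontier_def by blast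
    then have "u \<in> C" using C(4) l3 E(1) by metis
    then show ?thesis using u by blast
  qed
  have 1: "\<forall>v\<in>verts G. l' v \<le> Suc i" using l' l1 by (simp add: le_SucI)
  have 2: "l' u \<le> Suc (l' v)" if e: "{u, v} \<in> edges G" "l' u \<noteq> 0" "l' v \<noteq> 0" for u v
  proof -
    have uv: "u \<in> verts G" "v \<in> verts G" using E[OF e(1)] by auto
    show ?thesis
    proof (cases "v \<in> S")
      case True then show ?thesis using 1 uv l' by (metis le_SucI)
    next
      case False
      then have v: "l' v = l v" using uv l' by simp
      show ?thesis
      proof (cases "u \<in> S")
        case True
        then have "l u = 0" "l v \<noteq> 0" using SV v e(3) by auto
        then have "l v = i" using l3[OF Ec[OF e(1)]] by blast
        then show ?thesis using v True l' uv by simp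
      next
        case False
        then show ?thesis using l2[OF e(1)] v l' uv e by simp
      qed
    qed
  qed
  have 3: "l' u = Suc i" if e: "{u, v} \<in> edges G" "l' u \<noteq> 0" "l' v = 0" for u v
  proof -
    have uv: "u \<in> verts G" "v \<in> verts G" using E[OF e(1)] by auto
    then have "v \<notin> S" "l v = 0" using l' e(3) by (auto split: if_splits)
    then have "l u = 0" using frontS[OF e(1)] by blast
    then show ?thesis using l'[OF uv(1)] e(2) by (auto split: if_splits)
  qed
  have 4: "card J \<le> q" if j: "0 < j" "independent G J" "\<forall>v\<in>J. l' v = j" for j J
  proof -
    have JV: "J \<subseteq> verts G" using j(2) unfolding independent_def by blast
    show ?thesis
    proof (cases "j = Suc i")
      case False
      then have "\<forall>v\<in>J. l v = j" using j(3) l' JV by (metis subset_iff)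
      then show ?thesis using l4 j by blast
    next
      case True
      have JS: "J \<subseteq> S"
      proof
        fix v assume "v \<in> J"
        then show "v \<in> S" using True j(3) l' JV l1 by (metis Suc_n_not_le_n subset_iff)
      qed
      show ?thesis
      proof (cases "S = frontier G l")
        case True
        have "J \<inter> C = {}" using JS SV C(3) by blast
        moreover have "\<forall>v\<in>J. \<exists>c\<in>C. {c, v} \<in> edges G" using JS True frontC by blast
        ultimately show ?thesis
          using card_independent_neighbours_less[OF G C(1,2) j(2)] by simp
      next
        case False
        then have "card S \<le> 1" using S by blast
        then show ?thesis using card_mono[OF finS JS] G(3) by linarith
      qed
    qed
  qed
  have l'S: "v \<in> S" if "v \<in> verts G" "l' v = Suc i" for v
    using l'[OF that(1)] l1[OF that(1)] that(2) by (simp split: if_splits)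
  have 5: "\<exists>C\<subseteq>verts G. connected_in G C \<and> (\<forall>v\<in>C. l' v \<noteq> 0) \<and>
        (\<forall>v\<in>verts G. l' v = Suc i \<longrightarrow> l' v \<noteq> 0 \<longrightarrow> v \<in> C)"
  proof (cases "S = frontier G l")
    case True
    have "connected_in G (C \<union> S)" using connected_in_extend[OF C(2)] frontC True by blast
    moreover have "\<forall>v\<in>C \<union> S. l' v \<noteq> 0" using C l' SV by (metis (mono_tags, lifting) Un_iff
      mem_Collect_eq nat.distinct(1) subset_iff)
    ultimately show ?thesis using l'S C(1) SV by (intro exI[of _ "C \<union> S"]) auto
  next
    case False
    then have "card S \<le> 1" using S by blast
    then have "S = {} \<or> (\<exists>r. S = {r})"
      using finS by (metis One_nat_def card_0_eq card_1_singletonE le_Suc_eq le_zero_eq)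
    then have "connected_in G S" unfolding connected_in_def by blast
    moreover have "\<forall>v\<in>S. l' v \<noteq> 0" using l' SV by auto
    ultimately show ?thesis using l'S SV by (intro exI[of _ S]) auto
  qed
  have 6: "Suc i \<le> card {v \<in> verts G. l' v \<noteq> 0} \<or> (\<forall>v\<in>verts G. l' v \<noteq> 0)"
  proof (cases "\<forall>v\<in>verts G. l v \<noteq> 0")
    case True then show ?thesis using l' by auto
  next
    case False
    then have i: "i \<le> card {v \<in> verts G. l v \<noteq> 0}" using l6 by blast
    have "S \<noteq> {}" using False S by blast
    then have "0 < card S" using finS by (simp add: card_gt_0_iff)
    moreover have "{v \<in> verts G. l' v \<noteq> 0} = {v \<in> verts G. l v \<noteq> 0} \<union> S"
      using SV l' by auto
    moreover have "card ({v \<in> verts G. l v \<noteq> 0} \<union> S) = card {v \<in> verts G. l v \<noteq> 0} + card S"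
      by (rule card_Un_disjoint) (use fin finS SV in auto)
    ultimately show ?thesis using i by simp
  qed
  have 2: "\<forall>u v. {u, v} \<in> edges G \<longrightarrow> l' u \<noteq> 0 \<longrightarrow> l' v \<noteq> 0 \<longrightarrow> l' u \<le> Suc (l' v)"
    using 2 by blast
  have 3: "\<forall>u v. {u, v} \<in> edges G \<longrightarrow> l' u \<noteq> 0 \<longrightarrow> l' v = 0 \<longrightarrow> l' u = Suc i"
    using 3 by blast
  have 4: "\<forall>j>0. \<forall>J. independent G J \<longrightarrow> (\<forall>v\<in>J. l' v = j) \<longrightarrow> card J \<le> q"
    using 4 by blast
  show ?thesis unfolding partial_layering_def by (intro conjI) (fact 1 2 3 4 5 6)+
qed

lemma partial_layering_complete:
  assumes "simple_graph G" "partial_layering G q (card (verts G)) l" "v \<in> verts G"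
  shows "l v \<noteq> 0"
proof -
  have fin: "finite (verts G)" using assms(1) unfolding simple_graph_def by blast
  have "card (verts G) \<le> card {v \<in> verts G. l v \<noteq> 0} \<or> (\<forall>v\<in>verts G. l v \<noteq> 0)"
    using assms(2) unfolding partial_layering_def by (elim conjE)
  then show ?thesis
  proof
    assume "card (verts G) \<le> card {v \<in> verts G. l v \<noteq> 0}"
    then have "{v \<in> verts G. l v \<noteq> 0} = verts G"
      by (intro card_seteq) (use fin in auto)
    then show ?thesis using assms(3) by blast
  qed (use assms(3) in blast)
qed

section \<open>Programs on numbers of bounded length\<close>

definition bounded :: "nat \<Rightarrow> state \<Rightarrow> bool" where
  "bounded B s \<longleftrightarrow> 1 \<le> B \<and> (\<forall>x. regs s x < 2 ^ B) \<and> (\<forall>a i. arrays s a i < 2 ^ B)"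

fun esize :: "expr \<Rightarrow> nat" where
  "esize (Const n) = Suc n"
| "esize (Reg x) = 1"
| "esize (Cell a e) = Suc (esize e)"
| "esize (Arith f e1 e2) = Suc (esize e1 + esize e2)"

lemma esize_pos: "1 \<le> esize e" by (cases e) auto

lemma bit_len_le: "v < 2 ^ m \<Longrightarrow> 1 \<le> m \<Longrightarrow> bit_len v \<le> m"
  unfolding bit_len_def by (auto simp: floorlog_le_iff)

lemma less_bit_len: "v < 2 ^ bit_len v"
  using floorlog_le_iff[of 2 v "bit_len v"] unfolding bit_len_def by simp

text \<open>An operation adds at most the lengths of its arguments, up to one bit, so lengths grow linearly
  with the size of the expression. Intermediate results of an expression therefore need no
  individual bounds: it is enough to bound the numbers that are stored.\<close>
lemma eval_expr_bound:
  assumes "bounded B s"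
  shows "eval_expr e s < 2 ^ (B * esize e)"
proof (induction e)
  case (Const n)
  have "n < 2 ^ n" by (rule less_exp)
  also have "\<dots> \<le> 2 ^ (B * esize (Const n))"
    using assms unfolding bounded_def by (intro power_increasing) (auto intro: trans_le_add2)
  finally show ?case by simp
next
  case (Reg x) then show ?case using assms unfolding bounded_def by simp
next
  case (Cell a e)
  have "arrays s a (eval_expr e s) < 2 ^ B" using assms unfolding bounded_def by simp
  also have "\<dots> \<le> (2::nat) ^ (B * esize (Cell a e))" by (intro power_increasing) auto
  finally show ?case by simp
next
  case (Arith f e1 e2)
  let ?x = "eval_expr e1 s" and ?y = "eval_expr e2 s"
  let ?X = "(2::nat) ^ (B * esize e1)" and ?Y = "(2::nat) ^ (B * esize e2)"
  have B: "2 \<le> (2::nat) ^ B" using assms unfolding bounded_def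
    by (metis power_increasing one_le_numeral power_one_right)
  have m: "?x * ?y < ?X * ?Y" using Arith by (intro mult_strict_mono) auto
  have X: "?x < ?X * ?Y" using Arith(1) by (rule order_less_le_trans) simp
  have Y: "?y < ?X * ?Y" using Arith(2) by (rule order_less_le_trans) simp
  have "?x div ?y \<le> ?x" by simp
  then have "apply_arith f ?x ?y < 2 * (?X * ?Y)"
  proof (cases f)
    case Add
    then show ?thesis using X Y by simp
  next
    case Div
    have "?x div ?y \<le> ?x" by simp
    then show ?thesis using X unfolding Div apply_arith.simps by linarith
  qed (use m X in simp_all)
  also have "\<dots> \<le> 2 ^ B * (?X * ?Y)" using B by (intro mult_right_mono) auto
  also have "\<dots> = 2 ^ (B * esize (Arith f e1 e2))" by (simp add: power_add algebra_simps)
  finally show ?case by simp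
qed

lemma cost_expr_bound:
  assumes "bounded B s"
  shows "cost_expr e s \<le> B * (esize e)\<^sup>2"
proof (induction e)
  case (Const n)
  have "bit_len n \<le> Suc n"
    by (rule bit_len_le) (simp_all add: less_SucI less_exp[THEN order_less_trans])
  also have "\<dots> \<le> B * (Suc n)\<^sup>2"
    using assms unfolding bounded_def
    by (metis (no_types, lifting) esize.simps(1) esize_pos le_square le_trans mult_le_mono1
        nat_mult_1 power2_eq_square)
  finally show ?case by simp
next
  case (Reg x)
  then show ?case using assms unfolding bounded_def by (simp add: bit_len_le)
next
  case (Cell a e)
  have "bit_len (arrays s a (eval_expr e s)) \<le> B"
    using assms unfolding bounded_def by (simp add: bit_len_le)
  then have "cost_expr (Cell a e) s \<le> B * (esize e)\<^sup>2 + B" using Cell by simp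
  also have "\<dots> \<le> B * (esize (Cell a e))\<^sup>2" by (simp add: power2_eq_square algebra_simps)
  finally show ?case .
next
  case (Arith f e1 e2)
  have "bit_len (eval_expr (Arith f e1 e2) s) \<le> B * esize (Arith f e1 e2)"
    using assms by (intro bit_len_le eval_expr_bound) (auto simp: bounded_def)
  then have "cost_expr (Arith f e1 e2) s \<le> B * (esize e1)\<^sup>2 + B * (esize e2)\<^sup>2 + B * esize (Arith f e1 e2)"
    using Arith by simp
  also have "\<dots> \<le> B * (esize (Arith f e1 e2))\<^sup>2" by (simp add: power2_eq_square algebra_simps)
  finally show ?case .
qed

text \<open>A condition on the text of a program that, over bounded memory, makes \<open>B * K\<^sup>2\<close> an upper bound
  for the cost of every single expression.\<close>
fun fits :: "nat \<Rightarrow> com \<Rightarrow> bool" where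
  "fits K Skip \<longleftrightarrow> 1 \<le> K"
| "fits K (Assign x e) \<longleftrightarrow> esize e \<le> K"
| "fits K (Store a e1 e2) \<longleftrightarrow> esize e1 \<le> K \<and> esize e2 \<le> K"
| "fits K (Seq c1 c2) \<longleftrightarrow> fits K c1 \<and> fits K c2"
| "fits K (Cond e c1 c2) \<longleftrightarrow> esize e \<le> K \<and> fits K c1 \<and> fits K c2"
| "fits K (While e c) \<longleftrightarrow> esize e \<le> K \<and> fits K c"

fun wregs :: "com \<Rightarrow> nat set" where
  "wregs Skip = {}"
| "wregs (Assign x e) = {x}"
| "wregs (Store a e1 e2) = {}"
| "wregs (Seq c1 c2) = wregs c1 \<union> wregs c2"
| "wregs (Cond e c1 c2) = wregs c1 \<union> wregs c2"
| "wregs (While e c) = wregs c"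

fun warrs :: "com \<Rightarrow> nat set" where
  "warrs Skip = {}"
| "warrs (Assign x e) = {}"
| "warrs (Store a e1 e2) = {a}"
| "warrs (Seq c1 c2) = warrs c1 \<union> warrs c2"
| "warrs (Cond e c1 c2) = warrs c1 \<union> warrs c2"
| "warrs (While e c) = warrs c"

text \<open>Frame conditions come for free from the sets of registers and arrays that a program assigns.\<close>
definition same_off :: "nat set \<Rightarrow> nat set \<Rightarrow> state \<Rightarrow> state \<Rightarrow> bool" where
  "same_off R A s s' \<longleftrightarrow>
     (\<forall>x. x \<notin> R \<longrightarrow> regs s' x = regs s x) \<and> (\<forall>a. a \<notin> A \<longrightarrow> arrays s' a = arrays s a)"

lemma same_offD:
  assumes "same_off R A s s'"
  shows "x \<notin> R \<Longrightarrow> regs s' x = regs s x" "a \<notin> A \<Longrightarrow> arrays s' a = arrays s a"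
  using assms unfolding same_off_def by auto

lemma exec_same_off: "exec c s t s' \<Longrightarrow> same_off (wregs c) (warrs c) s s'"
  by (induction rule: exec.induct) (auto simp: same_off_def)

text \<open>Total correctness with running time \<open>T\<close> in units of \<open>B * K\<^sup>2\<close>, the price of one expression.
  Boundedness of the memory is maintained silently.\<close>
definition runs :: "nat \<Rightarrow> nat \<Rightarrow> com \<Rightarrow> state \<Rightarrow> nat \<Rightarrow> (state \<Rightarrow> bool) \<Rightarrow> bool" where
  "runs B K c s T Q \<longleftrightarrow> (bounded B s \<longrightarrow> fits K c \<longrightarrow>
     (\<exists>t s'. exec c s t s' \<and> t \<le> T * (B * K\<^sup>2) \<and> bounded B s' \<and> Q s'))"

lemma runs_mono:
  assumes "runs B K c s T Q" "\<And>s'. same_off (wregs c) (warrs c) s s' \<Longrightarrow> Q s' \<Longrightarrow> Q' s'" "T \<le> T'"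
  shows "runs B K c s T' Q'"
  using assms exec_same_off unfolding runs_def by (meson mult_le_mono1 le_trans)

lemma runs_Seq:
  assumes "runs B K c1 s T1 Q1"
    and "\<And>s'. same_off (wregs c1) (warrs c1) s s' \<Longrightarrow> Q1 s' \<Longrightarrow> runs B K c2 s' T2 Q"
  shows "runs B K (Seq c1 c2) s (T1 + T2) Q"
  unfolding runs_def
proof (intro impI)
  assume b: "bounded B s" and f: "fits K (Seq c1 c2)"
  then obtain t1 s1 where 1: "exec c1 s t1 s1" "t1 \<le> T1 * (B * K\<^sup>2)" "bounded B s1" "Q1 s1"
    using assms(1) unfolding runs_def by auto
  then obtain t2 s2 where 2: "exec c2 s1 t2 s2" "t2 \<le> T2 * (B * K\<^sup>2)" "bounded B s2" "Q s2"
    using assms(2)[OF exec_same_off[OF 1(1)] 1(4)] f unfolding runs_def by auto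
  show "\<exists>t s'. exec (Seq c1 c2) s t s' \<and> t \<le> (T1 + T2) * (B * K\<^sup>2) \<and> bounded B s' \<and> Q s'"
    using exec.Seq[OF 1(1) 2(1)] 1 2 by (intro exI conjI) (auto simp: algebra_simps)
qed

text \<open>Programs without loops are evaluated as functions; \<open>safe\<close> collects the bounds on the numbers
  they store. The values on loops are dummies, since \<open>safe\<close> is false there.\<close>
fun straight :: "com \<Rightarrow> state \<Rightarrow> state" where
  "straight Skip s = s"
| "straight (Assign x e) s = s\<lparr>regs := (regs s)(x := eval_expr e s)\<rparr>"
| "straight (Store a e1 e2) s =
     s\<lparr>arrays := (arrays s)(a := (arrays s a)(eval_expr e1 s := eval_expr e2 s))\<rparr>"
| "straight (Seq c1 c2) s = straight c2 (straight c1 s)"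
| "straight (Cond e c1 c2) s = (if eval_expr e s \<noteq> 0 then straight c1 s else straight c2 s)"
| "straight (While e c) s = s"

fun safe :: "nat \<Rightarrow> com \<Rightarrow> state \<Rightarrow> bool" where
  "safe B Skip s \<longleftrightarrow> True"
| "safe B (Assign x e) s \<longleftrightarrow> eval_expr e s < 2 ^ B"
| "safe B (Store a e1 e2) s \<longleftrightarrow> eval_expr e2 s < 2 ^ B"
| "safe B (Seq c1 c2) s \<longleftrightarrow> safe B c1 s \<and> safe B c2 (straight c1 s)"
| "safe B (Cond e c1 c2) s \<longleftrightarrow> (if eval_expr e s \<noteq> 0 then safe B c1 s else safe B c2 s)"
| "safe B (While e c) s \<longleftrightarrow> False"

fun len :: "com \<Rightarrow> nat" where
  "len Skip = 1"
| "len (Assign x e) = 1"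
| "len (Store a e1 e2) = 2"
| "len (Seq c1 c2) = len c1 + len c2"
| "len (Cond e c1 c2) = 1 + len c1 + len c2"
| "len (While e c) = 0"

lemma cost_le_unit:
  assumes "bounded B s" "esize e \<le> K" shows "cost_expr e s \<le> B * K\<^sup>2"
proof -
  have "cost_expr e s \<le> B * (esize e)\<^sup>2" by (rule cost_expr_bound[OF assms(1)])
  also have "\<dots> \<le> B * K\<^sup>2" using assms(2) by simp
  finally show ?thesis .
qed

lemma exec_straight:
  assumes "bounded B s" "fits K c" "safe B c s"
  shows "\<exists>t. exec c s t (straight c s) \<and> t \<le> len c * (B * K\<^sup>2) \<and> bounded B (straight c s)"
  using assms
proof (induction c arbitrary: s)
  case Skip
  then have "1 \<le> B * K\<^sup>2" by (auto simp: bounded_def Suc_le_eq)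
  then show ?case using exec.Skip[of s] Skip by auto
next
  case (Assign x e)
  then show ?case using exec.Assign[of x e s] cost_le_unit[of B s e K]
    by (intro exI) (auto simp: bounded_def)
next
  case (Store a e1 e2)
  then show ?case using exec.Store[of a e1 e2 s] cost_le_unit[of B s e1 K] cost_le_unit[of B s e2 K]
    by (intro exI) (auto simp: bounded_def)
next
  case (Seq c1 c2)
  then obtain t1 where 1: "exec c1 s t1 (straight c1 s)" "t1 \<le> len c1 * (B * K\<^sup>2)"
      "bounded B (straight c1 s)" by fastforce
  then obtain t2 where 2: "exec c2 (straight c1 s) t2 (straight c2 (straight c1 s))"
      "t2 \<le> len c2 * (B * K\<^sup>2)" "bounded B (straight c2 (straight c1 s))"
    using Seq.IH(2)[of "straight c1 s"] Seq.prems by auto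
  show ?case using exec.Seq[OF 1(1) 2(1)] 1 2 by (intro exI) (auto simp: algebra_simps)
next
  case (Cond e c1 c2)
  have k: "cost_expr e s \<le> B * K\<^sup>2" using cost_le_unit Cond.prems by simp
  show ?case
  proof (cases "eval_expr e s = 0")
    case True
    then obtain t where "exec c2 s t (straight c2 s)" "t \<le> len c2 * (B * K\<^sup>2)" "bounded B (straight c2 s)"
      using Cond.IH(2)[of s] Cond.prems by auto
    then show ?thesis using exec.CondFalse[OF True] k True
      by (intro exI[of _ "cost_expr e s + t"]) (auto simp: algebra_simps trans_le_add1)
  next
    case False
    then obtain t where "exec c1 s t (straight c1 s)" "t \<le> len c1 * (B * K\<^sup>2)" "bounded B (straight c1 s)"
      using Cond.IH(1)[of s] Cond.prems by auto
    then show ?thesis using exec.CondTrue[OF False] k False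
      by (intro exI[of _ "cost_expr e s + t"]) (auto simp: algebra_simps trans_le_add1)
  qed
qed auto

lemma runs_straight:
  assumes "bounded B s \<Longrightarrow> safe B c s" "bounded B s \<Longrightarrow> Q (straight c s)" "len c \<le> T"
  shows "runs B K c s T Q"
  unfolding runs_def
proof (intro impI)
  assume b: "bounded B s" and f: "fits K c"
  then obtain t where t: "exec c s t (straight c s)" "t \<le> len c * (B * K\<^sup>2)" "bounded B (straight c s)"
    using exec_straight assms(1) by blast
  have "len c * (B * K\<^sup>2) \<le> T * (B * K\<^sup>2)" using assms(3) by (rule mult_le_mono1)
  then show "\<exists>t s'. exec c s t s' \<and> t \<le> T * (B * K\<^sup>2) \<and> bounded B s' \<and> Q s'"
    using t assms(2)[OF b] le_trans by blast
qed

lemma runs_Cond: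
  assumes "eval_expr e s \<noteq> 0 \<Longrightarrow> runs B K c1 s T Q" "eval_expr e s = 0 \<Longrightarrow> runs B K c2 s T Q"
  shows "runs B K (Cond e c1 c2) s (T + 1) Q"
  unfolding runs_def
proof (intro impI)
  assume b: "bounded B s" and f: "fits K (Cond e c1 c2)"
  then have e: "cost_expr e s \<le> B * K\<^sup>2" using cost_le_unit[of B s e K] by simp
  show "\<exists>t s'. exec (Cond e c1 c2) s t s' \<and> t \<le> (T + 1) * (B * K\<^sup>2) \<and> bounded B s' \<and> Q s'"
  proof (cases "eval_expr e s = 0")
    case True
    then obtain t s' where "exec c2 s t s'" "t \<le> T * (B * K\<^sup>2)" "bounded B s'" "Q s'"
      using assms(2) b f unfolding runs_def by auto
    then show ?thesis using exec.CondFalse[OF True] e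
      by (intro exI[of _ "cost_expr e s + t"] exI[of _ s']) (auto simp: algebra_simps)
  next
    case False
    then obtain t s' where "exec c1 s t s'" "t \<le> T * (B * K\<^sup>2)" "bounded B s'" "Q s'"
      using assms(1) b f unfolding runs_def by auto
    then show ?thesis using exec.CondTrue[OF False] e
      by (intro exI[of _ "cost_expr e s + t"] exI[of _ s']) (auto simp: algebra_simps)
  qed
qed

text \<open>The register \<open>x\<close> runs from \<open>0\<close> to one less than the value of register \<open>m\<close>. The bound is a
  register because then the counter never exceeds a number in the memory and hence is bounded.\<close>
definition For :: "nat \<Rightarrow> nat \<Rightarrow> com \<Rightarrow> com" where
  "For x m c = Seq (Assign x (Const 0))
     (While (Arith Sub (Reg m) (Reg x)) (Seq c (Assign x (Arith Add (Reg x) (Const 1)))))"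

lemma For_simps [simp]:
  "fits K (For x m c) \<longleftrightarrow> 4 \<le> K \<and> fits K c"
  "wregs (For x m c) = insert x (wregs c)"
  "warrs (For x m c) = warrs c"
  by (auto simp: For_def)

text \<open>In a round, the overhead of two units pays for the test and the increment. The body may use that the
  state agrees with the one before the loop except where the loop writes.\<close>
lemma runs_For:
  assumes m: "m \<noteq> x" "x \<notin> wregs c" "m \<notin> wregs c" "regs s m = k"
    and init: "Inv 0 (s\<lparr>regs := (regs s)(x := 0)\<rparr>)"
    and step: "\<And>i s'. i < k \<Longrightarrow> same_off (insert x (wregs c)) (warrs c) s s' \<Longrightarrow> regs s' x = i \<Longrightarrow>
      Inv i s' \<Longrightarrow> runs B K c s' T (\<lambda>s''. Inv (Suc i) (s''\<lparr>regs := (regs s'')(x := Suc i)\<rparr>))"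
  shows "runs B K (For x m c) s (k * (T + 2) + 2) (Inv k)"
  unfolding runs_def
proof (intro impI)
  assume b: "bounded B s" and f: "fits K (For x m c)"
  let ?U = "B * K\<^sup>2"
  let ?e = "Arith Sub (Reg m) (Reg x)"
  let ?inc = "Assign x (Arith Add (Reg x) (Const 1))"
  let ?W = "While ?e (Seq c ?inc)"
  have loop: "\<exists>t s''. exec ?W s' t s'' \<and> t \<le> ((k - i) * (T + 2) + 1) * ?U \<and> bounded B s'' \<and> Inv k s''"
    if "i \<le> k" "bounded B s'" "same_off (insert x (wregs c)) (warrs c) s s'" "regs s' x = i" "Inv i s'"
    for i s'
    using that
  proof (induction "k - i" arbitrary: i s')
    case 0
    have "regs s' m = k" using 0 m same_offD(1)[OF 0(4), of m] by simp
    then have "exec ?W s' (cost_expr ?e s') s'" using 0 by (intro exec.WhileFalse) simp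
    moreover have "cost_expr ?e s' \<le> ?U" using cost_le_unit[OF 0(3), of ?e K] f by (simp add: For_def)
    ultimately show ?case using 0 by (intro exI conjI) auto
  next
    case (Suc d)
    have i: "i < k" and d: "d = k - Suc i" using Suc(2) by simp_all
    have rm: "regs s' m = k" using m same_offD(1)[OF Suc(5), of m] by simp
    have c1: "cost_expr ?e s' \<le> ?U" using cost_le_unit[OF Suc(4), of ?e K] f by (simp add: For_def)
    obtain t1 s1 where 1: "exec c s' t1 s1" "t1 \<le> T * ?U" "bounded B s1"
        "Inv (Suc i) (s1\<lparr>regs := (regs s1)(x := Suc i)\<rparr>)"
      using step[OF i Suc(5,6,7)] Suc(4) f unfolding runs_def by auto
    have so: "same_off (wregs c) (warrs c) s' s1" using exec_same_off[OF 1(1)] .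
    have rx: "regs s1 x = i" "regs s1 m = k" using same_offD(1)[OF so] m Suc(6) rm by auto
    let ?s2 = "s1\<lparr>regs := (regs s1)(x := Suc i)\<rparr>"
    have e2: "exec ?inc s1 (cost_expr (Arith Add (Reg x) (Const 1)) s1) ?s2"
      using exec.Assign[of x "Arith Add (Reg x) (Const 1)" s1] rx by simp
    have c2: "cost_expr (Arith Add (Reg x) (Const 1)) s1 \<le> ?U"
      using cost_le_unit[OF 1(3), of "Arith Add (Reg x) (Const 1)" K] f by (simp add: For_def)
    have "regs s1 m < 2 ^ B" using 1(3) by (simp add: bounded_def)
    then have b2: "bounded B ?s2" using 1(3) i rx by (auto simp: bounded_def)
    have so2: "same_off (insert x (wregs c)) (warrs c) s ?s2"
      using so Suc(5) by (auto simp: same_off_def)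
    obtain t3 s3 where 3: "exec ?W ?s2 t3 s3" "t3 \<le> ((k - Suc i) * (T + 2) + 1) * ?U" "bounded B s3" "Inv k s3"
      using Suc(1)[of "Suc i" ?s2] d i b2 so2 1(4) by (auto simp del: One_nat_def)
    have ne: "eval_expr ?e s' \<noteq> 0" using rm Suc(6) i by simp
    have ex: "exec ?W s' (cost_expr ?e s' + (t1 + cost_expr (Arith Add (Reg x) (Const 1)) s1) + t3) s3"
      using exec.WhileTrue[OF ne exec.Seq[OF 1(1) e2] 3(1)] .
    have "k - i = Suc (k - Suc i)" using i by simp
    then have "((k - i) * (T + 2) + 1) * ?U = ?U + T * ?U + ?U + ((k - Suc i) * (T + 2) + 1) * ?U"
      by (simp add: algebra_simps)
    then have "cost_expr ?e s' + (t1 + cost_expr (Arith Add (Reg x) (Const 1)) s1) + t3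
        \<le> ((k - i) * (T + 2) + 1) * ?U"
      using c1 c2 1(2) 3(2) by linarith
    then show ?case using ex 3 by blast
  qed
  let ?s0 = "s\<lparr>regs := (regs s)(x := 0)\<rparr>"
  have e0: "exec (Assign x (Const 0)) s (cost_expr (Const 0) s) ?s0"
    using exec.Assign[of x "Const 0" s] by simp
  have c0: "cost_expr (Const 0) s \<le> ?U" using cost_le_unit[OF b, of "Const 0" K] f by (simp add: For_def)
  have "bounded B ?s0" "same_off (insert x (wregs c)) (warrs c) s ?s0"
    using b by (auto simp: bounded_def same_off_def)
  then obtain t s' where 1: "exec ?W ?s0 t s'" "t \<le> (k * (T + 2) + 1) * ?U" "bounded B s'" "Inv k s'"
    using loop[of 0 ?s0] init by auto
  have "exec (For x m c) s (cost_expr (Const 0) s + t) s'"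
    unfolding For_def using exec.Seq[OF e0 1(1)] .
  moreover have "cost_expr (Const 0) s + t \<le> (k * (T + 2) + 2) * ?U"
    using c0 1(2) by (simp add: algebra_simps)
  ultimately show "\<exists>t s'. exec (For x m c) s t s' \<and> t \<le> (k * (T + 2) + 2) * ?U \<and> bounded B s' \<and> Inv k s'"
    using 1 by blast
qed

section \<open>Dynamic programming over layers\<close>

definition digit :: "nat \<Rightarrow> nat \<Rightarrow> nat \<Rightarrow> nat" where
  "digit b t a = t div b ^ a mod b"

lemma digit_less: "0 < b \<Longrightarrow> digit b t a < b"
  by (simp add: digit_def)

lemma digit_Suc: "digit b t (Suc a) = digit b (t div b) a"
  by (simp add: digit_def div_mult2_eq)

lemma digit_mod: "a < q \<Longrightarrow> digit b (t mod b ^ q) a = digit b t a"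
proof (induction a arbitrary: q t)
  case 0
  then obtain p where "q = Suc p" by (metis gr0_implies_Suc)
  then show ?case by (simp add: digit_def mod_mod_cancel)
next
  case (Suc a)
  then obtain p where p: "q = Suc p" "a < p" by (metis Suc_lessE)
  show ?case
  proof (cases "b = 0")
    case False
    then have "(t mod b ^ q) div b = (t div b) mod b ^ p"
      by (simp add: p mod_mult2_eq)
    then show ?thesis using Suc.IH[OF p(2)] by (simp add: digit_Suc)
  qed (simp add: digit_def)
qed

lemma digit_div: "digit b (t div b ^ q) a = digit b t (q + a)"
  by (simp add: digit_def power_add div_mult2_eq)

lemma digit_beyond:
  assumes "0 < b" "t < b ^ k" "k \<le> a"
  shows "digit b t a = 0"
proof -
  have "b ^ k \<le> b ^ a" using assms by (simp add: power_increasing)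
  then show ?thesis using assms by (simp add: digit_def)
qed

text \<open>Vertex sets with at most \<open>q\<close> elements are encoded as numbers with \<open>q\<close> digits in base
  \<open>n + 1\<close>, the digit \<open>0\<close> meaning no vertex.\<close>
lemma ex_digits:
  assumes "\<And>a. a < k \<Longrightarrow> g a < b"
  shows "\<exists>t<b ^ k. \<forall>a<k. digit b t a = g a"
  using assms
proof (induction k arbitrary: g)
  case 0 then show ?case by simp
next
  case (Suc k)
  have "\<exists>t<b ^ k. \<forall>a<k. digit b t a = g (Suc a)"
    by (rule Suc.IH) (use Suc.prems in simp)
  then obtain t where t: "t < b ^ k" "\<And>a. a < k \<Longrightarrow> digit b t a = g (Suc a)" by blast
  have g0: "g 0 < b" using Suc.prems by simp
  let ?t = "g 0 + b * t"
  have "b * Suc t \<le> b * b ^ k" using t(1) by (intro mult_le_mono2) simp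
  then have "?t < b ^ Suc k" using g0 by simp
  moreover have "digit b ?t a = g a" if "a < Suc k" for a
  proof (cases a)
    case 0 then show ?thesis using g0 by (simp add: digit_def)
  next
    case (Suc c)
    then show ?thesis using g0 t(2)[of c] that by (simp add: digit_Suc)
  qed
  ultimately show ?case by blast
qed

text \<open>A layered graph on the vertices \<open>1, \<dots>, n\<close>. The number \<open>0\<close> is a dummy vertex of weight \<open>0\<close>.\<close>
locale layered =
  fixes n q :: nat and adj :: "nat \<Rightarrow> nat \<Rightarrow> bool" and lay W :: "nat \<Rightarrow> nat"
  assumes W0: "W 0 = 0"
    and lay_range: "v \<in> {1..n} \<Longrightarrow> lay v \<in> {1..n}"
    and adj_sym: "adj u v \<Longrightarrow> adj v u"
    and adj_irrefl: "\<not> adj v v"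
    and adj_lay: "adj u v \<Longrightarrow> lay u \<le> Suc (lay v)"
    and card_layer: "J \<subseteq> {1..n} \<Longrightarrow> (\<forall>u\<in>J. \<forall>v\<in>J. \<not> adj u v) \<Longrightarrow> (\<forall>v\<in>J. lay v = j) \<Longrightarrow> card J \<le> q"
begin

definition indep :: "nat set \<Rightarrow> bool" where
  "indep J \<longleftrightarrow> J \<subseteq> {1..n} \<and> (\<forall>u\<in>J. \<forall>v\<in>J. \<not> adj u v)"

definition conflict :: "nat \<Rightarrow> nat \<Rightarrow> bool" where
  "conflict u v \<longleftrightarrow> u \<noteq> 0 \<and> v \<noteq> 0 \<and> (u = v \<or> adj u v)"

abbreviation dig :: "nat \<Rightarrow> nat \<Rightarrow> nat" where "dig \<equiv> digit (Suc n)"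
abbreviation M :: nat where "M \<equiv> Suc n ^ q"

text \<open>A number \<open>t\<close> with \<open>2 * q\<close> digits stands for a candidate step of the dynamic program: the first
  \<open>q\<close> digits are the vertices chosen in layer \<open>i + 1\<close>, the others those chosen in layer \<open>i\<close>.
  Each digit of the first group is compared with all later ones, where the digits beyond the last
  one are \<open>0\<close> and compatible with everything. Conflicts inside the second group and its layer are
  not tested: they concern an earlier step.\<close>
definition ok :: "nat \<Rightarrow> nat \<Rightarrow> bool" where
  "ok i t \<longleftrightarrow> (\<forall>a<q. (dig t a = 0 \<or> lay (dig t a) = Suc i) \<and>
     (\<forall>b<2 * q. \<not> conflict (dig t a) (dig t (Suc a + b))))"

definition wt :: "nat \<Rightarrow> nat" where "wt t = (\<Sum>a<q. W (dig t a))"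

text \<open>Soundness of a table entry \<open>x\<close> for layer \<open>i\<close> and code \<open>s\<close>. The set may have fewer vertices
  in layer \<open>i\<close> than \<open>s\<close> has; the entry \<open>0\<close>, attained by the empty set, thus serves as the
  initial value of every cell, also for codes of sets that are not independent.\<close>
definition attained :: "nat \<Rightarrow> nat \<Rightarrow> nat \<Rightarrow> bool" where
  "attained i s x \<longleftrightarrow> (\<exists>J. indep J \<and> (\<forall>v\<in>J. lay v \<le> i) \<and>
     (\<forall>v\<in>J. lay v = i \<longrightarrow> (\<exists>a<q. v = dig s a)) \<and> x = sum W J)"

text \<open>A relation rather than a function: the order of the elements and the positions of the zeros are free.\<close>
definition codes :: "nat \<Rightarrow> nat set \<Rightarrow> bool" where
  "codes s S \<longleftrightarrow> inj_on (dig s) {a. a < q \<and> dig s a \<noteq> 0} \<and> dig s ` {a. a < q \<and> dig s a \<noteq> 0} = S"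

lemma finite_indep: "indep J \<Longrightarrow> finite J"
  unfolding indep_def by (meson finite_atLeastAtMost finite_subset)

lemma attained_empty: "attained i s 0"
  unfolding attained_def indep_def by (intro exI[of _ "{}"]) simp

lemma sum_digits:
  assumes "inj_on (dig t) {a. a < q \<and> dig t a \<noteq> 0}"
  shows "wt t = sum W (dig t ` {a. a < q \<and> dig t a \<noteq> 0})"
proof -
  have "wt t = (\<Sum>a\<in>{a. a < q \<and> dig t a \<noteq> 0}. W (dig t a))"
    unfolding wt_def by (rule sum.mono_neutral_right) (auto simp: W0)
  then show ?thesis by (simp only: sum.reindex[OF assms] o_def)
qed

text \<open>The new vertices \<open>S\<close> lie in layer \<open>i + 1\<close>, so the only members of \<open>J\<close> that can be adjacent
  to them lie in layer \<open>i\<close>. These are digits of the second group of \<open>t\<close>, which were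
  compared with \<open>S\<close>.\<close>
lemma attained_step:
  assumes ok: "ok i t" and at: "attained i (t div M) x"
  shows "attained (Suc i) (t mod M) (x + wt t)"
proof -
  let ?A = "{a. a < q \<and> dig t a \<noteq> 0}"
  define S where "S = dig t ` ?A"
  obtain J where J: "indep J" "\<forall>v\<in>J. lay v \<le> i"
      "\<forall>v\<in>J. lay v = i \<longrightarrow> (\<exists>a<q. v = dig (t div M) a)" "x = sum W J"
    using at unfolding attained_def by blast
  have noconf: "\<not> conflict (dig t a) (dig t c)" if "a < q" "a < c" "c < 2 * q" for a c
  proof -
    have "c - Suc a < 2 * q" "Suc a + (c - Suc a) = c" using that by auto
    moreover have "\<forall>b<2 * q. \<not> conflict (dig t a) (dig t (Suc a + b))"
      using ok that(1) unfolding ok_def by blast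
    ultimately show ?thesis by metis
  qed
  \<comment> \<open>the comparisons are made for \<open>a < c\<close> only; symmetry gives the others\<close>
  have noconf': "a = c \<or> \<not> conflict (dig t a) (dig t c)" if "a < q" "c < q" for a c
  proof (cases a c rule: linorder_cases)
    case less then show ?thesis using noconf[of a c] that by simp
  next
    case greater
    then have "\<not> conflict (dig t c) (dig t a)" using noconf[of c a] that by simp
    then show ?thesis unfolding conflict_def using adj_sym by metis
  qed simp
  have inj: "inj_on (dig t) ?A"
    using noconf' unfolding inj_on_def conflict_def by blast
  have lay_S: "lay v = Suc i" if "v \<in> S" for v using that ok unfolding S_def ok_def by auto
  have S1: "S \<subseteq> {1..n}"
  proof
    fix v assume "v \<in> S"
    then obtain a where "v = dig t a" "dig t a \<noteq> 0" unfolding S_def by blast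
    then show "v \<in> {1..n}" using digit_less[of "Suc n" t a] by simp
  qed
  have disj: "J \<inter> S = {}" using J(2) lay_S by fastforce
  have JS: "\<not> adj v u" if v: "v \<in> J" and u: "u \<in> S" for u v
  proof
    assume adj: "adj v u"
    then have "Suc i \<le> Suc (lay v)" using adj_lay[OF adj_sym[OF adj]] lay_S[OF u] by simp
    then have "lay v = i" using J(2) v by (simp add: le_antisym)
    then obtain c where "c < q" "v = dig (t div M) c" using J(3) v by blast
    then have c: "c < q" "v = dig t (q + c)" using digit_div[of "Suc n" t q c] by simp_all
    obtain a where a: "a < q" "u = dig t a" "u \<noteq> 0" using u unfolding S_def by blast
    have "\<not> conflict u v" using noconf[of a "q + c"] a c by simp
    moreover have "v \<noteq> 0" using v J(1) unfolding indep_def by auto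
    ultimately show False using a(3) adj_sym[OF adj] unfolding conflict_def by simp
  qed
  have SS: "\<not> adj u v" if "u \<in> S" "v \<in> S" for u v
  proof -
    obtain a c where a: "a < q" "u = dig t a" "u \<noteq> 0" and c: "c < q" "v = dig t c" "v \<noteq> 0"
      using \<open>u \<in> S\<close> \<open>v \<in> S\<close> unfolding S_def by blast
    show ?thesis using noconf'[OF a(1) c(1)] a c adj_irrefl unfolding conflict_def by metis
  qed
  have "indep (J \<union> S)"
    using J(1) S1 JS SS adj_sym unfolding indep_def by blast
  moreover have "\<forall>v\<in>J \<union> S. lay v \<le> Suc i" using J(2) lay_S by (auto simp: le_SucI)
  moreover have "\<exists>a<q. v = dig (t mod M) a" if v: "v \<in> J \<union> S" "lay v = Suc i" for v
  proof -
    have "v \<in> S" using v J(2) by fastforce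
    then obtain a where "a < q" "v = dig t a" unfolding S_def by blast
    then show ?thesis using digit_mod[of a q "Suc n" t] by auto
  qed
  moreover have "x + wt t = sum W (J \<union> S)"
  proof -
    have "finite S" by (rule finite_subset[OF S1]) simp
    then have "sum W (J \<union> S) = sum W J + sum W S"
      by (rule sum.union_disjoint[OF finite_indep[OF J(1)] _ disj])
    then show ?thesis using J(4) sum_digits[OF inj] unfolding S_def by simp
  qed
  ultimately show ?thesis unfolding attained_def by blast
qed

lemma ex_code:
  assumes "S \<subseteq> {1..n}" "card S \<le> q"
  shows "\<exists>s<M. codes s S"
proof -
  have fin: "finite S" by (rule finite_subset[OF assms(1)]) simp
  obtain h where h: "bij_betw h {0..<card S} S" using ex_bij_betw_nat_finite[OF fin] by blast
  define g where "g a = (if a < card S then h a else 0)" for a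
  have hS: "h a \<in> {1..n}" if "a < card S" for a
  proof -
    have "h a \<in> S" using bij_betwE[OF h] that by simp
    then show ?thesis using assms(1) by blast
  qed
  have "g a < Suc n" for a using hS[of a] unfolding g_def by auto
  then obtain s where s: "s < M" "\<And>a. a < q \<Longrightarrow> dig s a = g a"
    using ex_digits[of q g "Suc n"] by blast
  have "g a \<noteq> 0 \<longleftrightarrow> a < card S" for a using hS[of a] unfolding g_def by auto
  then have A: "{a. a < q \<and> dig s a \<noteq> 0} = {0..<card S}" using s(2) assms(2) by auto
  have eq: "dig s a = h a" if "a \<in> {0..<card S}" for a
    using that s(2) assms(2) unfolding g_def by auto
  have "bij_betw (dig s) {0..<card S} S"
    by (rule bij_betw_cong[THEN iffD2, OF _ h]) (rule eq)
  then have "codes s S" unfolding codes_def A bij_betw_def by blast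
  then show ?thesis using s(1) by blast
qed

text \<open>If every admissible step has been relaxed, an entry dominates every independent set that it
  describes. In the induction the set is cut off at layer \<open>i\<close>, and its layers \<open>i + 1\<close> and \<open>i\<close>
  form the step \<open>t\<close> that reaches it; codes exist because a layer holds at most \<open>q\<close> vertices of
  the set.\<close>
lemma table_complete:
  assumes dom: "\<And>i t. i < n \<Longrightarrow> t < M * M \<Longrightarrow> ok i t \<Longrightarrow> F i (t div M) + wt t \<le> F (Suc i) (t mod M)"
  shows "i \<le> n \<Longrightarrow> indep J \<Longrightarrow> \<forall>v\<in>J. lay v \<le> i \<Longrightarrow> s < M \<Longrightarrow> codes s {v \<in> J. lay v = i} \<Longrightarrow> sum W J \<le> F i s"
proof (induction i arbitrary: J s)
  case 0
  have "J = {}"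
  proof (rule ccontr)
    assume "J \<noteq> {}"
    then obtain v where "v \<in> J" by blast
    then have "v \<in> {1..n}" "lay v \<le> 0" using 0 unfolding indep_def by blast+
    then show False using lay_range[of v] by simp
  qed
  then show ?case by simp
next
  case (Suc i)
  define J' L L' where "J' = {v \<in> J. lay v \<le> i}" and "L = {v \<in> J. lay v = Suc i}"
    and "L' = {v \<in> J. lay v = i}"
  note J = Suc.prems(2)[unfolded indep_def]
  have indJ': "indep J'" using J unfolding indep_def J'_def by blast
  have "card L' \<le> q" by (rule card_layer[of L' i]) (use J in \<open>auto simp: L'_def\<close>)
  moreover have "L' \<subseteq> {1..n}" using J unfolding L'_def by blast
  ultimately obtain s' where s': "s' < M" "codes s' L'" using ex_code by blast
  have "{v \<in> J'. lay v = i} = L'" unfolding J'_def L'_def by auto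
  then have IH: "sum W J' \<le> F i s'"
  proof (intro Suc.IH[OF _ indJ' _ s'(1)])
    show "\<forall>v\<in>J'. lay v \<le> i" unfolding J'_def by blast
  qed (use Suc.prems(1) s'(2) in simp_all)
  \<comment> \<open>the step from the set coded by \<open>s'\<close> to the one coded by \<open>s\<close>\<close>
  define t where "t = s + M * s'"
  have ts: "t mod M = s" "t div M = s'" unfolding t_def using Suc.prems(4) by simp_all
  have tM: "t < M * M"
  proof -
    have "s + M * s' < M + M * s'" using Suc.prems(4) by simp
    also have "\<dots> = M * Suc s'" by simp
    also have "\<dots> \<le> M * M" using s'(1) by (intro mult_le_mono2) simp
    finally show ?thesis unfolding t_def .
  qed
  have d1: "dig t a = dig s a" if "a < q" for a using digit_mod[OF that, of "Suc n" t] ts by simp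
  have d2: "dig t (q + a) = dig s' a" for a using digit_div[of "Suc n" t q a] ts by simp
  have A: "{a. a < q \<and> dig t a \<noteq> 0} = {a. a < q \<and> dig s a \<noteq> 0}" using d1 by auto
  have inj: "inj_on (dig t) {a. a < q \<and> dig t a \<noteq> 0}" and img: "dig t ` {a. a < q \<and> dig t a \<noteq> 0} = L"
  proof -
    have c: "inj_on (dig s) {a. a < q \<and> dig s a \<noteq> 0}" "dig s ` {a. a < q \<and> dig s a \<noteq> 0} = L"
      using Suc.prems(5) unfolding codes_def L_def by blast+
    show "inj_on (dig t) {a. a < q \<and> dig t a \<noteq> 0}" using c(1) d1 unfolding inj_on_def by auto
    show "dig t ` {a. a < q \<and> dig t a \<noteq> 0} = L"
      unfolding c(2)[symmetric] by (rule image_cong) (use d1 in auto)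
  qed
  have L1: "dig t a \<in> L" if "a < q" "dig t a \<noteq> 0" for a using that img by blast
  have L2: "dig t c \<in> L'" if "q \<le> c" "dig t c \<noteq> 0" for c
  proof -
    have "c < 2 * q"
    proof (rule ccontr)
      assume "\<not> c < 2 * q"
      then have "dig t c = 0"
        using digit_beyond[of "Suc n" t "2 * q" c] tM by (simp add: mult_2 power_add)
      then show False using that(2) by simp
    qed
    then have "c - q < q" "dig s' (c - q) = dig t c" using that(1) d2[of "c - q"] by auto
    moreover from this have "dig s' (c - q) \<in> dig s' ` {a. a < q \<and> dig s' a \<noteq> 0}"
      using that(2) by (intro imageI) simp
    ultimately show ?thesis using s'(2) unfolding codes_def by simp
  qed
  have "ok i t"
    unfolding ok_def
  proof (intro allI impI conjI)
    fix a assume a: "a < q"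
    show "dig t a = 0 \<or> lay (dig t a) = Suc i" using L1[OF a] unfolding L_def by blast
    fix b
    show "\<not> conflict (dig t a) (dig t (Suc a + b))"
    proof
      let ?u = "dig t a" and ?v = "dig t (Suc a + b)"
      assume "conflict ?u ?v"
      then have c: "?u \<noteq> 0" "?v \<noteq> 0" "?u = ?v \<or> adj ?u ?v" unfolding conflict_def by auto
      have u: "?u \<in> J" "lay ?u = Suc i" using L1[OF a c(1)] unfolding L_def by auto
      show False
      proof (cases "Suc a + b < q")
        case True
        then have "?v \<in> J" using L1[OF True c(2)] unfolding L_def by auto
        moreover have "?u \<noteq> ?v" using inj_onD[OF inj, of a "Suc a + b"] a True c by auto
        ultimately show False using c(3) u J by blast
      next
        case False
        then have "?v \<in> L'" using L2[OF _ c(2)] by simp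
        then have "?v \<in> J" "lay ?v = i" unfolding L'_def by auto
        then show False using c(3) u J by force
      qed
    qed
  qed
  then have "F i s' + wt t \<le> F (Suc i) s" using dom[of i t] tM ts Suc.prems(1) by simp
  moreover have "sum W J = sum W J' + wt t"
  proof -
    have "J = J' \<union> L" using Suc.prems(3) unfolding J'_def L_def by (auto simp: le_Suc_eq)
    moreover have "J' \<inter> L = {}" unfolding J'_def L_def by auto
    moreover have "finite J" by (rule finite_indep[OF Suc.prems(2)])
    ultimately have "sum W J = sum W J' + sum W L" by (auto intro: sum.union_disjoint)
    then show ?thesis using sum_digits[OF inj] img by simp
  qed
  ultimately show ?case using IH by linarith
qed

lemma table_optimal:
  assumes "\<And>i t. i < n \<Longrightarrow> t < M * M \<Longrightarrow> ok i t \<Longrightarrow> F i (t div M) + wt t \<le> F (Suc i) (t mod M)"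
    and "\<And>s. F n s \<le> best" and J: "indep J"
  shows "sum W J \<le> best"
proof -
  let ?L = "{v \<in> J. lay v = n}"
  have "card ?L \<le> q" by (rule card_layer[of ?L n]) (use J in \<open>auto simp: indep_def\<close>)
  moreover have "?L \<subseteq> {1..n}" using J unfolding indep_def by blast
  ultimately obtain s where s: "s < M" "codes s ?L" using ex_code by blast
  have "\<forall>v\<in>J. lay v \<le> n"
  proof
    fix v assume "v \<in> J"
    then have "v \<in> {1..n}" using J unfolding indep_def by blast
    then show "lay v \<le> n" using lay_range[of v] by simp
  qed
  then have "sum W J \<le> F n s" using table_complete[of F n J s, OF assms(1)] J s by simp
  then show ?thesis using assms(2) le_trans by blast
qed

text \<open>The table is a single array, with the entry for layer \<open>i\<close> and code \<open>s\<close> at address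
  \<open>i * M + s\<close>. The last clause says that all steps before step \<open>t\<close> of round \<open>i\<close> have been
  relaxed.\<close>
definition table_inv :: "nat \<Rightarrow> nat \<Rightarrow> (nat \<Rightarrow> nat) \<Rightarrow> nat \<Rightarrow> bool" where
  "table_inv i t A best \<longleftrightarrow>
     (\<forall>i'\<le>n. \<forall>s<M. attained i' s (A (i' * M + s))) \<and>
     (\<forall>x. A x \<le> best) \<and> (\<exists>J. indep J \<and> best = sum W J) \<and>
     (\<forall>i' t'. i' < i \<or> i' = i \<and> t' < t \<longrightarrow> t' < M * M \<longrightarrow> ok i' t' \<longrightarrow>
        A (i' * M + t' div M) + wt t' \<le> A (Suc i' * M + t' mod M))"

lemma address_inject: "s < M \<Longrightarrow> s' < M \<Longrightarrow> i * M + s = i' * M + s' \<longleftrightarrow> i = i' \<and> s = s'"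
proof
  assume s: "s < M" "s' < M" and eq: "i * M + s = i' * M + s'"
  have "(i * M + s) div M = i" "(i' * M + s') div M = i'" using s by simp_all
  then show "i = i' \<and> s = s'" using eq by simp
qed simp

lemma table_inv_init: "table_inv 0 0 (\<lambda>_. 0) 0"
  unfolding table_inv_def using attained_empty by (auto intro!: exI[of _ "{}"] simp: indep_def)

lemma table_inv_skip: "table_inv i t A best \<Longrightarrow> \<not> ok i t \<Longrightarrow> table_inv i (Suc t) A best"
  unfolding table_inv_def less_Suc_eq by blast

lemma table_inv_row: "table_inv i (M * M) A best \<Longrightarrow> table_inv (Suc i) 0 A best"
  unfolding table_inv_def less_Suc_eq by blast

lemma attained_indep: "attained i s x \<Longrightarrow> \<exists>J. indep J \<and> x = sum W J"
  unfolding attained_def by blast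

text \<open>Round \<open>i\<close> writes only to row \<open>i + 1\<close> and entries never decrease, so the steps relaxed earlier
  remain so.\<close>
lemma table_inv_step:
  fixes A :: "nat \<Rightarrow> nat"
  assumes inv: "table_inv i t A best" and i: "i < n" and t: "t < M * M" and ok: "ok i t"
  defines "c \<equiv> A (i * M + t div M) + wt t" and "x \<equiv> Suc i * M + t mod M"
  shows "table_inv i (Suc t) (A(x := max (A x) c)) (max best c)"
proof -
  have att: "attained i' s (A (i' * M + s))" if "i' \<le> n" "s < M" for i' s
    using inv that unfolding table_inv_def by blast
  have best: "A y \<le> best" for y using inv unfolding table_inv_def by blast
  obtain J where J: "indep J" "best = sum W J" using inv unfolding table_inv_def by blast
  have dom: "A (i' * M + t' div M) + wt t' \<le> A (Suc i' * M + t' mod M)"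
    if "i' < i \<or> i' = i \<and> t' < t" "t' < M * M" "ok i' t'" for i' t'
    using inv that unfolding table_inv_def by blast
  let ?A = "A(x := max (A x) c)"
  have div: "t' div M < M" if "t' < M * M" for t' using that by (simp add: less_mult_imp_div_less)
  have md: "t' mod M < M" for t' by simp
  have attc: "attained (Suc i) (t mod M) c"
    unfolding c_def by (rule attained_step[OF ok]) (use att i div[OF t] in simp)
  have addr: "i' * M + s = x \<longleftrightarrow> i' = Suc i \<and> s = t mod M" if "s < M" for i' s
    unfolding x_def by (rule address_inject[OF that md])
  have 1: "attained i' s (?A (i' * M + s))" if "i' \<le> n" "s < M" for i' s
    using att[OF that] attc addr[OF that(2), of i'] unfolding max_def by auto
  have 2: "?A y \<le> max best c" for y using best[of y] best[of x] by (simp add: max.coboundedI1)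
  have 3: "\<exists>J. indep J \<and> max best c = sum W J"
    using J attained_indep[OF attc] unfolding max_def by metis
  have up: "A y \<le> ?A y" for y by simp
  have 4: "?A (i' * M + t' div M) + wt t' \<le> ?A (Suc i' * M + t' mod M)"
    if a: "i' < i \<or> i' = i \<and> t' < Suc t" "t' < M * M" "ok i' t'" for i' t'
  proof -
    have "i' * M + t' div M \<noteq> x" using addr[OF div[OF a(2)], of i'] a(1) by auto
    then have same: "?A (i' * M + t' div M) = A (i' * M + t' div M)" by simp
    show ?thesis
    proof (cases "i' = i \<and> t' = t")
      case True
      then have "A (i' * M + t' div M) + wt t' = c" "Suc i' * M + t' mod M = x"
        unfolding c_def x_def by auto
      then show ?thesis unfolding same by simp
    next
      case False
      then have "A (i' * M + t' div M) + wt t' \<le> A (Suc i' * M + t' mod M)"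
        using dom a by (auto simp: less_Suc_eq)
      then show ?thesis unfolding same using up le_trans by blast
    qed
  qed
  show ?thesis unfolding table_inv_def using 1 2 3 4 by blast
qed

lemma table_inv_optimal:
  assumes "table_inv n 0 A best" "indep J"
  shows "sum W J \<le> best"
proof (rule table_optimal[of "\<lambda>i s. A (i * M + s)", OF _ _ assms(2)])
  show "A (n * M + s) \<le> best" for s using assms(1) unfolding table_inv_def by blast
  show "A (i * M + t div M) + wt t \<le> A (Suc i * M + t mod M)" if "i < n" "t < M * M" "ok i t" for i t
    using assms(1) that unfolding table_inv_def by blast
qed

lemma wt_partial_le:
  assumes "\<And>v. W v \<le> m" shows "(\<Sum>c<a. W (dig t c)) \<le> a * m"
proof -
  have "(\<Sum>c<a. W (dig t c)) \<le> of_nat (card {..<a}) * m" by (rule sum_bounded_above) (rule assms)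
  then show ?thesis by simp
qed

lemma indep_weight_le:
  assumes "\<And>v. W v \<le> m" "indep J" shows "sum W J \<le> n * m"
proof -
  have "sum W J \<le> of_nat (card J) * m" by (rule sum_bounded_above) (rule assms)
  also have "\<dots> \<le> n * m"
    using card_mono[of "{1..n}" J] assms(2) by (simp add: indep_def mult_le_mono1)
  finally show ?thesis .
qed

end

section \<open>Weights that identify their set\<close>

text \<open>The factors \<open>2\<close> contribute \<open>2\<^sup>n\<close>, which makes room for the \<open>n\<close> bits below.\<close>
definition common_multiple :: "(nat \<Rightarrow> nat) \<Rightarrow> nat \<Rightarrow> nat" where
  "common_multiple b n = (\<Prod>i<n. 2 * b i)"

definition code_weight :: "(nat \<Rightarrow> nat) \<Rightarrow> (nat \<Rightarrow> nat) \<Rightarrow> nat \<Rightarrow> nat \<Rightarrow> nat" where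
  "code_weight a b n i = a i * (common_multiple b n div b i) + 2 ^ i"

text \<open>The total weight consists of the scaled original weight in the upper bits and the
  characteristic vector of the set in the lower \<open>n\<close> bits, without any carry between them.\<close>
lemma code_weight_sum:
  fixes w :: "nat \<Rightarrow> rat"
  assumes b: "\<And>i. i < n \<Longrightarrow> 0 < b i" and w: "\<And>i. i < n \<Longrightarrow> w i = of_nat (a i) / of_nat (b i)"
    and I: "I \<subseteq> {..<n}"
  shows "\<exists>X. sum (code_weight a b n) I = 2 ^ n * X + set_encode I \<and>
    of_nat X = of_nat (\<Prod>i<n. b i) * sum w I"
proof -
  have fin: "finite I" by (rule finite_subset[OF I]) simp
  let ?K = "\<Prod>i<n. b i"
  let ?A = "\<lambda>i. a i * (\<Prod>j\<in>{..<n} - {i}. b j)"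
  have K: "?K = b i * (\<Prod>j\<in>{..<n} - {i}. b j)" if "i < n" for i
    using that by (simp add: prod.remove)
  have cw: "code_weight a b n i = 2 ^ n * ?A i + 2 ^ i" if "i < n" for i
  proof -
    have "common_multiple b n = b i * (2 ^ n * (\<Prod>j\<in>{..<n} - {i}. b j))"
      unfolding common_multiple_def using K[OF that] by (simp add: prod.distrib algebra_simps)
    then have "common_multiple b n div b i = 2 ^ n * (\<Prod>j\<in>{..<n} - {i}. b j)"
      using b[OF that] by simp
    then show ?thesis unfolding code_weight_def by simp
  qed
  have "sum (code_weight a b n) I = (\<Sum>i\<in>I. 2 ^ n * ?A i + 2 ^ i)"
    by (rule sum.cong) (use cw I in auto)
  also have "\<dots> = 2 ^ n * sum ?A I + set_encode I"
    by (simp add: sum.distrib sum_distrib_left set_encode_def)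
  finally have 1: "sum (code_weight a b n) I = 2 ^ n * sum ?A I + set_encode I" .
  have A: "of_nat (?A i) = of_nat ?K * w i" if "i < n" for i
    using b[OF that] unfolding w[OF that] K[OF that] by (simp add: field_simps)
  have "(of_nat (sum ?A I) :: rat) = (\<Sum>i\<in>I. of_nat (?A i))" by simp
  also have "\<dots> = (\<Sum>i\<in>I. of_nat ?K * w i)" by (rule sum.cong) (use A I in auto)
  also have "\<dots> = of_nat ?K * sum w I" by (simp add: sum_distrib_left)
  finally show ?thesis using 1 by blast
qed

lemma set_encode_less: "I \<subseteq> {..<n} \<Longrightarrow> set_encode I < 2 ^ n"
proof -
  assume I: "I \<subseteq> {..<n}"
  have "set_encode I \<le> set_encode {..<n}"
    unfolding set_encode_def by (rule sum_mono2) (use I in auto)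
  also have "\<dots> = 2 ^ n - 1" unfolding set_encode_def by (simp add: sum_power2 lessThan_atLeast0)
  also have "\<dots> < 2 ^ n" by simp
  finally show ?thesis .
qed

lemma code_weight_reflects_order:
  fixes w :: "nat \<Rightarrow> rat"
  assumes b: "\<And>i. i < n \<Longrightarrow> 0 < b i" and w: "\<And>i. i < n \<Longrightarrow> w i = of_nat (a i) / of_nat (b i)"
    and I: "I \<subseteq> {..<n}" and J: "J \<subseteq> {..<n}"
    and le: "sum (code_weight a b n) J \<le> sum (code_weight a b n) I"
  shows "sum w J \<le> sum w I"
proof -
  obtain X where X: "sum (code_weight a b n) I = 2 ^ n * X + set_encode I"
      "of_nat X = of_nat (\<Prod>i<n. b i) * sum w I"
    using code_weight_sum[of n b w a, OF b w I] by blast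
  obtain Y where Y: "sum (code_weight a b n) J = 2 ^ n * Y + set_encode J"
      "of_nat Y = of_nat (\<Prod>i<n. b i) * sum w J"
    using code_weight_sum[of n b w a, OF b w J] by blast
  have "Y \<le> X"
  proof (rule ccontr)
    assume "\<not> Y \<le> X"
    then have "(2::nat) ^ n * Suc X \<le> 2 ^ n * Y" by (intro mult_le_mono2) simp
    then show False using le X(1) Y(1) set_encode_less[OF I] by simp
  qed
  then have "of_nat (\<Prod>i<n. b i) * sum w J \<le> of_nat (\<Prod>i<n. b i) * sum w I"
    unfolding X(2)[symmetric] Y(2)[symmetric] by simp
  moreover have "0 < (\<Prod>i<n. b i)" using b by (intro prod_pos) simp
  then have "(0::rat) < of_nat (\<Prod>i<n. b i)" by (simp only: of_nat_0_less_iff)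
  ultimately show ?thesis by (simp only: mult_le_cancel_left_pos)
qed

lemma code_weight_bit:
  fixes w :: "nat \<Rightarrow> rat"
  assumes b: "\<And>i. i < n \<Longrightarrow> 0 < b i"
    and I: "I \<subseteq> {..<n}" and i: "i < n"
  shows "odd (sum (code_weight a b n) I div 2 ^ i) \<longleftrightarrow> i \<in> I"
proof -
  obtain X where X: "sum (code_weight a b n) I = 2 ^ n * X + set_encode I"
    using code_weight_sum[of n b "\<lambda>i. of_nat (a i) / of_nat (b i)" a I, OF b refl I] by blast
  have fin: "finite I" by (rule finite_subset[OF I]) simp
  obtain k where k: "n = i + Suc k" using i less_iff_Suc_add by auto
  have "sum (code_weight a b n) I = set_encode I + 2 ^ i * (2 * (2 ^ k * X))"
    unfolding X by (simp add: k power_add)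
  then have "sum (code_weight a b n) I div 2 ^ i = 2 * (2 ^ k * X) + set_encode I div 2 ^ i"
    by simp
  then have "odd (sum (code_weight a b n) I div 2 ^ i) \<longleftrightarrow> i \<in> set_decode (set_encode I)"
    by (simp add: set_decode_def)
  then show ?thesis using set_encode_inverse[OF fin] by simp
qed

section \<open>The input list\<close>

lemma nth_concat_uniform:
  assumes "\<And>xs. xs \<in> set xss \<Longrightarrow> length xs = k" "i < length xss" "j < k"
  shows "concat xss ! (i * k + j) = xss ! i ! j"
  using assms
proof (induction xss arbitrary: i)
  case (Cons xs xss)
  then have l: "length xs = k" by simp
  show ?case
  proof (cases i)
    case 0 then show ?thesis using l Cons.prems(3) by (simp add: nth_append)
  next
    case (Suc i')
    then show ?thesis using l Cons by (simp add: nth_append)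
  qed
qed simp

lemma length_concat_uniform:
  "(\<And>xs. xs \<in> set xss \<Longrightarrow> length xs = k) \<Longrightarrow> length (concat xss) = length xss * k"
  by (induction xss) auto

definition numer :: "(nat \<Rightarrow> rat) \<Rightarrow> nat \<Rightarrow> nat" where "numer w i = nat (fst (quotient_of (w i)))"
definition denom :: "(nat \<Rightarrow> rat) \<Rightarrow> nat \<Rightarrow> nat" where "denom w i = nat (snd (quotient_of (w i)))"

lemma numer_denom: "0 \<le> w i \<Longrightarrow> w i = of_nat (numer w i) / of_nat (denom w i)" "0 < denom w i"
proof -
  obtain a b where ab: "quotient_of (w i) = (a, b)" by fastforce
  have b: "0 < b" using quotient_of_denom_pos[OF ab] .
  then show "0 < denom w i" by (simp add: denom_def ab)
  assume w: "0 \<le> w i"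
  have eq: "w i = of_int a / of_int b" using quotient_of_div[OF ab] .
  then have "0 \<le> a" using w b by (simp add: zero_le_divide_iff)
  then show "w i = of_nat (numer w i) / of_nat (denom w i)"
    unfolding numer_def denom_def ab using eq b by (simp add: of_nat_nat)
qed

text \<open>The adjacency matrix and the list of fractions are concatenations of blocks of equal length,
  which gives access to single entries.\<close>
lemma encode_mwis_alt:
  "encode_mwis (G, w) = card (verts G) #
     concat (map (\<lambda>i. map (\<lambda>j. if {i, j} \<in> edges G then 1 else 0) [0..<card (verts G)]) [0..<card (verts G)])
     @ concat (map (\<lambda>i. [numer w i, denom w i]) [0..<card (verts G)])"
  by (simp add: Let_def numer_def denom_def case_prod_unfold)

lemma encode_mwis_nth:
  fixes G :: "nat ugraph" and w :: "nat \<Rightarrow> rat"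
  defines "n \<equiv> card (verts G)" and "xs \<equiv> encode_mwis (G, w)"
  shows "length xs = 1 + n * n + 2 * n" "xs ! 0 = n"
    and "i < n \<Longrightarrow> j < n \<Longrightarrow> xs ! Suc (i * n + j) = (if {i, j} \<in> edges G then 1 else 0)"
    and "i < n \<Longrightarrow> xs ! Suc (n * n + 2 * i) = numer w i"
    and "i < n \<Longrightarrow> xs ! Suc (n * n + Suc (2 * i)) = denom w i"
proof -
  let ?R = "map (\<lambda>i. map (\<lambda>j. if {i, j} \<in> edges G then 1 else 0::nat) [0..<n]) [0..<n]"
  let ?P = "map (\<lambda>i. [numer w i, denom w i]) [0..<n]"
  have xs: "xs = n # concat ?R @ concat ?P" unfolding xs_def n_def encode_mwis_alt ..
  have lR: "length (concat ?R) = n * n" by (subst length_concat_uniform[of _ n]) auto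
  have lP: "length (concat ?P) = n * 2" by (subst length_concat_uniform[of _ 2]) auto
  show "length xs = 1 + n * n + 2 * n" "xs ! 0 = n" using lR lP unfolding xs by simp_all
  { assume i: "i < n" and j: "j < n"
    have "Suc i * n \<le> n * n" using i by (intro mult_le_mono1) simp
    then have "i * n + j < n * n" using j by simp
    moreover have "concat ?R ! (i * n + j) = ?R ! i ! j"
      by (rule nth_concat_uniform) (use i j in auto)
    ultimately show "xs ! Suc (i * n + j) = (if {i, j} \<in> edges G then 1 else 0)"
      using lR i j unfolding xs by (simp add: nth_append) }
  { assume i: "i < n"
    have 1: "concat ?P ! (i * 2 + 0) = ?P ! i ! 0" by (rule nth_concat_uniform) (use i in auto)
    have 2: "concat ?P ! (i * 2 + 1) = ?P ! i ! 1" by (rule nth_concat_uniform) (use i in auto)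
    show "xs ! Suc (n * n + 2 * i) = numer w i"
      using 1 lR i unfolding xs by (simp add: nth_append mult.commute)
    show "xs ! Suc (n * n + Suc (2 * i)) = denom w i"
      using 2 lR i unfolding xs by (simp add: nth_append mult.commute) }
qed

section \<open>The program\<close>

declare encode_mwis.simps [simp del]

abbreviation eAdd (infixl "\<oplus>" 65) where "a \<oplus> b \<equiv> Arith Add a b"
abbreviation eSub (infixl "\<ominus>" 65) where "a \<ominus> b \<equiv> Arith Sub a b"
abbreviation eMul (infixl "\<otimes>" 70) where "a \<otimes> b \<equiv> Arith Mul a b"
abbreviation eDiv (infixl "\<oslash>" 70) where "a \<oslash> b \<equiv> Arith Div a b"
abbreviation eMod :: "expr \<Rightarrow> expr \<Rightarrow> expr" where "eMod a b \<equiv> a \<ominus> b \<otimes> (a \<oslash> b)"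
abbreviation eDist :: "expr \<Rightarrow> expr \<Rightarrow> expr" where "eDist a b \<equiv> (a \<ominus> b) \<oplus> (b \<ominus> a)"

notation Seq (infixr ";;" 60)

lemma eMod_simp [simp]: "(x::nat) - m * (x div m) = x mod m"
  by (simp add: minus_mult_div_eq_mod)

text \<open>Names for registers and arrays. Vertices are numbered from \<open>1\<close> in the program. The array
  \<open>aW\<close> holds the new weights, \<open>alay\<close> the layers, and \<open>aF\<close> the table; arrays \<open>0\<close> and
  \<open>1\<close> are input and output.\<close>
abbreviation (input) rn :: nat where "rn \<equiv> 0"
abbreviation (input) rN :: nat where "rN \<equiv> 1"
abbreviation (input) rq :: nat where "rq \<equiv> 2"
abbreviation (input) rqq :: nat where "rqq \<equiv> 3"
abbreviation (input) ri :: nat where "ri \<equiv> 4"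
abbreviation (input) rj :: nat where "rj \<equiv> 5"
abbreviation (input) rD :: nat where "rD \<equiv> 6"
abbreviation (input) rP :: nat where "rP \<equiv> 7"
abbreviation (input) rany :: nat where "rany \<equiv> 8"
abbreviation (input) rr :: nat where "rr \<equiv> 9"
abbreviation (input) rflag :: nat where "rflag \<equiv> 10"
abbreviation (input) rM :: nat where "rM \<equiv> 11"
abbreviation (input) rMM :: nat where "rMM \<equiv> 12"
abbreviation (input) rt :: nat where "rt \<equiv> 13"
abbreviation (input) rbad :: nat where "rbad \<equiv> 14"
abbreviation (input) rwt :: nat where "rwt \<equiv> 15"
abbreviation (input) rx :: nat where "rx \<equiv> 16"
abbreviation (input) ra :: nat where "ra \<equiv> 17"
abbreviation (input) ru :: nat where "ru \<equiv> 18"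
abbreviation (input) ry :: nat where "ry \<equiv> 19"
abbreviation (input) rb :: nat where "rb \<equiv> 20"
abbreviation (input) rv :: nat where "rv \<equiv> 21"
abbreviation (input) rcand :: nat where "rcand \<equiv> 22"
abbreviation (input) rbest :: nat where "rbest \<equiv> 23"
abbreviation (input) rR :: nat where "rR \<equiv> 24"

abbreviation (input) aW :: nat where "aW \<equiv> 3"
abbreviation (input) alay :: nat where "alay \<equiv> 4"
abbreviation (input) aF :: nat where "aF \<equiv> 5"

text \<open>The input array starts with its length and \<open>n\<close>, so the matrix begins in cell \<open>2\<close>. The
  fractions follow it, each denominator one cell after its numerator.\<close>
definition adj_expr :: "nat \<Rightarrow> nat \<Rightarrow> expr" where
  "adj_expr u v = Cell 0 (Const 2 \<oplus> (Reg u \<ominus> Const 1) \<otimes> Reg rn \<oplus> (Reg v \<ominus> Const 1))"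
definition num_expr :: "nat \<Rightarrow> expr" where
  "num_expr i = Cell 0 (Const 2 \<oplus> Reg rn \<otimes> Reg rn \<oplus> Const 2 \<otimes> Reg i)"
definition den_expr :: "nat \<Rightarrow> expr" where
  "den_expr i = Cell 0 (Const 3 \<oplus> Reg rn \<otimes> Reg rn \<oplus> Const 2 \<otimes> Reg i)"
text \<open>Nonzero iff both vertices are proper ones and are equal or adjacent; with truncated subtraction
  \<open>1 - d\<close> is nonzero exactly for distance \<open>d = 0\<close>.\<close>
definition conflict_expr :: "nat \<Rightarrow> nat \<Rightarrow> expr" where
  "conflict_expr u v = Reg u \<otimes> Reg v \<otimes> (adj_expr u v \<oplus> (Const 1 \<ominus> eDist (Reg u) (Reg v)))"

definition off_layer_expr :: "nat \<Rightarrow> expr" where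
  "off_layer_expr u = Reg u \<otimes> eDist (Cell alay (Reg u)) (Reg ri \<oplus> Const 1)"

lemma off_layer_expr_eval:
  "eval_expr (off_layer_expr u) s = 0 \<longleftrightarrow> regs s u = 0 \<or> arrays s alay (regs s u) = Suc (regs s ri)"
  unfolding off_layer_expr_def by auto

definition setup_code :: "nat \<Rightarrow> com" where
  "setup_code q = Assign rn (Cell 0 (Const 1)) ;; Assign rN (Reg rn \<oplus> Const 1) ;;
     Assign rq (Const q) ;; Assign rqq (Const (2 * q)) ;;
     Assign rD (Const 1) ;; Assign rP (Const 1) ;; Assign rM (Const 1)"

definition denominators_code :: com where
  "denominators_code = For ri rn (Assign rD (Reg rD \<otimes> (Const 2 \<otimes> den_expr ri)))"

definition weights_code :: com where
  "weights_code = For ri rn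
     (Store aW (Reg ri \<oplus> Const 1) (num_expr ri \<otimes> (Reg rD \<oslash> den_expr ri) \<oplus> Reg rP) ;;
      Assign rP (Reg rP \<otimes> Const 2))"

text \<open>The last two factors are nonzero iff \<open>u\<close> was reached in an earlier round; this excludes the
  vertices reached in the current one, whose layer is \<open>i + 1\<close>.\<close>
definition layer_test_code :: com where
  "layer_test_code = For ru rN
     (Cond (Reg ru \<otimes> Reg rj \<otimes> adj_expr ru rj \<otimes> Cell alay (Reg ru) \<otimes>
        (Reg ri \<oplus> Const 1 \<ominus> Cell alay (Reg ru))) (Assign rflag (Const 1)) Skip)"

text \<open>Register \<open>rr\<close> remembers some unreached vertex as the seed of a new component, for a round that
  reaches nothing else.\<close>
definition layer_vertex_code :: com where
  "layer_vertex_code = Cond (Cell alay (Reg rj)) Skip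
     ((Assign rr (Reg rj) ;; Assign rflag (Const 0)) ;; layer_test_code ;;
      Cond (Reg rflag) (Store alay (Reg rj) (Reg ri \<oplus> Const 1) ;; Assign rany (Const 1)) Skip)"

definition layer_code :: com where
  "layer_code = For ri rn ((Assign rany (Const 0) ;; Assign rr (Const 0)) ;;
     For rj rN layer_vertex_code ;;
     Cond (Reg rany) Skip (Store alay (Reg rr) (Reg ri \<oplus> Const 1)))"

definition power_code :: com where
  "power_code = For ra rq (Assign rM (Reg rM \<otimes> Reg rN)) ;; Assign rMM (Reg rM \<otimes> Reg rM)"

definition digit_test_code :: com where
  "digit_test_code = For rb rqq
     (Assign rv (eMod (Reg ry) (Reg rN)) ;; Assign ry (Reg ry \<oslash> Reg rN) ;;
      Cond (conflict_expr ru rv) (Assign rbad (Const 1)) Skip)"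

definition digit_code :: com where
  "digit_code =
     (Assign ru (eMod (Reg rx) (Reg rN)) ;; Assign rx (Reg rx \<oslash> Reg rN) ;;
      Assign rwt (Reg rwt \<oplus> Cell aW (Reg ru)) ;;
      Cond (off_layer_expr ru) (Assign rbad (Const 1)) Skip ;;
      Assign ry (Reg rx)) ;;
     digit_test_code"

text \<open>The last two conditionals take maxima: a truncated difference is nonzero iff the candidate is
  larger than the stored number.\<close>
definition commit_code :: com where
  "commit_code = Cond (Reg rbad) Skip
     (let cell = (Reg ri \<oplus> Const 1) \<otimes> Reg rM \<oplus> eMod (Reg rt) (Reg rM) in
      Assign rcand (Cell aF (Reg ri \<otimes> Reg rM \<oplus> Reg rt \<oslash> Reg rM) \<oplus> Reg rwt) ;;
      Cond (Reg rcand \<ominus> Cell aF cell) (Store aF cell (Reg rcand)) Skip ;;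
      Cond (Reg rcand \<ominus> Reg rbest) (Assign rbest (Reg rcand)) Skip)"

definition table_code :: com where
  "table_code = For ri rn (For rt rMM
     ((Assign rbad (Const 0) ;; Assign rwt (Const 0) ;; Assign rx (Reg rt)) ;;
      For ra rq digit_code ;; commit_code))"

definition output_code :: com where
  "output_code = Assign rR (Reg rbest) ;; For ri rn
     (Cond (eMod (Reg rR) (Const 2))
        (Store 1 (Const 0) (Cell 1 (Const 0) \<oplus> Const 1) ;; Store 1 (Cell 1 (Const 0)) (Reg ri)) Skip ;;
      Assign rR (Reg rR \<oslash> Const 2))"

definition mwis_code :: "nat \<Rightarrow> com" where
  "mwis_code q = setup_code q ;; denominators_code ;; weights_code ;; layer_code ;;
     power_code ;; table_code ;; output_code"

lemmas code_defs = setup_code_def denominators_code_def weights_code_def layer_test_code_def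
  layer_vertex_code_def layer_code_def power_code_def digit_test_code_def digit_code_def
  commit_code_def table_code_def output_code_def adj_expr_def num_expr_def den_expr_def
  conflict_expr_def off_layer_expr_def Let_def

lemma fits_mwis_code: "fits (100 + 2 * q) (mwis_code q)"
  by (simp add: mwis_code_def code_defs)

section \<open>Correctness of the program\<close>

text \<open>The vertices of the program are those of \<open>G\<close> shifted by one, since \<open>0\<close> is the dummy vertex.\<close>
definition edge :: "nat ugraph \<Rightarrow> nat \<Rightarrow> nat \<Rightarrow> bool" where
  "edge G u v \<longleftrightarrow> u \<noteq> 0 \<and> v \<noteq> 0 \<and> {u - 1, v - 1} \<in> edges G"

text \<open>An instance together with bounds \<open>m\<close> on the new weights and \<open>B\<close> on the length of numbers.
  The latter covers all numbers that the program stores: loop bounds and codes, products of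
  denominators, powers of two, and sums of at most \<open>n + q\<close> weights, the largest candidates
  that the dynamic program computes.\<close>
locale instance_run =
  fixes q :: nat and G :: "nat ugraph" and w :: "nat \<Rightarrow> rat" and B m :: nat
  assumes q: "0 < q" and G: "simple_graph G" and free: "\<not> induced_minor (star q) G"
    and verts: "verts G = {0..<card (verts G)}" and nonneg: "\<And>v. v \<in> verts G \<Longrightarrow> 0 \<le> w v"
    and n_less: "Suc (card (verts G)) < 2 ^ B"
    and q_less: "2 * q < 2 ^ B"
    and pow2_less: "2 ^ card (verts G) < (2::nat) ^ B"
    and common_less: "common_multiple (denom w) (card (verts G)) < 2 ^ B"
    and weight_le: "\<And>i. i < card (verts G) \<Longrightarrow> code_weight (numer w) (denom w) (card (verts G)) i \<le> m"
    and m_less: "(card (verts G) + q) * m < 2 ^ B"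
    and codes_less: "(Suc (card (verts G)) ^ q) * (Suc (card (verts G)) ^ q) < 2 ^ B"
begin

abbreviation n :: nat where "n \<equiv> card (verts G)"
abbreviation M :: nat where "M \<equiv> Suc n ^ q"

definition W :: "nat \<Rightarrow> nat" where
  "W v = (if 1 \<le> v \<and> v \<le> n then code_weight (numer w) (denom w) n (v - 1) else 0)"

definition inp :: "state \<Rightarrow> bool" where
  "inp s \<longleftrightarrow> arrays s 0 = arrays (initial_state (encode_mwis (G, w))) 0 \<and> regs s rn = n"

lemma inp_cong: "inp s \<Longrightarrow> arrays s' 0 = arrays s 0 \<Longrightarrow> regs s' rn = regs s rn \<Longrightarrow> inp s'"
  unfolding inp_def by simp

lemma initial_cell:
  "k < length xs \<Longrightarrow> arrays (initial_state xs) 0 (Suc k) = xs ! k"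
  unfolding initial_state_def by simp

lemma edge_range: "edge G u v \<Longrightarrow> u \<in> {1..n} \<and> v \<in> {1..n} \<and> u \<noteq> v"
proof -
  assume e: "edge G u v"
  then have "u - 1 \<in> verts G" "v - 1 \<in> verts G" "u - 1 \<noteq> v - 1"
    using simple_graph_edgeD[OF G, of "u - 1" "v - 1"] unfolding edge_def by auto
  then have "u - 1 < n" "v - 1 < n" "u \<noteq> v" using verts by (metis atLeastLessThan_iff)+
  then show ?thesis using e unfolding edge_def by auto
qed

lemma edge_sym: "edge G u v \<Longrightarrow> edge G v u"
  unfolding edge_def by (simp add: insert_commute)

lemma adj_expr_eval:
  assumes "inp s" "regs s u \<noteq> 0" "regs s v \<noteq> 0" "regs s u \<le> n" "regs s v \<le> n"
  shows "eval_expr (adj_expr u v) s = (if edge G (regs s u) (regs s v) then 1 else 0)"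
proof -
  let ?i = "regs s u - 1" and ?j = "regs s v - 1"
  have ij: "?i < n" "?j < n" using assms by auto
  have "Suc ?i * n \<le> n * n" using ij by (intro mult_le_mono1) simp
  then have l: "Suc (?i * n + ?j) < length (encode_mwis (G, w))"
    unfolding encode_mwis_nth using ij by simp
  have "eval_expr (adj_expr u v) s = arrays s 0 (Suc (Suc (?i * n + ?j)))"
    using assms(1) unfolding adj_expr_def inp_def by (simp add: ac_simps)
  also have "\<dots> = encode_mwis (G, w) ! Suc (?i * n + ?j)"
    using assms(1) initial_cell[OF l] unfolding inp_def by simp
  also have "\<dots> = (if edge G (regs s u) (regs s v) then 1 else 0)"
    using encode_mwis_nth(3)[of ?i G ?j w] ij assms(2,3) unfolding edge_def by simp
  finally show ?thesis .
qed

lemma conflict_expr_eval: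
  assumes "inp s" "regs s u \<le> n" "regs s v \<le> n"
  shows "eval_expr (conflict_expr u v) s \<noteq> 0 \<longleftrightarrow>
    regs s u \<noteq> 0 \<and> regs s v \<noteq> 0 \<and> (regs s u = regs s v \<or> edge G (regs s u) (regs s v))"
proof (cases "regs s u = 0 \<or> regs s v = 0")
  case True then show ?thesis unfolding conflict_expr_def by auto
next
  case False
  then show ?thesis
    using adj_expr_eval[of s u v] assms unfolding conflict_expr_def by auto
qed

lemma num_expr_eval:
  assumes "inp s" "regs s i < n" shows "eval_expr (num_expr i) s = numer w (regs s i)"
proof -
  have l: "Suc (n * n + 2 * regs s i) < length (encode_mwis (G, w))"
    unfolding encode_mwis_nth using assms by simp
  have "eval_expr (num_expr i) s = arrays s 0 (Suc (Suc (n * n + 2 * regs s i)))"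
    using assms(1) unfolding num_expr_def inp_def by simp
  also have "\<dots> = numer w (regs s i)"
    using assms initial_cell[OF l] encode_mwis_nth(4)[of "regs s i" G w] unfolding inp_def by simp
  finally show ?thesis .
qed

lemma den_expr_eval:
  assumes "inp s" "regs s i < n" shows "eval_expr (den_expr i) s = denom w (regs s i)"
proof -
  have l: "Suc (n * n + Suc (2 * regs s i)) < length (encode_mwis (G, w))"
    unfolding encode_mwis_nth using assms by simp
  have "eval_expr (den_expr i) s = arrays s 0 (Suc (Suc (n * n + Suc (2 * regs s i))))"
    using assms(1) unfolding den_expr_def inp_def by (simp add: eval_nat_numeral)
  also have "\<dots> = denom w (regs s i)"
    using assms initial_cell[OF l] encode_mwis_nth(5)[of "regs s i" G w] unfolding inp_def by simp
  finally show ?thesis .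
qed

lemma den_pos: "i < n \<Longrightarrow> 0 < denom w i"
  using numer_denom(2) .

lemma runs_setup:
  assumes "s = initial_state (encode_mwis (G, w))"
  shows "runs B K (setup_code q) s 7 (\<lambda>s'. inp s' \<and> regs s' rN = Suc n \<and> regs s' rq = q \<and>
    regs s' rqq = 2 * q \<and> regs s' rD = 1 \<and> regs s' rP = 1 \<and> regs s' rM = 1 \<and> regs s' rbest = 0 \<and>
    (\<forall>a. a \<noteq> 0 \<longrightarrow> arrays s' a = (\<lambda>_. 0)))"
proof (rule runs_straight)
  have c: "arrays s 0 1 = n"
    using initial_cell[of 0 "encode_mwis (G, w)"] encode_mwis_nth(1,2)[of G w] assms by simp
  have s: "regs s x = 0" "a \<noteq> 0 \<Longrightarrow> arrays s a = (\<lambda>_. 0)" for x a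
    unfolding assms initial_state_def by auto
  have 1: "(1::nat) < 2 ^ B" using n_less by simp
  show "safe B (setup_code q) s"
    using c 1 n_less q_less unfolding setup_code_def by simp
  show "inp (straight (setup_code q) s) \<and> regs (straight (setup_code q) s) rN = Suc n \<and>
    regs (straight (setup_code q) s) rq = q \<and>
    regs (straight (setup_code q) s) rqq = 2 * q \<and> regs (straight (setup_code q) s) rD = 1 \<and>
    regs (straight (setup_code q) s) rP = 1 \<and> regs (straight (setup_code q) s) rM = 1 \<and>
    regs (straight (setup_code q) s) rbest = 0 \<and>
    (\<forall>a. a \<noteq> 0 \<longrightarrow> arrays (straight (setup_code q) s) a = (\<lambda>_. 0))"
    using c s assms unfolding setup_code_def inp_def by simp
qed (simp add: setup_code_def)

lemma common_multiple_partial: "i < n \<Longrightarrow> (\<Prod>j<i. 2 * denom w j) * (2 * denom w i) < 2 ^ B"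
proof -
  assume i: "i < n"
  have "(\<Prod>j<i. 2 * denom w j) * (2 * denom w i) = (\<Prod>j\<in>{..<Suc i}. 2 * denom w j)" by simp
  also have "\<dots> \<le> (\<Prod>j\<in>{..<n}. 2 * denom w j)"
  proof (rule dvd_imp_le)
    show "(\<Prod>j\<in>{..<Suc i}. 2 * denom w j) dvd (\<Prod>j\<in>{..<n}. 2 * denom w j)"
      by (rule prod_dvd_prod_subset) (use i in auto)
    show "0 < (\<Prod>j\<in>{..<n}. 2 * denom w j)" by (rule prod_pos) (use den_pos in auto)
  qed
  also have "\<dots> < 2 ^ B" using common_less unfolding common_multiple_def .
  finally show ?thesis .
qed

lemma runs_denominators:
  assumes "inp s" "regs s rD = 1"
  shows "runs B K denominators_code s (n * (1 + 2) + 2) (\<lambda>s'. regs s' rD = common_multiple (denom w) n)"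
  unfolding denominators_code_def common_multiple_def
proof (rule runs_For[where Inv = "\<lambda>i s'. regs s' rD = (\<Prod>j<i. 2 * denom w j)"])
  fix i s'
  assume i: "i < n" and so: "same_off (insert ri (wregs (Assign rD (Reg rD \<otimes> (Const 2 \<otimes> den_expr ri)))))
      (warrs (Assign rD (Reg rD \<otimes> (Const 2 \<otimes> den_expr ri)))) s s'"
    and ri: "regs s' ri = i" and inv: "regs s' rD = (\<Prod>j<i. 2 * denom w j)"
  have "inp s'" by (rule inp_cong[OF assms(1)]) (use same_offD[OF so] in simp_all)
  then have d: "eval_expr (den_expr ri) s' = denom w i" using den_expr_eval[of s' ri] ri i by simp
  show "runs B K (Assign rD (Reg rD \<otimes> (Const 2 \<otimes> den_expr ri))) s' 1
     (\<lambda>s''. regs (s''\<lparr>regs := (regs s'')(ri := Suc i)\<rparr>) rD = (\<Prod>j<Suc i. 2 * denom w j))"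
    by (rule runs_straight) (use common_multiple_partial[OF i] inv d in simp_all)
qed (use assms in \<open>simp_all add: inp_def\<close>)

lemma runs_weights:
  assumes "inp s" "regs s rD = common_multiple (denom w) n" "regs s rP = 1" "arrays s aW = (\<lambda>_. 0)"
  shows "runs B K weights_code s (n * (3 + 2) + 2) (\<lambda>s'. arrays s' aW = W)"
proof -
  let ?Inv = "\<lambda>i s'. regs s' rP = 2 ^ i \<and>
    arrays s' aW = (\<lambda>v. if 1 \<le> v \<and> v \<le> i then code_weight (numer w) (denom w) n (v - 1) else 0)"
  let ?c = "Store aW (Reg ri \<oplus> Const 1) (num_expr ri \<otimes> (Reg rD \<oslash> den_expr ri) \<oplus> Reg rP) ;;
      Assign rP (Reg rP \<otimes> Const 2)"
  have "runs B K weights_code s (n * (3 + 2) + 2) (?Inv n)"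
    unfolding weights_code_def
  proof (rule runs_For[where Inv = ?Inv])
    fix i s'
    assume i: "i < n" and so: "same_off (insert ri (wregs ?c)) (warrs ?c) s s'"
      and ri: "regs s' ri = i" and inv: "?Inv i s'"
    have "inp s'" by (rule inp_cong[OF assms(1)]) (use same_offD[OF so] in simp_all)
    then have d: "eval_expr (den_expr ri) s' = denom w i" "eval_expr (num_expr ri) s' = numer w i"
      using den_expr_eval[of s' ri] num_expr_eval[of s' ri] ri i by simp_all
    have D: "regs s' rD = common_multiple (denom w) n" using same_offD(1)[OF so, of rD] assms(2) by simp
    have cw: "numer w i * (common_multiple (denom w) n div denom w i) + 2 ^ i = code_weight (numer w) (denom w) n i"
      unfolding code_weight_def ..
    have "code_weight (numer w) (denom w) n i \<le> m * 1" using weight_le[OF i] by simp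
    also have "\<dots> \<le> m * (n + q)" using q by (intro mult_le_mono2) simp
    also have "\<dots> < 2 ^ B" using m_less by (simp add: mult.commute)
    finally have b1: "code_weight (numer w) (denom w) n i < 2 ^ B" .
    have "(2::nat) ^ Suc i \<le> 2 ^ n" using i by (intro power_increasing) simp_all
    then have b2: "(2::nat) ^ i * 2 < 2 ^ B" using order_le_less_trans[OF _ pow2_less] by simp
    show "runs B K ?c s' 3 (\<lambda>s''. ?Inv (Suc i) (s''\<lparr>regs := (regs s'')(ri := Suc i)\<rparr>))"
      by (rule runs_straight) (use inv d D ri b1 b2 in \<open>auto simp: cw fun_eq_iff\<close>)
  qed (use assms in \<open>auto simp: inp_def\<close>)
  then show ?thesis by (rule runs_mono) (auto simp: W_def fun_eq_iff)
qed

lemma runs_layer_test: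
  assumes "inp s" "regs s rN = Suc n" "regs s rj \<le> n" "regs s rflag = 0"
  shows "runs B K layer_test_code s (Suc n * (3 + 2) + 2) (\<lambda>s'. regs s' rflag \<noteq> 0 \<longleftrightarrow>
    (\<exists>u\<le>n. edge G u (regs s rj) \<and> arrays s alay u \<noteq> 0 \<and> arrays s alay u \<le> regs s ri))"
proof -
  let ?P = "\<lambda>u. edge G u (regs s rj) \<and> arrays s alay u \<noteq> 0 \<and> arrays s alay u \<le> regs s ri"
  let ?Inv = "\<lambda>k s'. regs s' rflag \<noteq> 0 \<longleftrightarrow> (\<exists>u<k. ?P u)"
  let ?e = "Reg ru \<otimes> Reg rj \<otimes> adj_expr ru rj \<otimes> Cell alay (Reg ru) \<otimes>
        (Reg ri \<oplus> Const 1 \<ominus> Cell alay (Reg ru))"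
  let ?c = "Cond ?e (Assign rflag (Const 1)) Skip"
  have "runs B K layer_test_code s (Suc n * (3 + 2) + 2) (?Inv (Suc n))"
    unfolding layer_test_code_def
  proof (rule runs_For[where Inv = ?Inv])
    fix k s'
    assume k: "k < Suc n" and so: "same_off (insert ru (wregs ?c)) (warrs ?c) s s'"
      and ru: "regs s' ru = k" and inv: "?Inv k s'"
    have same: "arrays s' = arrays s" "regs s' rj = regs s rj" "regs s' ri = regs s ri"
      using same_offD[OF so] by auto
    have i': "inp s'" by (rule inp_cong[OF assms(1)]) (use same_offD[OF so] in simp_all)
    have e: "eval_expr ?e s' \<noteq> 0 \<longleftrightarrow> ?P k"
    proof (cases "k = 0 \<or> regs s rj = 0")
      case True then show ?thesis using same ru by (auto simp: edge_def)
    next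
      case False
      then have "eval_expr (adj_expr ru rj) s' = (if edge G k (regs s rj) then 1 else 0)"
        using adj_expr_eval[OF i', of ru rj] same ru k assms(3) by simp
      then show ?thesis using False same ru by auto
    qed
    have B1: "(1::nat) < 2 ^ B" using n_less by simp
    show "runs B K ?c s' 3 (\<lambda>s''. ?Inv (Suc k) (s''\<lparr>regs := (regs s'')(ru := Suc k)\<rparr>))"
    proof (rule runs_straight)
      show "safe B ?c s'" using B1 by (simp del: eval_expr.simps(4))
      show "?Inv (Suc k) ((straight ?c s')\<lparr>regs := (regs (straight ?c s'))(ru := Suc k)\<rparr>)"
        using inv e by (auto simp del: eval_expr.simps(4) simp: less_Suc_eq)
    qed simp
  qed (use assms in auto)
  then show ?thesis by (rule runs_mono) (auto simp: less_Suc_eq_le)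
qed

abbreviation layer_of :: "state \<Rightarrow> nat \<Rightarrow> nat" where
  "layer_of s v \<equiv> arrays s alay (Suc v)"

lemma vertex_iff: "v \<in> verts G \<longleftrightarrow> v < n"
  using verts by (metis atLeastLessThan_iff zero_le)

text \<open>The layers change during the pass over the vertices, but the test ignores the new
  layer \<open>i + 1\<close>, so that it always decides membership in the frontier of the old layering.\<close>
lemma runs_layer_pass:
  fixes s :: state
  defines "l \<equiv> layer_of s" and "i \<equiv> regs s ri"
  assumes s: "inp s" "regs s rN = Suc n" "regs s rany = 0" "regs s rr = 0" and i: "i < n"
    and l: "partial_layering G q i l"
  shows "runs B K (For rj rN layer_vertex_code) s (Suc n * ((5 * n + 16) + 2) + 2)
    (\<lambda>s'. (\<forall>v<n. layer_of s' v = (if v \<in> frontier G l then Suc i else l v)) \<and>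
      (regs s' rany \<noteq> 0 \<longleftrightarrow> frontier G l \<noteq> {}) \<and>
      (regs s' rr = 0 \<and> (\<forall>v<n. l v \<noteq> 0) \<or> (\<exists>v<n. regs s' rr = Suc v \<and> l v = 0)))"
proof -
  have li: "l v \<le> i" if "v < n" for v
    using l[unfolded partial_layering_def, THEN conjunct1] that vertex_iff by blast
  have fr: "v \<in> frontier G l \<longleftrightarrow> l v = 0 \<and> (\<exists>u. edge G u (Suc v) \<and> l (u - 1) \<noteq> 0)" for v
  proof
    assume "v \<in> frontier G l"
    then obtain u where "l v = 0" "{u, v} \<in> edges G" "l u \<noteq> 0" unfolding frontier_def by blast
    then show "l v = 0 \<and> (\<exists>u. edge G u (Suc v) \<and> l (u - 1) \<noteq> 0)"
      by (intro conjI exI[of _ "Suc u"]) (simp_all add: edge_def)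
  next
    assume "l v = 0 \<and> (\<exists>u. edge G u (Suc v) \<and> l (u - 1) \<noteq> 0)"
    then obtain u where u: "l v = 0" "edge G u (Suc v)" "l (u - 1) \<noteq> 0" by blast
    then show "v \<in> frontier G l"
      using edge_range[OF u(2)] vertex_iff[of v] unfolding frontier_def edge_def by auto
  qed
  have fn: "v \<in> frontier G l \<Longrightarrow> v < n" for v using vertex_iff unfolding frontier_def by blast
  let ?Inv = "\<lambda>j s'.
    (\<forall>v<n. layer_of s' v = (if Suc v < j \<and> v \<in> frontier G l then Suc i else l v)) \<and>
    (regs s' rany \<noteq> 0 \<longleftrightarrow> (\<exists>v. Suc v < j \<and> v \<in> frontier G l)) \<and>
    (regs s' rr = 0 \<and> (\<forall>v<n. Suc v < j \<longrightarrow> l v \<noteq> 0) \<or> (\<exists>v<n. regs s' rr = Suc v \<and> l v = 0))"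
  have "runs B K (For rj rN layer_vertex_code) s (Suc n * ((5 * n + 16) + 2) + 2) (?Inv (Suc n))"
  proof (rule runs_For[where Inv = ?Inv])
    fix j s'
    assume j: "j < Suc n" and so: "same_off (insert rj (wregs layer_vertex_code)) (warrs layer_vertex_code) s s'"
      and rj: "regs s' rj = j" and inv: "?Inv j s'"
    have so': "regs s' x = regs s x" if "x \<notin> {rj, rr, rflag, ru, rany}" for x
      using same_offD(1)[OF so, of x] that by (simp add: layer_vertex_code_def layer_test_code_def)
    have i': "inp s'"
      by (rule inp_cong[OF s(1)]) (use same_offD(2)[OF so, of 0] so' in \<open>simp_all add: layer_vertex_code_def layer_test_code_def\<close>)
    have ri: "regs s' ri = i" using so' unfolding i_def by simp
    have B1: "(1::nat) < 2 ^ B" "j < 2 ^ B" "Suc i < 2 ^ B" using n_less j i by linarith+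
    let ?post = "\<lambda>s''. ?Inv (Suc j) (s''\<lparr>regs := (regs s'')(rj := Suc j)\<rparr>)"
    have cell: "arrays s' alay j = l (j - 1)" if "j \<noteq> 0"
      using inv that j by (cases j) auto
    have "runs B K layer_vertex_code s' ((2 + ((Suc n * (3 + 2) + 2) + 5)) + 1) ?post"
      unfolding layer_vertex_code_def
    proof (rule runs_Cond)
      assume nz: "eval_expr (Cell alay (Reg rj)) s' \<noteq> 0"
      have "l v \<noteq> 0" if "j = Suc v" for v using nz rj cell that by simp
      then have eq: "Suc v < Suc j \<and> l v = 0 \<longleftrightarrow> Suc v < j \<and> l v = 0" for v
        by (auto simp: less_Suc_eq)
      then have eq2: "Suc v < Suc j \<and> v \<in> frontier G l \<longleftrightarrow> Suc v < j \<and> v \<in> frontier G l" for v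
        unfolding fr by blast
      have imp: "(Suc v < Suc j \<longrightarrow> l v \<noteq> 0) \<longleftrightarrow> (Suc v < j \<longrightarrow> l v \<noteq> 0)" for v
        using eq[of v] by argo
      have "?Inv (Suc j) s'" unfolding eq2 imp by (rule inv)
      then show "runs B K Skip s' (2 + ((Suc n * (3 + 2) + 2) + 5)) ?post"
        by (intro runs_straight) simp_all
    next
      assume z: "eval_expr (Cell alay (Reg rj)) s' = 0"
      let ?s1 = "s'\<lparr>regs := (regs s')(rr := j, rflag := 0)\<rparr>"
      let ?set = "Cond (Reg rflag) (Store alay (Reg rj) (Reg ri \<oplus> Const 1) ;; Assign rany (Const 1)) Skip"
      have lz: "l v = 0" if "j = Suc v" for v using z rj cell that by simp
      have a1: "runs B K (Assign rr (Reg rj) ;; Assign rflag (Const 0)) s' 2 (\<lambda>s''. s'' = ?s1)"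
        by (rule runs_straight) (use B1 rj in simp_all)
      have a2: "runs B K layer_test_code ?s1 (Suc n * (3 + 2) + 2) (\<lambda>s'. regs s' rflag \<noteq> 0 \<longleftrightarrow>
          (\<exists>u\<le>n. edge G u (regs ?s1 rj) \<and> arrays ?s1 alay u \<noteq> 0 \<and> arrays ?s1 alay u \<le> regs ?s1 ri))"
        by (rule runs_layer_test) (use i' s so' rj j in \<open>simp_all add: inp_def\<close>)
      have flag: "(\<exists>u\<le>n. edge G u j \<and> arrays s' alay u \<noteq> 0 \<and> arrays s' alay u \<le> i) \<longleftrightarrow>
          j \<noteq> 0 \<and> j - 1 \<in> frontier G l" (is "?L \<longleftrightarrow> ?R")
      proof -
        have cells: "arrays s' alay u \<noteq> 0 \<and> arrays s' alay u \<le> i \<longleftrightarrow> l (u - 1) \<noteq> 0"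
          if e: "edge G u j" for u
        proof -
          have u: "u \<in> {1..n}" using edge_range[OF e] by blast
          then obtain v where v: "u = Suc v" "v < n" by (cases u) auto
          show ?thesis
            using inv[THEN conjunct1, rule_format, OF v(2)] li[OF v(2)] fr[of v] unfolding v(1) by auto
        qed
        have "?L \<longleftrightarrow> (\<exists>u. edge G u j \<and> l (u - 1) \<noteq> 0)"
          using cells edge_range by (metis atLeastAtMost_iff)
        also have "\<dots> \<longleftrightarrow> ?R"
        proof (cases j)
          case 0 then show ?thesis by (simp add: edge_def)
        next
          case (Suc v) then show ?thesis using lz[OF Suc] fr[of v] by simp
        qed
        finally show ?thesis .
      qed
      have rrj: "j = 0 \<or> (\<exists>v<n. j = Suc v \<and> l v = 0)"
        using lz j by (cases j) auto
      show "runs B K ((Assign rr (Reg rj) ;; Assign rflag (Const 0)) ;; layer_test_code ;; ?set) s'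
          (2 + ((Suc n * (3 + 2) + 2) + 5)) ?post"
      proof (rule runs_Seq[OF a1], simp only:, rule runs_Seq[OF a2])
        fix s2
        assume so2: "same_off (wregs layer_test_code) (warrs layer_test_code) ?s1 s2"
          and fl: "regs s2 rflag \<noteq> 0 \<longleftrightarrow>
            (\<exists>u\<le>n. edge G u (regs ?s1 rj) \<and> arrays ?s1 alay u \<noteq> 0 \<and> arrays ?s1 alay u \<le> regs ?s1 ri)"
        have s2: "arrays s2 = arrays s'" "regs s2 rj = j" "regs s2 ri = i" "regs s2 rr = j"
            "regs s2 rany = regs s' rany"
          using same_offD[OF so2] rj ri by (auto simp: layer_test_code_def)
        have fl: "regs s2 rflag \<noteq> 0 \<longleftrightarrow> j \<noteq> 0 \<and> j - 1 \<in> frontier G l"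
          using fl flag rj ri by simp
        have rr: "j = 0 \<and> (\<forall>v<n. Suc v < Suc j \<longrightarrow> l v \<noteq> 0) \<or> (\<exists>v<n. j = Suc v \<and> l v = 0)"
          using rrj by auto
        show "runs B K ?set s2 5 ?post"
        proof (rule runs_straight)
          show "safe B ?set s2" using B1 s2 by simp
          show "?post (straight ?set s2)"
          proof (cases "regs s2 rflag = 0")
            case True
            then have eq2: "Suc v < Suc j \<and> v \<in> frontier G l \<longleftrightarrow> Suc v < j \<and> v \<in> frontier G l" for v
              using fl by (auto simp: less_Suc_eq)
            show ?thesis using True s2 inv rr unfolding eq2 by simp
          next
            case False
            then obtain v where v: "j = Suc v" "v \<in> frontier G l" using fl by (cases j) auto
            have "layer_of (straight ?set s2) u = (if Suc u < Suc j \<and> u \<in> frontier G l then Suc i else l u)"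
              if "u < n" for u
              using inv[THEN conjunct1, rule_format, OF that] False s2 v by (auto simp: less_Suc_eq)
            then show ?thesis using False s2 v rr by auto
          qed
        qed simp
      qed
    qed
    then show "runs B K layer_vertex_code s' (5 * n + 16) ?post" by (rule runs_mono) auto
  qed (use s in \<open>auto simp: layer_vertex_code_def layer_test_code_def l_def\<close>)
  moreover have "Suc v < Suc n \<and> v \<in> frontier G l \<longleftrightarrow> v \<in> frontier G l" for v using fn by auto
  then have "?Inv (Suc n) s' \<longleftrightarrow>
      (\<forall>v<n. layer_of s' v = (if v \<in> frontier G l then Suc i else l v)) \<and>
      (regs s' rany \<noteq> 0 \<longleftrightarrow> frontier G l \<noteq> {}) \<and>
      (regs s' rr = 0 \<and> (\<forall>v<n. l v \<noteq> 0) \<or> (\<exists>v<n. regs s' rr = Suc v \<and> l v = 0))" for s'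
    by auto
  ultimately show ?thesis by simp
qed

text \<open>If all vertices have been reached, the seed is the dummy vertex, whose layer
  has no influence on the result.\<close>
lemma runs_layer:
  assumes s: "inp s" "regs s rN = Suc n" "arrays s alay = (\<lambda>_. 0)"
  shows "runs B K layer_code s (n * ((2 + ((Suc n * ((5 * n + 16) + 2) + 2) + 4)) + 2) + 2)
    (\<lambda>s'. partial_layering G q n (layer_of s'))"
  unfolding layer_code_def
proof (rule runs_For[where Inv = "\<lambda>i s'. partial_layering G q i (layer_of s')"])
  let ?seed = "Cond (Reg rany) Skip (Store alay (Reg rr) (Reg ri \<oplus> Const 1))"
  let ?c = "(Assign rany (Const 0) ;; Assign rr (Const 0)) ;; For rj rN layer_vertex_code ;; ?seed"
  fix i s'
  assume i: "i < n" and so: "same_off (insert ri (wregs ?c)) (warrs ?c) s s'"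
    and ri: "regs s' ri = i" and inv: "partial_layering G q i (layer_of s')"
  have i': "inp s'"
    by (rule inp_cong[OF s(1)]) (use same_offD(2)[OF so, of 0] same_offD(1)[OF so, of rn] in
      \<open>simp_all add: layer_vertex_code_def layer_test_code_def\<close>)
  have rN: "regs s' rN = Suc n"
    using same_offD(1)[OF so, of rN] s(2) by (simp add: layer_vertex_code_def layer_test_code_def)
  let ?s1 = "s'\<lparr>regs := (regs s')(rany := 0, rr := 0)\<rparr>"
  have a1: "runs B K (Assign rany (Const 0) ;; Assign rr (Const 0)) s' 2 (\<lambda>s''. s'' = ?s1)"
    by (rule runs_straight) simp_all
  have a2: "runs B K (For rj rN layer_vertex_code) ?s1 (Suc n * ((5 * n + 16) + 2) + 2)
    (\<lambda>s'. (\<forall>v<n. layer_of s' v = (if v \<in> frontier G (layer_of ?s1) then Suc (regs ?s1 ri) else layer_of ?s1 v)) \<and>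
      (regs s' rany \<noteq> 0 \<longleftrightarrow> frontier G (layer_of ?s1) \<noteq> {}) \<and>
      (regs s' rr = 0 \<and> (\<forall>v<n. layer_of ?s1 v \<noteq> 0) \<or> (\<exists>v<n. regs s' rr = Suc v \<and> layer_of ?s1 v = 0)))"
    by (rule runs_layer_pass) (use i' i ri rN inv in \<open>simp_all add: inp_def\<close>)
  show "runs B K ?c s' (2 + ((Suc n * ((5 * n + 16) + 2) + 2) + 4))
    (\<lambda>s''. partial_layering G q (Suc i) (layer_of (s''\<lparr>regs := (regs s'')(ri := Suc i)\<rparr>)))"
  proof (rule runs_Seq[OF a1], simp only:, rule runs_Seq[OF a2])
    fix s2
    let ?l = "layer_of s'"
    assume so2: "same_off (wregs (For rj rN layer_vertex_code)) (warrs (For rj rN layer_vertex_code)) ?s1 s2"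
      and "(\<forall>v<n. layer_of s2 v = (if v \<in> frontier G (layer_of ?s1) then Suc (regs ?s1 ri) else layer_of ?s1 v)) \<and>
      (regs s2 rany \<noteq> 0 \<longleftrightarrow> frontier G (layer_of ?s1) \<noteq> {}) \<and>
      (regs s2 rr = 0 \<and> (\<forall>v<n. layer_of ?s1 v \<noteq> 0) \<or> (\<exists>v<n. regs s2 rr = Suc v \<and> layer_of ?s1 v = 0))"
    then have lay2: "\<And>v. v < n \<Longrightarrow> layer_of s2 v = (if v \<in> frontier G ?l then Suc i else ?l v)"
      and any2: "regs s2 rany \<noteq> 0 \<longleftrightarrow> frontier G ?l \<noteq> {}"
      and rr2: "regs s2 rr = 0 \<and> (\<forall>v<n. ?l v \<noteq> 0) \<or> (\<exists>v<n. regs s2 rr = Suc v \<and> ?l v = 0)"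
      using ri by auto
    have ri2: "regs s2 ri = i"
      using same_offD(1)[OF so2, of ri] ri by (simp add: layer_vertex_code_def layer_test_code_def)
    \<comment> \<open>in a round without new neighbours, a seed register \<open>0\<close> means that no vertex is left\<close>
    define S where "S = (if regs s2 rany \<noteq> 0 then frontier G ?l else {v. v < n \<and> regs s2 rr = Suc v})"
    have "partial_layering G q (Suc i) (layer_of (straight ?seed s2))"
    proof (rule partial_layering_Suc[OF G free q inv, where S = S])
      fix v assume "v \<in> verts G"
      then show "layer_of (straight ?seed s2) v = (if v \<in> S then Suc i else ?l v)"
        using lay2[of v] any2 ri2 vertex_iff unfolding S_def by auto
    next
      have "card {v. v < n \<and> regs s2 rr = Suc v} \<le> card {regs s2 rr - 1}"
        by (rule card_mono) auto
      then show "frontier G ?l \<noteq> {} \<and> S = frontier G ?l \<or>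
        frontier G ?l = {} \<and> S \<subseteq> {v \<in> verts G. ?l v = 0} \<and> card S \<le> 1 \<and>
          (S = {} \<longrightarrow> (\<forall>v\<in>verts G. ?l v \<noteq> 0))"
        using any2 rr2 vertex_iff unfolding S_def by auto
    qed
    then show "runs B K ?seed s2 4
      (\<lambda>s''. partial_layering G q (Suc i) (layer_of (s''\<lparr>regs := (regs s'')(ri := Suc i)\<rparr>)))"
      by (intro runs_straight) (use n_less i ri2 in auto)
  qed
qed (use s in \<open>auto intro!: partial_layering_0[OF G] simp: inp_def layer_vertex_code_def layer_test_code_def\<close>)

end

lemma div_power_Suc: "(x::nat) div b ^ k div b = x div b ^ Suc k"
  by (simp only: power_Suc2 div_mult2_eq)

lemma eMod_Suc_simp [simp]: "(x::nat) - (x div Suc k + k * (x div Suc k)) = x mod Suc k"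
  using eMod_simp[of x "Suc k"] by simp

context instance_run
begin

lemma inp_same_off:
  "inp s \<Longrightarrow> same_off R A s s' \<Longrightarrow> 0 \<notin> A \<Longrightarrow> rn \<notin> R \<Longrightarrow> inp s'"
  unfolding inp_def same_off_def by simp

lemma runs_digit_test:
  assumes s: "inp s" "regs s rN = Suc n" "regs s rqq = 2 * q" "regs s ru \<le> n"
  defines "conf u v \<equiv> u \<noteq> 0 \<and> v \<noteq> 0 \<and> (u = v \<or> edge G u v)"
  shows "runs B K digit_test_code s (2 * q * (5 + 2) + 2) (\<lambda>s'.
    regs s' rbad = 0 \<longleftrightarrow> regs s rbad = 0 \<and>
      (\<forall>b<2 * q. \<not> conf (regs s ru) (digit (Suc n) (regs s ry) b)))"
proof -
  let ?N = "Suc n"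
  let ?y = "regs s ry"
  let ?Inv = "\<lambda>b s'. regs s' ry = ?y div ?N ^ b \<and>
    (regs s' rbad = 0 \<longleftrightarrow> regs s rbad = 0 \<and> (\<forall>c<b. \<not> conf (regs s ru) (digit ?N ?y c)))"
  let ?t = "Cond (conflict_expr ru rv) (Assign rbad (Const 1)) Skip"
  let ?c = "Assign rv (eMod (Reg ry) (Reg rN)) ;; Assign ry (Reg ry \<oslash> Reg rN) ;; ?t"
  have "runs B K digit_test_code s (2 * q * (5 + 2) + 2) (?Inv (2 * q))"
    unfolding digit_test_code_def
  proof (rule runs_For[where Inv = ?Inv])
    fix b s'
    assume b: "b < 2 * q" and so: "same_off (insert rb (wregs ?c)) (warrs ?c) s s'"
      and rb: "regs s' rb = b" and inv: "?Inv b s'"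
    have i': "inp s'" by (rule inp_same_off[OF s(1) so]) auto
    have same: "regs s' rN = ?N" "regs s' ru = regs s ru" using same_offD(1)[OF so] s by auto
    \<comment> \<open>the state after the digit has been split off\<close>
    let ?s2 = "s'\<lparr>regs := (regs s')(rv := regs s' ry mod ?N, ry := regs s' ry div ?N)\<rparr>"
    have y: "regs s' ry mod ?N = digit ?N ?y b" "regs s' ry div ?N = ?y div ?N ^ Suc b"
      using inv div_power_Suc[of ?y ?N b] by (simp_all add: digit_def del: power_Suc)
    have i2: "inp ?s2" using i' by (simp add: inp_def)
    have e: "eval_expr (conflict_expr ru rv) ?s2 \<noteq> 0 \<longleftrightarrow> conf (regs s ru) (digit ?N ?y b)"
      using conflict_expr_eval[OF i2, of ru rv] same s(4) y(1) digit_less[of ?N ?y b]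
      unfolding conf_def by simp
    have st: "straight ?c s' = straight ?t ?s2" using same by simp
    show "runs B K ?c s' 5 (\<lambda>s''. ?Inv (Suc b) (s''\<lparr>regs := (regs s'')(rb := Suc b)\<rparr>))"
    proof (rule runs_straight)
      assume bd: "bounded B s'"
      then have yb: "regs s' ry < 2 ^ B" unfolding bounded_def by blast
      have "regs s' ry mod ?N < 2 ^ B" "regs s' ry div ?N < 2 ^ B"
        using yb order_le_less_trans[OF mod_less_eq_dividend yb] order_le_less_trans[OF div_le_dividend yb]
        by auto
      then show "safe B ?c s'" using same n_less by simp
      show "?Inv (Suc b) ((straight ?c s')\<lparr>regs := (regs (straight ?c s'))(rb := Suc b)\<rparr>)"
        unfolding st using e inv y(2) by (auto simp: less_Suc_eq)
    qed simp
  qed (use s in auto)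
  then show ?thesis by (rule runs_mono) auto
qed

lemma W_le: "W v \<le> m"
proof (cases "1 \<le> v \<and> v \<le> n")
  case True
  then have "v - 1 < n" by linarith
  then show ?thesis using weight_le True unfolding W_def by simp
qed (simp only: W_def if_False)

context
  fixes L :: "nat \<Rightarrow> nat"
  assumes layered: "layered n q (edge G) L W"
begin

interpretation dp: layered n q "edge G" L W by (rule layered)

text \<open>The digits are split off one after the other, so that after removing digit \<open>a\<close> the remaining
  quotient consists of exactly the later digits to compare it with.\<close>
lemma runs_digits:
  assumes s: "inp s" "regs s rN = Suc n" "regs s rq = q" "regs s rqq = 2 * q" "arrays s aW = W"
      "\<forall>v\<in>{1..n}. arrays s alay v = L v"
    and t: "regs s rx = t" "regs s rbad = 0" "regs s rwt = 0" and i: "regs s ri = i" "i < n"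
  shows "runs B K (For ra rq digit_code) s (q * ((8 + (2 * q * (5 + 2) + 2)) + 2) + 2) (\<lambda>s'.
    regs s' rwt = dp.wt t \<and> (regs s' rbad = 0 \<longleftrightarrow> dp.ok i t))"
proof -
  let ?N = "Suc n"
  let ?good = "\<lambda>a. (dp.dig t a = 0 \<or> L (dp.dig t a) = Suc i) \<and>
    (\<forall>b<2 * q. \<not> dp.conflict (dp.dig t a) (dp.dig t (Suc a + b)))"
  let ?Inv = "\<lambda>a s'. regs s' rx = t div ?N ^ a \<and> regs s' rwt = (\<Sum>c<a. W (dp.dig t c)) \<and>
    (regs s' rbad = 0 \<longleftrightarrow> (\<forall>c<a. ?good c))"
  let ?h = "Assign ru (eMod (Reg rx) (Reg rN)) ;; Assign rx (Reg rx \<oslash> Reg rN) ;;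
      Assign rwt (Reg rwt \<oplus> Cell aW (Reg ru)) ;;
      Cond (off_layer_expr ru) (Assign rbad (Const 1)) Skip ;;
      Assign ry (Reg rx)"
  have "runs B K (For ra rq digit_code) s (q * ((8 + (2 * q * (5 + 2) + 2)) + 2) + 2) (?Inv q)"
  proof (rule runs_For[where Inv = ?Inv])
    fix a s'
    assume a: "a < q" and so: "same_off (insert ra (wregs digit_code)) (warrs digit_code) s s'"
      and ra: "regs s' ra = a" and inv: "?Inv a s'"
    have same: "arrays s' = arrays s" "regs s' rN = ?N" "regs s' rqq = 2 * q" "regs s' ri = i"
      using same_offD[OF so] s i by (auto simp: digit_code_def digit_test_code_def)
    have i': "inp s'"
      by (rule inp_same_off[OF s(1) so]) (auto simp: digit_code_def digit_test_code_def)
    let ?u = "dp.dig t a"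
    have u: "regs s' rx mod ?N = ?u" "regs s' rx div ?N = t div ?N ^ Suc a"
      using inv div_power_Suc[of t ?N a] by (simp_all add: digit_def del: power_Suc)
    have un: "?u \<le> n" using digit_less[of ?N t a] by simp
    have dg: "dp.dig (t div ?N ^ Suc a) b = dp.dig t (Suc a + b)" for b
      using digit_div[of ?N t "Suc a" b] .
    let ?post = "\<lambda>s''. ?Inv (Suc a) (s''\<lparr>regs := (regs s'')(ra := Suc a)\<rparr>)"
    define g where "g = (\<forall>c<a. ?good c)"
    have inv': "regs s' rx = t div ?N ^ a" "regs s' rwt = (\<Sum>c<a. W (dp.dig t c))" "regs s' rbad = 0 \<longleftrightarrow> g"
      using inv unfolding g_def by blast+
    let ?Q = "\<lambda>s2. regs s2 ru = ?u \<and> regs s2 rx = t div ?N ^ Suc a \<and> regs s2 ry = t div ?N ^ Suc a \<and>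
      regs s2 rwt = (\<Sum>c<Suc a. W (dp.dig t c)) \<and>
      (regs s2 rbad = 0 \<longleftrightarrow> g \<and> (?u = 0 \<or> L ?u = Suc i))"
    have head: "runs B K ?h s' 8 ?Q"
    proof (rule runs_straight)
      assume bd: "bounded B s'"
      then have xb: "regs s' rx < 2 ^ B" unfolding bounded_def by blast
      have x: "regs s' rx mod ?N < 2 ^ B" "regs s' rx div ?N < 2 ^ B"
        using xb order_le_less_trans[OF mod_less_eq_dividend xb] order_le_less_trans[OF div_le_dividend xb]
        by auto
      have "(\<Sum>c<Suc a. W (dp.dig t c)) \<le> Suc a * m" by (rule dp.wt_partial_le[OF W_le])
      also have "\<dots> \<le> (n + q) * m" using a by (intro mult_le_mono1) simp
      also have "\<dots> < 2 ^ B" by (rule m_less)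
      finally have wb: "(\<Sum>c<a. W (dp.dig t c)) + W ?u < 2 ^ B" by simp
      show "safe B ?h s'" using x wb same inv'(2) u(1) s(5) n_less by simp
      have lay: "?u = 0 \<or> arrays s alay ?u = Suc i \<longleftrightarrow> ?u = 0 \<or> L ?u = Suc i"
        using s(6) un by (cases "?u = 0") auto
      show "?Q (straight ?h s')"
        using same inv' u(1) u(2)[symmetric] s(5) lay by (simp add: off_layer_expr_eval del: power_Suc)
    qed simp
    have "runs B K digit_code s' (8 + (2 * q * (5 + 2) + 2)) ?post"
      unfolding digit_code_def
    proof (rule runs_Seq[OF head])
      fix s2 assume so2: "same_off (wregs ?h) (warrs ?h) s' s2" and Q: "?Q s2"
      have i2: "inp s2" by (rule inp_same_off[OF i' so2]) auto
      have same2: "regs s2 rN = ?N" "regs s2 rqq = 2 * q" using same_offD(1)[OF so2] same by auto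
      show "runs B K digit_test_code s2 (2 * q * (5 + 2) + 2) ?post"
      proof (rule runs_mono[OF runs_digit_test[OF i2 same2]])
        show "regs s2 ru \<le> n" using Q un by simp
        fix s3
        assume so3: "same_off (wregs digit_test_code) (warrs digit_test_code) s2 s3"
          and bad: "regs s3 rbad = 0 \<longleftrightarrow> regs s2 rbad = 0 \<and>
            (\<forall>b<2 * q. \<not> (regs s2 ru \<noteq> 0 \<and> digit ?N (regs s2 ry) b \<noteq> 0 \<and>
              (regs s2 ru = digit ?N (regs s2 ry) b \<or> edge G (regs s2 ru) (digit ?N (regs s2 ry) b))))"
        have r: "regs s3 rx = regs s2 rx" "regs s3 rwt = regs s2 rwt"
          using same_offD(1)[OF so3] by (auto simp: digit_test_code_def)
        have "regs s2 ru = ?u" "regs s2 ry = t div ?N ^ Suc a" using Q by auto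
        then have "regs s3 rbad = 0 \<longleftrightarrow> regs s2 rbad = 0 \<and>
            (\<forall>b<2 * q. \<not> dp.conflict ?u (dp.dig t (Suc a + b)))"
          using bad unfolding dp.conflict_def dg[symmetric] by simp
        also have "\<dots> \<longleftrightarrow> (\<forall>c<Suc a. ?good c)" using Q unfolding g_def by (auto simp only: less_Suc_eq)
        finally show "?post s3" using Q r by simp
      qed simp
    qed
    then show "runs B K digit_code s' (8 + (2 * q * (5 + 2) + 2)) ?post" .
  qed (use s t in \<open>auto simp: digit_code_def digit_test_code_def\<close>)
  then show ?thesis by (rule runs_mono) (auto simp: dp.wt_def dp.ok_def)
qed

lemma runs_commit:
  assumes s: "regs s rM = M" "regs s rt = t" "t < M * M" "regs s ri = i" "i < n"
      "regs s rwt = dp.wt t" "regs s rbad = 0 \<longleftrightarrow> dp.ok i t"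
    and inv: "dp.table_inv i t (arrays s aF) (regs s rbest)"
  shows "runs B K commit_code s 10 (\<lambda>s'. dp.table_inv i (Suc t) (arrays s' aF) (regs s' rbest))"
proof (rule runs_straight)
  let ?A = "arrays s aF"
  let ?c = "?A (i * M + t div M) + dp.wt t"
  let ?x = "Suc i * M + t mod M"
  have "t div M < M" using s(3) by (simp add: less_mult_imp_div_less)
  then obtain J where "dp.indep J" "?A (i * M + t div M) = sum W J"
    using inv s(5) dp.attained_indep unfolding dp.table_inv_def by (metis less_imp_le_nat)
  then have "?A (i * M + t div M) \<le> n * m" using dp.indep_weight_le[OF W_le] by simp
  moreover have "dp.wt t \<le> q * m" using dp.wt_partial_le[OF W_le] unfolding dp.wt_def by simp
  ultimately have "?c \<le> (n + q) * m" by (simp add: add_mult_distrib)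
  then have cb: "?c < 2 ^ B" using m_less by (rule order_le_less_trans)
  show "safe B commit_code s" using s cb unfolding commit_code_def Let_def by simp
  show "dp.table_inv i (Suc t) (arrays (straight commit_code s) aF) (regs (straight commit_code s) rbest)"
  proof (cases "dp.ok i t")
    case False
    then have "straight commit_code s = s" using s unfolding commit_code_def by simp
    then show ?thesis using dp.table_inv_skip[OF inv False] by simp
  next
    case True
    have x: "(i + 1) * M + t mod M = ?x" by simp
    have "arrays (straight commit_code s) aF = ?A(?x := max (?A ?x) ?c)"
      using s True unfolding commit_code_def Let_def by (auto simp: fun_eq_iff max_def)
    moreover have "regs (straight commit_code s) rbest = max (regs s rbest) ?c"
      using s True unfolding commit_code_def Let_def by (auto simp: max_def)
    ultimately show ?thesis using dp.table_inv_step[OF inv s(5,3) True] by simp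
  qed
qed (simp add: commit_code_def Let_def)

lemma runs_table:
  assumes s: "inp s" "regs s rN = Suc n" "regs s rq = q" "regs s rqq = 2 * q" "arrays s aW = W"
      "\<forall>v\<in>{1..n}. arrays s alay v = L v" "regs s rM = M" "regs s rMM = M * M"
      "arrays s aF = (\<lambda>_. 0)" "regs s rbest = 0"
  shows "runs B K table_code s (n * ((M * M * ((3 + ((q * ((8 + (2 * q * (5 + 2) + 2)) + 2) + 2) + 10)) + 2) + 2) + 2) + 2)
    (\<lambda>s'. (\<exists>J. dp.indep J \<and> regs s' rbest = sum W J) \<and>
      (\<forall>J. dp.indep J \<longrightarrow> sum W J \<le> regs s' rbest))"
proof -
  let ?b = "(Assign rbad (Const 0) ;; Assign rwt (Const 0) ;; Assign rx (Reg rt)) ;;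
      For ra rq digit_code ;; commit_code"
  let ?T = "3 + ((q * ((8 + (2 * q * (5 + 2) + 2)) + 2) + 2) + 10)"
  have wr: "wregs (For rt rMM ?b) \<subseteq> {rt, rbad, rwt, rx, ra, ru, ry, rb, rv, rcand, rbest}"
    "warrs (For rt rMM ?b) \<subseteq> {aF}"
    by (auto simp: digit_code_def digit_test_code_def commit_code_def Let_def)
  have "runs B K table_code s (n * ((M * M * (?T + 2) + 2) + 2) + 2)
    (\<lambda>s'. dp.table_inv n 0 (arrays s' aF) (regs s' rbest))"
    unfolding table_code_def
  proof (rule runs_For[where Inv = "\<lambda>i s'. dp.table_inv i 0 (arrays s' aF) (regs s' rbest)"])
    fix i s'
    assume i: "i < n" and so: "same_off (insert ri (wregs (For rt rMM ?b))) (warrs (For rt rMM ?b)) s s'"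
      and ri: "regs s' ri = i" and inv: "dp.table_inv i 0 (arrays s' aF) (regs s' rbest)"
    have sr: "regs s' x = regs s x" if "x \<notin> {ri, rt, rbad, rwt, rx, ra, ru, ry, rb, rv, rcand, rbest}" for x
      by (rule same_offD(1)[OF so]) (use wr(1) that in blast)
    have sa: "arrays s' x = arrays s x" if "x \<noteq> aF" for x
      by (rule same_offD(2)[OF so]) (use wr(2) that in blast)
    let ?Inv = "\<lambda>t s'. dp.table_inv i t (arrays s' aF) (regs s' rbest)"
    have "runs B K (For rt rMM ?b) s' (M * M * (?T + 2) + 2) (?Inv (M * M))"
    proof (rule runs_For[where Inv = ?Inv])
      fix t s1
      assume t: "t < M * M" and so1: "same_off (insert rt (wregs ?b)) (warrs ?b) s' s1"
        and rt: "regs s1 rt = t" and inv1: "?Inv t s1"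
      have sr1: "regs s1 x = regs s' x" if "x \<notin> {rt, rbad, rwt, rx, ra, ru, ry, rb, rv, rcand, rbest}" for x
        by (rule same_offD(1)[OF so1]) (use wr(1) that in auto)
      have sa1: "arrays s1 x = arrays s x" if "x \<noteq> aF" for x
        unfolding sa[OF that, symmetric]
        by (rule same_offD(2)[OF so1]) (use wr(2) that in auto)
      let ?s2 = "s1\<lparr>regs := (regs s1)(rbad := 0, rwt := 0, rx := t)\<rparr>"
      have a1: "runs B K (Assign rbad (Const 0) ;; Assign rwt (Const 0) ;; Assign rx (Reg rt)) s1 3 (\<lambda>s''. s'' = ?s2)"
        by (rule runs_straight) (use rt in \<open>auto simp: bounded_def\<close>)
      have a2: "runs B K (For ra rq digit_code) ?s2 (q * ((8 + (2 * q * (5 + 2) + 2)) + 2) + 2) (\<lambda>s'.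
          regs s' rwt = dp.wt t \<and> (regs s' rbad = 0 \<longleftrightarrow> dp.ok i t))"
        by (rule runs_digits) (use s sr sr1 sa1 ri i in \<open>simp_all add: inp_def\<close>)
      show "runs B K ?b s1 ?T (\<lambda>s''. ?Inv (Suc t) (s''\<lparr>regs := (regs s'')(rt := Suc t)\<rparr>))"
      proof (rule runs_Seq[OF a1], simp only:, rule runs_Seq[OF a2])
        fix s3
        assume so3: "same_off (wregs (For ra rq digit_code)) (warrs (For ra rq digit_code)) ?s2 s3"
          and r: "regs s3 rwt = dp.wt t \<and> (regs s3 rbad = 0 \<longleftrightarrow> dp.ok i t)"
        have r3: "regs s3 rM = M" "regs s3 rt = t" "regs s3 ri = i" "regs s3 rbest = regs s1 rbest"
            "arrays s3 = arrays s1"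
          using same_offD[OF so3] s(7) sr sr1 rt ri by (auto simp: digit_code_def digit_test_code_def)
        show "runs B K commit_code s3 10 (\<lambda>s''. ?Inv (Suc t) (s''\<lparr>regs := (regs s'')(rt := Suc t)\<rparr>))"
          by (rule runs_mono[OF runs_commit[of s3 t i]]) (use r3 r t i inv1 in auto)
      qed
    qed (use s sr inv in \<open>auto simp: digit_code_def digit_test_code_def commit_code_def Let_def\<close>)
    then show "runs B K (For rt rMM ?b) s' (M * M * (?T + 2) + 2)
        (\<lambda>s''. dp.table_inv (Suc i) 0 (arrays (s''\<lparr>regs := (regs s'')(ri := Suc i)\<rparr>) aF)
          (regs (s''\<lparr>regs := (regs s'')(ri := Suc i)\<rparr>) rbest))"
      by (rule runs_mono) (auto intro: dp.table_inv_row)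
  qed (use s dp.table_inv_init in \<open>auto simp: inp_def digit_code_def digit_test_code_def commit_code_def Let_def\<close>)
  then show ?thesis
    by (rule runs_mono) (use dp.table_inv_optimal in \<open>auto simp: dp.table_inv_def\<close>)
qed

end

lemma runs_power:
  assumes s: "regs s rN = Suc n" "regs s rq = q" "regs s rM = 1"
  shows "runs B K power_code s ((q * (1 + 2) + 2) + 1) (\<lambda>s'. regs s' rM = M \<and> regs s' rMM = M * M)"
proof -
  let ?c = "Assign rM (Reg rM \<otimes> Reg rN)"
  have "M * 1 \<le> M * M" by (intro mult_le_mono2) simp
  then have MB: "M < 2 ^ B" using codes_less by linarith
  have "runs B K (For ra rq ?c) s (q * (1 + 2) + 2) (\<lambda>s'. regs s' rM = Suc n ^ q)"
  proof (rule runs_For[where Inv = "\<lambda>a s'. regs s' rM = Suc n ^ a"])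
    fix a s'
    assume a: "a < q" and so: "same_off (insert ra (wregs ?c)) (warrs ?c) s s'"
      and ra: "regs s' ra = a" and inv: "regs s' rM = Suc n ^ a"
    have rN: "regs s' rN = Suc n" using same_offD(1)[OF so, of rN] s by simp
    have "Suc n ^ Suc a \<le> Suc n ^ q" using a by (intro power_increasing) simp_all
    then have "Suc n ^ a * Suc n < 2 ^ B" using order_le_less_trans[OF _ MB] by (simp add: mult.commute)
    then show "runs B K ?c s' 1 (\<lambda>s''. regs (s''\<lparr>regs := (regs s'')(ra := Suc a)\<rparr>) rM = Suc n ^ Suc a)"
      by (intro runs_straight) (use inv rN in \<open>simp_all add: mult.commute\<close>)
  qed (use s in auto)
  then show ?thesis unfolding power_code_def
    by (rule runs_Seq) (intro runs_straight; use codes_less in simp)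
qed

text \<open>The bits of the optimal value are read from the lowest one upwards.\<close>
lemma runs_output:
  assumes s: "regs s rn = n" "arrays s 1 = (\<lambda>_. 0)"
  shows "runs B K output_code s (1 + (n * (7 + 2) + 2)) (\<lambda>s'.
    output_list s' = filter (\<lambda>j. odd (regs s rbest div 2 ^ j)) [0..<n])"
proof -
  let ?best = "regs s rbest"
  let ?ys = "\<lambda>i. filter (\<lambda>j. odd (?best div 2 ^ j)) [0..<i]"
  let ?c = "Cond (eMod (Reg rR) (Const 2))
        (Store 1 (Const 0) (Cell 1 (Const 0) \<oplus> Const 1) ;; Store 1 (Cell 1 (Const 0)) (Reg ri)) Skip ;;
      Assign rR (Reg rR \<oslash> Const 2)"
  let ?Inv = "\<lambda>i s'. regs s' rR = ?best div 2 ^ i \<and> arrays s' 1 0 = length (?ys i) \<and>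
    (\<forall>k<length (?ys i). arrays s' 1 (Suc k) = ?ys i ! k)"
  let ?s1 = "s\<lparr>regs := (regs s)(rR := ?best)\<rparr>"
  have a1: "runs B K (Assign rR (Reg rbest)) s 1 (\<lambda>s''. s'' = ?s1)"
    by (rule runs_straight) (auto simp: bounded_def)
  have "runs B K (For ri rn ?c) ?s1 (n * (7 + 2) + 2) (?Inv n)"
  proof (rule runs_For[where Inv = ?Inv])
    fix i s'
    assume i: "i < n" and so: "same_off (insert ri (wregs ?c)) (warrs ?c) ?s1 s'"
      and ri: "regs s' ri = i" and inv: "?Inv i s'"
    have odd: "regs s' rR mod 2 \<noteq> 0 \<longleftrightarrow> odd (?best div 2 ^ i)"
      using inv by (simp add: odd_iff_mod_2_eq_one)
    have len: "length (?ys i) \<le> i" using length_filter_le[of _ "[0..<i]"] by simp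
    have d: "?best div 2 ^ i div 2 = ?best div 2 ^ Suc i" by (rule div_power_Suc)
    show "runs B K ?c s' 7 (\<lambda>s''. ?Inv (Suc i) (s''\<lparr>regs := (regs s'')(ri := Suc i)\<rparr>))"
    proof (rule runs_straight)
      assume bd: "bounded B s'"
      then have rb: "regs s' rR < 2 ^ B" unfolding bounded_def by blast
      have "regs s' rR div 2 < 2 ^ B" by (rule order_le_less_trans[OF div_le_dividend rb])
      moreover have "Suc (length (?ys i)) < 2 ^ B" "i < 2 ^ B" using len i n_less by linarith+
      ultimately show "safe B ?c s'" using inv ri by simp
      show "?Inv (Suc i) ((straight ?c s')\<lparr>regs := (regs (straight ?c s'))(ri := Suc i)\<rparr>)"
      proof (cases "odd (?best div 2 ^ i)")
        case True
        then have ys: "?ys (Suc i) = ?ys i @ [i]" by simp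
        show ?thesis unfolding ys using True odd inv ri d[symmetric] by (auto simp: nth_append less_Suc_eq simp del: power_Suc)
      next
        case False
        then have ys: "?ys (Suc i) = ?ys i" by simp
        show ?thesis unfolding ys using False odd inv d[symmetric] by (auto simp del: power_Suc)
      qed
    qed simp
  qed (use s in auto)
  then have "runs B K output_code s (1 + (n * (7 + 2) + 2)) (?Inv n)"
    unfolding output_code_def by (intro runs_Seq[OF a1]) simp
  then show ?thesis
  proof (rule runs_mono)
    fix s' :: state assume inv: "?Inv n s'"
    show "output_list s' = ?ys n"
    proof (rule nth_equalityI)
      show "length (output_list s') = length (?ys n)" using inv unfolding output_list_def by (simp del: upt_Suc)
      fix k assume "k < length (output_list s')"
      then have "k < length (?ys n)" using inv unfolding output_list_def by (simp del: upt_Suc)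
      then show "output_list s' ! k = ?ys n ! k" using inv unfolding output_list_def by (simp del: upt_Suc)
    qed
  qed simp
qed

end

text \<open>The running time in units of the price of one expression: the term in \<open>5 * n + 18\<close> belongs to the layering, the one with
  the powers to the table. The other loops contribute to the summands \<open>31\<close> and \<open>21 + 3 * q\<close>.\<close>
definition steps :: "nat \<Rightarrow> nat \<Rightarrow> nat" where
  "steps q n = 21 + 3 * q +
     n * (31 + Suc n * (5 * n + 18) + Suc n ^ q * Suc n ^ q * (q * (14 * q + 12) + 17))"

context instance_run
begin

lemma layering_layered:
  assumes pl: "partial_layering G q n (\<lambda>v. L (Suc v))"
  shows "layered n q (edge G) L W"
proof
  let ?l = "\<lambda>v. L (Suc v)"
  show "W 0 = 0" by (simp add: W_def)
  show range: "L v \<in> {1..n}" if v: "v \<in> {1..n}" for v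
  proof -
    obtain u where u: "v = Suc u" "u \<in> verts G" using v vertex_iff by (cases v) auto
    have "L v \<noteq> 0" using partial_layering_complete[OF G pl u(2)] u(1) by simp
    moreover have "L v \<le> n"
      using pl[unfolded partial_layering_def, THEN conjunct1] u by blast
    ultimately show ?thesis by simp
  qed
  show "edge G v u" if "edge G u v" for u v using edge_sym[OF that] .
  show "\<not> edge G v v" for v using edge_range[of v v] by blast
  show "L u \<le> Suc (L v)" if e: "edge G u v" for u v
  proof -
    have uv: "u \<in> {1..n}" "v \<in> {1..n}" using edge_range[OF e] by auto
    have "{u - 1, v - 1} \<in> edges G" using e unfolding edge_def by blast
    moreover have "Suc (u - 1) = u" "Suc (v - 1) = v" using uv by auto
    moreover have "L u \<noteq> 0" "L v \<noteq> 0" using range[OF uv(1)] range[OF uv(2)] by auto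
    ultimately show ?thesis
      using pl[unfolded partial_layering_def, THEN conjunct2, THEN conjunct1, rule_format, of "u - 1" "v - 1"]
      by simp
  qed
  show "card J \<le> q" if J: "J \<subseteq> {1..n}" "\<forall>u\<in>J. \<forall>v\<in>J. \<not> edge G u v" "\<forall>v\<in>J. L v = j" for J j
  proof (cases "J = {}")
    case False
    then obtain v where "v \<in> J" by blast
    then have j: "j > 0" using range[of v] J by auto
    let ?I = "(\<lambda>v. v - 1) ` J"
    have inj: "inj_on (\<lambda>v. v - 1) J"
    proof (rule inj_onI)
      fix x y assume xy: "x \<in> J" "y \<in> J" "x - 1 = y - 1"
      then have "1 \<le> x" "1 \<le> y" using J(1) by auto
      then show "x = y" using xy(3) by linarith
    qed
    have "independent G ?I"
      unfolding independent_def
    proof (intro conjI ballI)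
      show "?I \<subseteq> verts G" using J(1) vertex_iff by fastforce
      fix a b assume "a \<in> ?I" "b \<in> ?I"
      then obtain u v where uv: "u \<in> J" "v \<in> J" "a = u - 1" "b = v - 1" by blast
      then have "u \<noteq> 0" "v \<noteq> 0" using J(1) by auto
      then show "{a, b} \<notin> edges G" using J(2) uv unfolding edge_def by blast
    qed
    moreover have "\<forall>v\<in>?I. L (Suc v) = j" using J(1,3) by auto
    ultimately have "card ?I \<le> q"
      using pl[unfolded partial_layering_def, THEN conjunct2, THEN conjunct2, THEN conjunct2, THEN conjunct1]
        j by blast
    then show ?thesis using card_image[OF inj] by simp
  qed simp
qed

text \<open>Both numberings and both weight functions are related here: an optimum of the shifted graph
  for the new weights is one of the given graph for the given weights.\<close>
lemma solution_of_optimum: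
  fixes best :: nat
  assumes lay: "layered n q (edge G) L W"
    and J: "layered.indep n (edge G) J" "best = sum W J"
    and opt: "\<And>J. layered.indep n (edge G) J \<Longrightarrow> sum W J \<le> best"
  shows "mwis_solution (G, w) (filter (\<lambda>j. odd (best div 2 ^ j)) [0..<n])"
proof -
  interpret dp: layered n q "edge G" L W by (rule lay)
  let ?cw = "code_weight (numer w) (denom w) n"
  have W_sum: "sum W (Suc ` I) = sum ?cw I" if I: "I \<subseteq> {..<n}" for I
  proof -
    have "sum W (Suc ` I) = (\<Sum>i\<in>I. W (Suc i))" by (simp add: sum.reindex)
    also have "\<dots> = sum ?cw I"
    proof (rule sum.cong)
      fix i assume "i \<in> I"
      then have "i < n" using I by blast
      then show "W (Suc i) = ?cw i" by (simp add: W_def)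
    qed simp
    finally show ?thesis .
  qed
  have ind: "dp.indep (Suc ` I) \<longleftrightarrow> independent G I" for I
  proof -
    have "Suc ` I \<subseteq> {1..n} \<longleftrightarrow> I \<subseteq> verts G" using vertex_iff by auto
    moreover have "(\<forall>u\<in>Suc ` I. \<forall>v\<in>Suc ` I. \<not> edge G u v) \<longleftrightarrow> (\<forall>u\<in>I. \<forall>v\<in>I. {u, v} \<notin> edges G)"
      by (simp add: edge_def)
    ultimately show ?thesis unfolding dp.indep_def independent_def by blast
  qed
  have sub: "I \<subseteq> {..<n}" if "independent G I" for I
    using that vertex_iff unfolding independent_def by blast
  define I where "I = (\<lambda>v. v - 1) ` J"
  have "Suc (v - 1) = v" if "v \<in> J" for v using that J(1) unfolding dp.indep_def by auto
  then have JI: "J = Suc ` I" unfolding I_def image_image by (simp add: image_def)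
  have iI: "independent G I" using J(1) ind JI by simp
  have nonneg': "0 \<le> w i" if "i < n" for i using nonneg vertex_iff that by blast
  have best: "best = sum ?cw I" using J(2) JI W_sum[OF sub[OF iI]] by simp
  have "set (filter (\<lambda>j. odd (best div 2 ^ j)) [0..<n]) = I"
    using code_weight_bit[of n "denom w" I, OF den_pos sub[OF iI]] sub[OF iI] unfolding best by auto
  moreover have "sum w J' \<le> sum w I" if J': "independent G J'" for J'
  proof (rule code_weight_reflects_order[of n "denom w" w "numer w"])
    show "sum ?cw J' \<le> sum ?cw I"
      using opt[of "Suc ` J'"] ind[of J'] J' W_sum[OF sub[OF J']] unfolding best by simp
  qed (use den_pos numer_denom(1) nonneg' sub[OF iI] sub[OF J'] in blast)+
  ultimately show ?thesis using iI by (simp add: max_weight_independent_def)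
qed

lemma runs_mwis_code:
  "runs B K (mwis_code q) (initial_state (encode_mwis (G, w))) (steps q n)
     (\<lambda>s'. mwis_solution (G, w) (output_list s'))"
proof (rule runs_mono)
  let ?Q = "\<lambda>s'. mwis_solution (G, w) (output_list s')"
  let ?s = "initial_state (encode_mwis (G, w))"
  let ?Tl = "n * ((2 + ((Suc n * ((5 * n + 16) + 2) + 2) + 4)) + 2) + 2"
  let ?Tp = "(q * (1 + 2) + 2) + 1"
  let ?Tt = "n * ((M * M * ((3 + ((q * ((8 + (2 * q * (5 + 2) + 2)) + 2) + 2) + 10)) + 2) + 2) + 2) + 2"
  let ?To = "1 + (n * (7 + 2) + 2)"
  show "runs B K (mwis_code q) ?s (7 + ((n * (1 + 2) + 2) + ((n * (3 + 2) + 2) + (?Tl + (?Tp + (?Tt + ?To)))))) ?Q"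
    unfolding mwis_code_def
  proof (rule runs_Seq[OF runs_setup[OF refl]], elim conjE)
    fix s1
    assume s1: "inp s1" "regs s1 rN = Suc n" "regs s1 rq = q" "regs s1 rqq = 2 * q" "regs s1 rD = 1"
      "regs s1 rP = 1" "regs s1 rM = 1" "regs s1 rbest = 0" "\<forall>a. a \<noteq> 0 \<longrightarrow> arrays s1 a = (\<lambda>_. 0)"
    show "runs B K (denominators_code ;; weights_code ;; layer_code ;; power_code ;; table_code ;; output_code) s1
       ((n * (1 + 2) + 2) + ((n * (3 + 2) + 2) + (?Tl + (?Tp + (?Tt + ?To))))) ?Q"
    proof (rule runs_Seq[OF runs_denominators[OF s1(1,5)]])
      fix s2
      assume so2: "same_off (wregs denominators_code) (warrs denominators_code) s1 s2"
        and D: "regs s2 rD = common_multiple (denom w) n"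
      have r2: "regs s2 rN = Suc n" "regs s2 rq = q" "regs s2 rqq = 2 * q" "regs s2 rP = 1" "regs s2 rM = 1"
          "regs s2 rbest = 0" "\<forall>a. a \<noteq> 0 \<longrightarrow> arrays s2 a = (\<lambda>_. 0)"
        using same_offD[OF so2] s1 by (simp_all add: denominators_code_def)
      have i2: "inp s2" by (rule inp_same_off[OF s1(1) so2]) (auto simp: denominators_code_def)
      show "runs B K (weights_code ;; layer_code ;; power_code ;; table_code ;; output_code) s2
         ((n * (3 + 2) + 2) + (?Tl + (?Tp + (?Tt + ?To)))) ?Q"
      proof (rule runs_Seq[OF runs_weights[OF i2 D r2(4)]])
        show "arrays s2 aW = (\<lambda>_. 0)" using r2(7) by simp
        fix s3
        assume so3: "same_off (wregs weights_code) (warrs weights_code) s2 s3" and W: "arrays s3 aW = W"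
        have r3: "regs s3 rN = Suc n" "regs s3 rq = q" "regs s3 rqq = 2 * q" "regs s3 rM = 1"
            "regs s3 rbest = 0" "arrays s3 1 = (\<lambda>_. 0)" "arrays s3 alay = (\<lambda>_. 0)" "arrays s3 aF = (\<lambda>_. 0)"
          using same_offD[OF so3] r2 by (simp_all add: weights_code_def)
        have i3: "inp s3" by (rule inp_same_off[OF i2 so3]) (auto simp: weights_code_def)
        show "runs B K (layer_code ;; power_code ;; table_code ;; output_code) s3 (?Tl + (?Tp + (?Tt + ?To))) ?Q"
        proof (rule runs_Seq[OF runs_layer[OF i3 r3(1,7)]])
          fix s4
          assume so4: "same_off (wregs layer_code) (warrs layer_code) s3 s4"
            and pl: "partial_layering G q n (layer_of s4)"
          note lay = layering_layered[OF pl]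
          have r4: "regs s4 rN = Suc n" "regs s4 rq = q" "regs s4 rqq = 2 * q" "regs s4 rM = 1"
              "regs s4 rbest = 0" "arrays s4 1 = (\<lambda>_. 0)" "arrays s4 aF = (\<lambda>_. 0)" "arrays s4 aW = W"
            using same_offD[OF so4] r3 W
            by (simp_all add: layer_code_def layer_vertex_code_def layer_test_code_def)
          have i4: "inp s4" by (rule inp_same_off[OF i3 so4])
            (auto simp: layer_code_def layer_vertex_code_def layer_test_code_def)
          show "runs B K (power_code ;; table_code ;; output_code) s4 (?Tp + (?Tt + ?To)) ?Q"
          proof (rule runs_Seq[OF runs_power[OF r4(1,2,4)]])
            fix s5
            assume so5: "same_off (wregs power_code) (warrs power_code) s4 s5"
              and M5: "regs s5 rM = M \<and> regs s5 rMM = M * M"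
            have r5: "regs s5 rN = Suc n" "regs s5 rq = q" "regs s5 rqq = 2 * q"
                "regs s5 rbest = 0" "arrays s5 = arrays s4"
              using same_offD[OF so5] r4 by (auto simp: power_code_def)
            have i5: "inp s5" by (rule inp_same_off[OF i4 so5]) (auto simp: power_code_def)
            have tab: "runs B K table_code s5 ?Tt
              (\<lambda>s'. (\<exists>J. layered.indep n (edge G) J \<and> regs s' rbest = sum W J) \<and>
                (\<forall>J. layered.indep n (edge G) J \<longrightarrow> sum W J \<le> regs s' rbest))"
              by (rule runs_table[OF lay]) (use i5 r5 r4 M5 in auto)
            show "runs B K (table_code ;; output_code) s5 (?Tt + ?To) ?Q"
            proof (rule runs_Seq[OF tab])
              fix s6
              assume so6: "same_off (wregs table_code) (warrs table_code) s5 s6"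
                and best: "(\<exists>J. layered.indep n (edge G) J \<and> regs s6 rbest = sum W J) \<and>
                  (\<forall>J. layered.indep n (edge G) J \<longrightarrow> sum W J \<le> regs s6 rbest)"
              have r6: "regs s6 rn = n" "arrays s6 1 = (\<lambda>_. 0)"
                using same_offD[OF so6] i5 r5 r4
                by (simp_all add: inp_def table_code_def digit_code_def digit_test_code_def commit_code_def Let_def)
              obtain J where J: "layered.indep n (edge G) J" "regs s6 rbest = sum W J" using best by blast
              have sol: "mwis_solution (G, w) (filter (\<lambda>j. odd (regs s6 rbest div 2 ^ j)) [0..<n])"
                by (rule solution_of_optimum[OF lay J]) (use best in blast)
              show "runs B K output_code s6 ?To ?Q"
                by (rule runs_mono[OF runs_output[OF r6]]) (use sol in simp_all)
            qed
          qed
        qed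
      qed
    qed
  qed
  show "7 + ((n * (1 + 2) + 2) + ((n * (3 + 2) + 2) + (?Tl + (?Tp + (?Tt + ?To))))) \<le> steps q n"
    unfolding steps_def by (simp add: algebra_simps)
qed

end

section \<open>Polynomial running time\<close>

lemma bit_len_pos: "1 \<le> bit_len x"
  unfolding bit_len_def by simp

lemma bit_len_le_input_size: "x \<in> set xs \<Longrightarrow> bit_len x \<le> input_size xs"
  unfolding input_size_def by (induction xs) auto

lemma length_le_input_size: "length xs \<le> input_size xs"
  unfolding input_size_def
proof (induction xs)
  case (Cons x xs) then show ?case using bit_len_pos[of x] by simp
qed simp

lemma less_pow_input_size: "x \<in> set xs \<Longrightarrow> x < 2 ^ input_size xs"
proof -
  assume "x \<in> set xs"
  then have "(2::nat) ^ bit_len x \<le> 2 ^ input_size xs"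
    by (intro power_increasing bit_len_le_input_size) simp_all
  then show ?thesis using less_bit_len[of x] by linarith
qed

lemma input_size_append: "input_size (xs @ ys) = input_size xs + input_size ys"
  unfolding input_size_def by simp

lemma input_size_concat: "input_size (concat (map f [0..<n])) = (\<Sum>i<n. input_size (f i))"
  by (induction n) (simp_all add: input_size_append, simp add: input_size_def)

lemma bounded_initial_state:
  assumes "input_size xs \<le> B" "1 \<le> B"
  shows "bounded B (initial_state xs)"
proof -
  have le: "(2::nat) ^ input_size xs \<le> 2 ^ B" using assms(1) by (intro power_increasing) simp_all
  have "length xs < 2 ^ input_size xs"
    using length_le_input_size[of xs] less_exp[of "input_size xs"] by linarith
  moreover have "xs ! (i - 1) < 2 ^ B" if "i \<noteq> 0" "i \<le> length xs" for i
    by (rule order_less_le_trans[OF less_pow_input_size le]) (use that in simp)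
  ultimately have "arrays (initial_state xs) a i < 2 ^ B" for a i
    using le unfolding initial_state_def by (auto intro: order_less_le_trans)
  then show ?thesis using assms(2) unfolding bounded_def initial_state_def by simp
qed

text \<open>The product of the denominators has at most the sum of their lengths as its length. The
  factors \<open>2\<close> are paid for by the numerators, each of which takes up at least one bit.\<close>
lemma common_multiple_le:
  "common_multiple (denom w) (card (verts G)) \<le> 2 ^ input_size (encode_mwis (G, w))"
proof -
  let ?n = "card (verts G)"
  have "common_multiple (denom w) ?n \<le> (\<Prod>i<?n. 2 ^ input_size [numer w i, denom w i])"
    unfolding common_multiple_def
  proof (rule prod_mono, intro conjI)
    fix i
    have "2 * denom w i \<le> 2 ^ 1 * 2 ^ bit_len (denom w i)" using less_bit_len[of "denom w i"] by simp
    also have "\<dots> \<le> 2 ^ bit_len (numer w i) * 2 ^ bit_len (denom w i)"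
      by (intro mult_le_mono1 power_increasing bit_len_pos) simp
    also have "\<dots> = 2 ^ input_size [numer w i, denom w i]" by (simp add: input_size_def power_add)
    finally show "2 * denom w i \<le> 2 ^ input_size [numer w i, denom w i]" .
  qed simp
  also have "\<dots> = 2 ^ (\<Sum>i<?n. input_size [numer w i, denom w i])" by (simp add: power_sum)
  also have "\<dots> \<le> 2 ^ input_size (encode_mwis (G, w))"
  proof (intro power_increasing)
    show "(\<Sum>i<?n. input_size [numer w i, denom w i]) \<le> input_size (encode_mwis (G, w))"
      unfolding encode_mwis_alt using input_size_concat[of "\<lambda>i. [numer w i, denom w i]" ?n]
      by (simp add: input_size_append input_size_def)
  qed simp
  finally show ?thesis .
qed

text \<open>With input size \<open>Z\<close>, the common multiple and the numerators are at most \<open>2 ^ Z\<close>, the new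
  weights at most \<open>2 ^ (2 * Z + 1)\<close>, and a step of the table is one of at most
  \<open>2 ^ (2 * q * Z)\<close> numbers; the chosen \<open>B\<close> exceeds every exponent that occurs.\<close>
lemma instance_run_bounds:
  assumes "0 < q" "simple_graph G" "\<not> induced_minor (star q) G"
    "verts G = {0..<card (verts G)}" "\<forall>v\<in>verts G. 0 \<le> w v"
  defines "Z \<equiv> input_size (encode_mwis (G, w))"
  shows "instance_run q G w (2 * q * Z + 3 * Z + 2 * q + 2) (2 ^ (2 * Z + 1))"
proof
  let ?n = "card (verts G)"
  let ?B = "2 * q * Z + 3 * Z + 2 * q + 2"
  have len: "1 + ?n * ?n + 2 * ?n \<le> Z"
    using length_le_input_size[of "encode_mwis (G, w)"] encode_mwis_nth(1)[of G w] unfolding Z_def by simp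
  then have nZ: "Suc ?n \<le> Z" by linarith
  have pow: "(2::nat) ^ a < 2 ^ ?B" if "a < ?B" for a
    by (rule power_strict_increasing[OF that]) simp
  have Z2: "Z < 2 ^ Z" by (rule less_exp)
  show "Suc ?n < 2 ^ ?B" using nZ Z2 pow[of Z] by linarith
  have "2 * q < 2 ^ (2 * q)" by (rule less_exp)
  also have "\<dots> < 2 ^ ?B" by (rule pow) simp
  finally show "2 * q < 2 ^ ?B" .
  show "2 ^ ?n < (2::nat) ^ ?B" by (rule pow) (use nZ in linarith)
  have common: "common_multiple (denom w) ?n \<le> 2 ^ Z" unfolding Z_def by (rule common_multiple_le)
  also have "\<dots> < 2 ^ ?B" by (rule pow) simp
  finally show "common_multiple (denom w) ?n < 2 ^ ?B" .
  show "code_weight (numer w) (denom w) ?n i \<le> 2 ^ (2 * Z + 1)" if i: "i < ?n" for i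
  proof -
    have "Suc (?n * ?n + 2 * i) < length (encode_mwis (G, w))"
      unfolding encode_mwis_nth using i by simp
    then have "numer w i \<in> set (encode_mwis (G, w))"
      using encode_mwis_nth(4)[OF i, of w] by (metis nth_mem)
    then have "numer w i \<le> 2 ^ Z" unfolding Z_def by (intro less_imp_le less_pow_input_size)
    moreover have "common_multiple (denom w) ?n div denom w i \<le> 2 ^ Z"
      using common div_le_dividend le_trans by blast
    ultimately have "numer w i * (common_multiple (denom w) ?n div denom w i) \<le> 2 ^ Z * 2 ^ Z"
      by (rule mult_le_mono)
    moreover have "(2::nat) ^ i \<le> 2 ^ (Z + Z)" using i nZ by (intro power_increasing) simp_all
    ultimately show ?thesis unfolding code_weight_def by (simp add: power_add mult_2)
  qed
  have "?n + q < 2 ^ (Z + q)" using nZ less_exp[of "Z + q"] by linarith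
  then have "(?n + q) * 2 ^ (2 * Z + 1) \<le> 2 ^ (Z + q) * 2 ^ (2 * Z + 1)"
    by (intro mult_le_mono1) simp
  also have "\<dots> = 2 ^ (3 * Z + q + 1)" by (simp flip: power_add add: algebra_simps)
  also have "\<dots> < 2 ^ ?B" by (rule pow) simp
  finally show "(?n + q) * 2 ^ (2 * Z + 1) < 2 ^ ?B" .
  have "Suc ?n \<le> 2 ^ Z" using nZ Z2 by linarith
  then have "Suc ?n ^ q \<le> (2 ^ Z) ^ q" by (rule power_mono) simp
  then have "Suc ?n ^ q * Suc ?n ^ q \<le> (2 ^ Z) ^ q * (2 ^ Z) ^ q" by (intro mult_le_mono)
  also have "\<dots> = 2 ^ (2 * q * Z)" by (simp flip: power_mult power_add add: algebra_simps)
  also have "\<dots> < 2 ^ ?B" by (rule pow) simp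
  finally show "Suc ?n ^ q * Suc ?n ^ q < 2 ^ ?B" .
qed (use assms in auto)

definition steps_poly :: "nat \<Rightarrow> nat poly" where
  "steps_poly q = (let x = [:0, 1:]; y = [:1, 1:] in of_nat (21 + 3 * q) +
     x * (of_nat 31 + y * (of_nat 5 * x + of_nat 18) + y ^ q * y ^ q * of_nat (q * (14 * q + 12) + 17)))"

lemma poly_steps_poly: "poly (steps_poly q) x = steps q x"
  unfolding steps_poly_def steps_def Let_def poly_add poly_mult poly_power poly_of_nat poly_pCons poly_0
  by simp

lemma steps_mono: "n \<le> n' \<Longrightarrow> steps q n \<le> steps q n'"
  unfolding steps_def by (intro add_mono mult_le_mono power_mono) simp_all

text \<open>The number of steps times the price of an expression, \<open>B * K\<^sup>2\<close>, with \<open>B\<close> as a linear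
  polynomial in the input size.\<close>
definition time_poly :: "nat \<Rightarrow> nat poly" where
  "time_poly q = steps_poly q * ([:2 * q + 2, 2 * q + 3:] * [:(100 + 2 * q)\<^sup>2:])"

theorem theorem8p1:
  fixes q :: nat
  assumes "q > 0"
  shows "mwis_poly_time {G. simple_graph G \<and> \<not> induced_minor (star q) G}"
  unfolding mwis_poly_time_def poly_time_solvable_def
proof (intro exI[of _ "mwis_code q"] exI[of _ "time_poly q"] ballI, clarsimp)
  fix G :: "nat ugraph" and w :: "nat \<Rightarrow> rat"
  assume G: "simple_graph G" "\<not> induced_minor (star q) G" "verts G = {0..<card (verts G)}"
      "\<forall>v\<in>verts G. 0 \<le> w v"
  let ?xs = "encode_mwis (G, w)"
  let ?Z = "input_size ?xs"
  let ?B = "2 * q * ?Z + 3 * ?Z + 2 * q + 2"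
  let ?K = "100 + 2 * q"
  interpret instance_run q G w ?B "2 ^ (2 * ?Z + 1)" by (rule instance_run_bounds[OF assms G])
  have "bounded ?B (initial_state ?xs)" by (rule bounded_initial_state) simp_all
  then obtain t s where s: "exec (mwis_code q) (initial_state ?xs) t s"
      "t \<le> steps q n * (?B * ?K\<^sup>2)" "mwis_solution (G, w) (output_list s)"
    using runs_mwis_code[of ?K] fits_mwis_code[of q] unfolding runs_def by blast
  have "n \<le> ?Z" using length_le_input_size[of ?xs] encode_mwis_nth(1)[of G w] by simp
  then have "steps q n * (?B * ?K\<^sup>2) \<le> steps q ?Z * (?B * ?K\<^sup>2)"
    by (intro mult_le_mono1 steps_mono)
  also have "\<dots> = poly (time_poly q) ?Z"
    unfolding time_poly_def by (simp add: poly_steps_poly algebra_simps)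
  finally have "t \<le> poly (time_poly q) ?Z" using s(2) by linarith
  then show "\<exists>t s. exec (mwis_code q) (initial_state ?xs) t s \<and> t \<le> poly (time_poly q) ?Z \<and>
      distinct (output_list s) \<and> max_weight_independent G w (set (output_list s))"
    using s by auto
qed

end
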